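(* Let $f$ be a meromorphic function in $\mathbb{C}$, transcendental or rational of degree at least two. Then $f$ is hyperbolic with respect to the Euclidean metric if and only if there exist $c>0$, $\lambda>1$ and $\delta>0$ such that, for each $n\in\mathbb{N}$, $$d(f^n(z),f^n(w))\geq c\lambda^n d(z,w)$$ whenever $z$ and $w$ lie in a common component of $f^{-n}(B(a,\delta))$ for some $a\in\mathcal{J}_f$.
   Context: Iterates: $f^0(z)=z$, $f^n=f\circ f^{n-1}$; if $f$ is transcendental (essential singularity at $\infty$), $f^n$ is defined and meromorphic on $\mathbb{C}\setminus\bigcup_{j=1}^{n-1}f^{-j}(\infty)$, and $f^{-n}(A)$ is the set of points $z$ in the domain of $f^n$ with $f^n(z)\in A$. The Fatou set $\mathcal{F}_f$ is the set of $z\in\widehat{\mathbb{C}}=\mathbb{C}\cup\{\infty\}$ having a neighborhood on which all iterates are well defined and form a normal family; $\widehat{\mathcal{J}}_f=\widehat{\mathbb{C}}\setminus\mathcal{F}_f$; $\mathcal{J}_f=\widehat{\mathcal{J}}_f\setminus\{\infty\}$; $\mathcal{J}_f(\infty)=\bigcup_{j=0}^\infty f^{-j}(\infty)$. $\mathrm{sing}(f^{-1})$ is the closure in $\mathbb{C}$ of the set of finite critical and asymptotic values of $f$. The post-singular set $\mathcal{P}(f)$ is the closure in $\widehat{\mathbb{C}}$ of $\bigcup_{n=0}^\infty f^n\big(\mathrm{sing}(f^{-1})\setminus\bigcup_{j=0}^{n-1}f^{-j}(\infty)\big)$. $d$ is the Euclidean distance on $\mathbb{C}$ and $B(a,r)$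 the Euclidean disk. $f$ is called hyperbolic with respect to the Euclidean metric if both of the following hold: (i) $\mathrm{dist}(\mathcal{P}(f),\mathcal{J}_f)>0$, the Euclidean distance (between the finite parts of these sets); (ii) for some $c>0$ and some $\lambda>1$, $|(f^n)'(z)|\geq c\lambda^n$ for all $n\geq1$ and all $z\in\mathcal{J}_f\setminus\mathcal{J}_f(\infty)$. *)

theory Defs
  imports "HOL-Complex_Analysis.Complex_Analysis" "HOL-Computational_Algebra.Computational_Algebra"
begin

text \<open>
  The Riemann sphere, metrized by stereographic projection to the unit sphere, i.e. by the
  chordal metric.
\<close>

datatype rsphere = Fin (fin: complex) | Infty

primrec stereo :: "rsphere \<Rightarrow> complex \<times> real" where
  "stereo (Fin z) = ((2 / (1 + (cmod z)\<^sup>2)) *\<^sub>R z, ((cmod z)\<^sup>2 - 1) / ((cmod z)\<^sup>2 + 1))"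
| "stereo Infty = (0, 1)"

lemma stereo_inject: "stereo x = stereo y \<longleftrightarrow> x = y"
proof
  have pos: "1 + (cmod z)\<^sup>2 > 0" for z :: complex
    by (simp add: add_pos_nonneg)
  have snd_stereo: "snd (stereo (Fin z)) = 1 - 2 / (1 + (cmod z)\<^sup>2)" for z
    using pos[of z] by (simp add: field_simps)
  assume eq: "stereo x = stereo y"
  show "x = y"
  proof (cases x; cases y)
    fix z w assume xy: "x = Fin z" "y = Fin w"
    have 1: "2 / (1 + (cmod z)\<^sup>2) = 2 / (1 + (cmod w)\<^sup>2)"
      using arg_cong[OF eq, of snd] unfolding xy snd_stereo by simp
    have "(2 / (1 + (cmod z)\<^sup>2)) *\<^sub>R z = (2 / (1 + (cmod w)\<^sup>2)) *\<^sub>R w"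
      using arg_cong[OF eq, of fst] unfolding xy by simp
    hence "(2 / (1 + (cmod w)\<^sup>2)) *\<^sub>R z = (2 / (1 + (cmod w)\<^sup>2)) *\<^sub>R w"
      unfolding 1 .
    thus "x = y" using pos[of w] xy by simp
  next
    fix z assume xy: "x = Fin z" "y = Infty"
    show "x = y"
      using arg_cong[OF eq, of snd] pos[of z] unfolding xy snd_stereo by simp
  next
    fix z assume xy: "x = Infty" "y = Fin z"
    show "x = y"
      using arg_cong[OF eq, of snd] pos[of z] unfolding xy snd_stereo by simp
  qed simp
qed simp

instantiation rsphere :: metric_space
begin

definition dist_rsphere :: "rsphere \<Rightarrow> rsphere \<Rightarrow> real" where
  "dist_rsphere x y = dist (stereo x) (stereo y)"

definition uniformity_rsphere :: "(rsphere \<times> rsphere) filter" where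
  "uniformity_rsphere = (INF e\<in>{0<..}. principal {(x, y). dist x y < e})"

definition open_rsphere :: "rsphere set \<Rightarrow> bool" where
  "open_rsphere U \<longleftrightarrow> (\<forall>x\<in>U. eventually (\<lambda>(x', y). x' = x \<longrightarrow> y \<in> U) uniformity)"

instance
proof
  fix x y z :: rsphere
  show "dist x y = 0 \<longleftrightarrow> x = y"
    by (simp add: dist_rsphere_def stereo_inject)
  show "dist x y \<le> dist x z + dist y z"
    unfolding dist_rsphere_def by (rule dist_triangle2)
qed (simp_all only: uniformity_rsphere_def open_rsphere_def)

end

text \<open>
  A meromorphic function in the plane is a function with
  \<open>f nicely_meromorphic_on UNIV\<close>: it is analytic except at its poles, where it takes the
  dummy value 0.  The corresponding map into the sphere is \<open>to_sphere f\<close>.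
\<close>

definition to_sphere :: "(complex \<Rightarrow> complex) \<Rightarrow> complex \<Rightarrow> rsphere" where
  "to_sphere f z = (if is_pole f z then Infty else Fin (f z))"

text \<open>
  Essential singularity at infinity: there is no limit in the sphere.  This also covers the case
  of poles accumulating at infinity.
\<close>

definition transcendental :: "(complex \<Rightarrow> complex) \<Rightarrow> bool" where
  "transcendental f \<longleftrightarrow> \<not> (\<exists>l. (to_sphere f \<longlongrightarrow> l) at_infinity)"

text \<open>At zeros of \<open>q\<close> the quotient below is 0, in accordance with the dummy value at poles.\<close>

definition rational_of_degree :: "nat \<Rightarrow> (complex \<Rightarrow> complex) \<Rightarrow> bool" where
  "rational_of_degree d f \<longleftrightarrow>
     (\<exists>p q. q \<noteq> 0 \<and> coprime p q \<and> max (degree p) (degree q) = d \<and>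
            f = (\<lambda>z. poly p z / poly q z))"

text \<open>
  \<open>f\<close> as a partial self-map of the sphere: undefined at infinity if \<open>f\<close> is
  transcendental, continuously extended to infinity otherwise.
\<close>

definition sphere_map :: "(complex \<Rightarrow> complex) \<Rightarrow> rsphere \<rightharpoonup> rsphere" where
  "sphere_map f x = (case x of
      Fin z \<Rightarrow> Some (to_sphere f z)
    | Infty \<Rightarrow> if transcendental f then None else Some (Lim at_infinity (to_sphere f)))"

primrec iter :: "(complex \<Rightarrow> complex) \<Rightarrow> nat \<Rightarrow> rsphere \<rightharpoonup> rsphere" where
  "iter f 0 = Some"
| "iter f (Suc n) = sphere_map f \<circ>\<^sub>m iter f n"

definition preimage :: "(complex \<Rightarrow> complex) \<Rightarrow> nat \<Rightarrow> rsphere set \<Rightarrow> rsphere set" where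
  "preimage f n A = {x \<in> dom (iter f n). the (iter f n x) \<in> A}"

text \<open>
  The iterate in the coordinate of the plane; only meaningful where \<open>f\<^sup>n\<close> is
  defined and finite.  (For rational \<open>f\<close> the orbit may pass through infinity before time
  \<open>n\<close>, so this is not \<open>f ^^ n\<close>.)
\<close>

definition plane_iter :: "(complex \<Rightarrow> complex) \<Rightarrow> nat \<Rightarrow> complex \<Rightarrow> complex" where
  "plane_iter f n z = fin (the (iter f n (Fin z)))"

text \<open>
  Locally uniform convergence is with respect to the chordal metric, so that limits taking the
  value infinity are allowed.
\<close>

definition normal_family :: "rsphere set \<Rightarrow> (rsphere \<Rightarrow> rsphere) set \<Rightarrow> bool" where
  "normal_family U \<F> \<longleftrightarrow>
     (\<forall>g :: nat \<Rightarrow> rsphere \<Rightarrow> rsphere. range g \<subseteq> \<F> \<longrightarrow>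
        (\<exists>h r. strict_mono (r :: nat \<Rightarrow> nat) \<and>
           (\<forall>K. compact K \<and> K \<subseteq> U \<longrightarrow> uniform_limit K (g \<circ> r) h sequentially)))"

definition Fatou :: "(complex \<Rightarrow> complex) \<Rightarrow> rsphere set" where
  "Fatou f = {x. \<exists>U. open U \<and> x \<in> U \<and> (\<forall>n. U \<subseteq> dom (iter f n)) \<and>
                     normal_family U (range (\<lambda>n x. the (iter f n x)))}"

definition Julia :: "(complex \<Rightarrow> complex) \<Rightarrow> complex set" where
  "Julia f = {z. Fin z \<notin> Fatou f}"

definition Julia_infty :: "(complex \<Rightarrow> complex) \<Rightarrow> rsphere set" where
  "Julia_infty f = (\<Union>j. preimage f j {Infty})"

text \<open>
  For rational \<open>f\<close> the point at infinity belongs to the domain, hence it may be a critical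
  point (tested in the coordinate \<open>1 / z\<close>).  For transcendental \<open>f\<close> the second set is empty.
\<close>

definition finite_critical_values :: "(complex \<Rightarrow> complex) \<Rightarrow> complex set" where
  "finite_critical_values f =
     {f z | z. \<not> is_pole f z \<and> deriv f z = 0} \<union>
     {v. sphere_map f Infty = Some (Fin v) \<and>
         deriv (\<lambda>w. if w = 0 then v else f (1 / w)) 0 = 0}"

text \<open>
  Asymptotic values are limits along curves leading to the essential singularity, so a rational
  function has none.
\<close>

definition finite_asymptotic_values :: "(complex \<Rightarrow> complex) \<Rightarrow> complex set" where
  "finite_asymptotic_values f =
     {a. transcendental f \<and>
         (\<exists>\<gamma> :: real \<Rightarrow> complex. continuous_on {0..} \<gamma> \<and> filterlim \<gamma> at_infinity at_top \<and>
              ((\<lambda>t. to_sphere f (\<gamma> t)) \<longlongrightarrow> Fin a) at_top)}"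

definition sing_inv :: "(complex \<Rightarrow> complex) \<Rightarrow> complex set" where
  "sing_inv f = closure (finite_critical_values f \<union> finite_asymptotic_values f)"

definition post_singular :: "(complex \<Rightarrow> complex) \<Rightarrow> rsphere set" where
  "post_singular f =
     closure (\<Union>n. (\<lambda>x. the (iter f n x)) `
                     (Fin ` sing_inv f - (\<Union>j<n. preimage f j {Infty})))"

text \<open>
  Extended-real valued, so that the distance to the empty set is infinite; the library's
  \<open>setdist\<close> is 0 in that case.
\<close>

definition set_distance :: "complex set \<Rightarrow> complex set \<Rightarrow> ereal" where
  "set_distance A B = (INF (x, y) \<in> A \<times> B. ereal (dist x y))"

definition euclidean_hyperbolic :: "(complex \<Rightarrow> complex) \<Rightarrow> bool" where
  "euclidean_hyperbolic f \<longleftrightarrow>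
     set_distance {z. Fin z \<in> post_singular f} (Julia f) > 0 \<and>
     (\<exists>c>0. \<exists>\<mu>>1. \<forall>n\<ge>1. \<forall>z\<in>Julia f. Fin z \<notin> Julia_infty f \<longrightarrow>
        cmod (deriv (plane_iter f n) z) \<ge> c * \<mu> ^ n)"

end

theory Submission
  imports Defs
begin

text \<open>
  If the inverse iterates expand by definite factors on components of preimages of small disks
  about the Julia set, the preimage components contain neither critical points nor paths to the essential
  singularity, which keeps the post-singular set away from the Julia set.

  Conversely, if infinity is in the Fatou set, the Julia set is compact and (ii) alone makes a fixed
  iterate locally expanding near it.  Otherwise hyperbolicity forces infinity to be fixed or essential:
  the Julia set has no isolated prepoles (by Picard's theorem, or by Schottky's and Montel's theorems for
  rational functions), so points satisfying (ii) accumulate at infinity, whereas \<open>f'\<close> tends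
  to \<open>0\<close> there if \<open>f(\<infinity>)\<close> is finite.  Then disks off the post-singular set
  lift univalently along all iterates, and Koebe's distortion theorem spreads the bound in (ii) from one
  point of the Julia set to the whole component.
\<close>

section \<open>Removable singularities and the Riemann sphere\<close>

text \<open>Two features of the definitions shape the proof: \<open>post_singular\<close> drops a
  singular orbit once it meets infinity, and (ii) speaks only of Julia points that are not prepoles.
  Branches of the iterates can be built by lifting one step at a time off the post-singular set if
  an orbit that ends at a finite point never passes through infinity; this is
  \<open>no_return\<close>. A rational map with a finite value at infinity is therefore either in
  the compact case, where the post-singular set does not enter, or it contradicts (ii). And (ii)
  helps near every Julia point only if non-prepoles are dense in the Julia set, which is why
  isolated prepoles have to be excluded. Both cases end in \<open>branches_at\<close>: inverse
  branches on disks of a radius independent of \<open>n\<close>, with geometrically decaying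
  Lipschitz constants. One branch covers a whole component of the preimage, so its Lipschitz bound
  read backwards is the expansion.\<close>

lemma holomorphic_onI_analytic_at: "(\<And>w. w \<in> S \<Longrightarrow> g analytic_on {w}) \<Longrightarrow> g holomorphic_on S"
  by (rule analytic_imp_holomorphic) (subst analytic_on_analytic_at, blast)

lemma analytic_at_compose_inverse:
  assumes "g analytic_on {inverse w}" "w \<noteq> (0 :: complex)"
  shows "(\<lambda>w. g (inverse w)) analytic_on {w}"
proof -
  have "inverse analytic_on {w}" using assms(2) by (intro analytic_intros) auto
  then have "(g \<circ> inverse) analytic_on {w}" by (rule analytic_on_compose_gen) (use assms in auto)
  then show ?thesis by (simp add: o_def)
qed

lemma holomorphic_extend_limit:
  assumes an: "\<And>w. w \<in> ball 0 s - {0} \<Longrightarrow> k analytic_on {w}" and lim: "(k \<longlongrightarrow> v) (at 0)"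
  shows "(\<lambda>w. if w = 0 then v else k w) holomorphic_on ball 0 s"
proof (rule no_isolated_singularity[of _ _ "{0}"])
  let ?k = "\<lambda>w. if w = 0 then v else k w"
  show hol: "?k holomorphic_on (ball 0 s - {0})"
    by (rule holomorphic_transform[OF holomorphic_onI_analytic_at[OF an]]) auto
  have lim': "(?k \<longlongrightarrow> v) (at 0)"
    by (rule Lim_transform_eventually[OF lim]) (auto simp: eventually_at_filter)
  show "continuous_on (ball 0 s) ?k" unfolding continuous_on_eq_continuous_at[OF open_ball]
  proof
    fix w assume w: "w \<in> ball (0::complex) s"
    show "isCont ?k w"
    proof (cases "w = 0")
      case True
      then show ?thesis using lim' by (simp add: isCont_def)
    next
      case False
      have "open (ball (0::complex) s - {0})" by auto
      then show ?thesis
        using holomorphic_on_imp_continuous_on[OF hol] w False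
        by (metis DiffI continuous_on_eq_continuous_at singletonD)
    qed
  qed
qed auto

lemma norm_inverse_greater:
  assumes "R > 0" "w \<in> ball 0 (1 / R) - {0}"
  shows "norm (inverse w :: complex) > R"
proof -
  have "norm w < 1 / R" "norm w > 0" using assms(2) by auto
  then have "R < 1 / norm w" using assms(1) by (simp add: pos_less_divide_eq mult.commute)
  then show ?thesis by (simp add: norm_divide inverse_eq_divide)
qed

lemma tendsto_stereo_iff: "((\<lambda>x. stereo (g x)) \<longlongrightarrow> stereo l) F \<longleftrightarrow> (g \<longlongrightarrow> l) F"
  unfolding tendsto_iff dist_rsphere_def ..

lemma continuous_on_Fin [continuous_intros]:
  assumes "continuous_on A g"
  shows "continuous_on A (\<lambda>z. Fin (g z))"
  unfolding continuous_on_def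
proof
  fix x assume "x \<in> A"
  then have g: "(g \<longlongrightarrow> g x) (at x within A)" using assms by (auto simp: continuous_on_def)
  have "1 + (cmod (g x))\<^sup>2 \<noteq> 0" "(cmod (g x))\<^sup>2 + 1 \<noteq> 0" by (smt (verit) zero_le_power2)+
  then have "((\<lambda>z. stereo (Fin (g z))) \<longlongrightarrow> stereo (Fin (g x))) (at x within A)"
    unfolding stereo.simps by (intro tendsto_intros g)
  then show "((\<lambda>z. Fin (g z)) \<longlongrightarrow> Fin (g x)) (at x within A)" by (simp only: tendsto_stereo_iff)
qed

lemma tendsto_Fin_iff: "((\<lambda>x. Fin (g x)) \<longlongrightarrow> Fin l) F \<longleftrightarrow> (g \<longlongrightarrow> l) F"
proof
  assume "(g \<longlongrightarrow> l) F"
  moreover have "isCont Fin l"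
    using continuous_on_Fin[OF continuous_on_id, of UNIV] by (simp add: continuous_on_eq_continuous_at)
  ultimately show "((\<lambda>x. Fin (g x)) \<longlongrightarrow> Fin l) F" by (rule isCont_tendsto_compose[rotated])
next
  \<comment> \<open>Inverse stereographic projection: divide the horizontal coordinate by one minus
    the height. It is continuous away from the north pole.\<close>
  have eq: "z = (1 / (1 - snd (stereo (Fin z)))) *\<^sub>R fst (stereo (Fin z))" for z
  proof -
    have "1 + (cmod z)\<^sup>2 > 0" by (simp add: add_pos_nonneg)
    then have "1 - snd (stereo (Fin z)) = 2 / (1 + (cmod z)\<^sup>2)"
        "1 / (2 / (1 + (cmod z)\<^sup>2)) * (2 / (1 + (cmod z)\<^sup>2)) = 1"
      by (auto simp: field_simps)
    then show ?thesis by (simp only: stereo.simps fst_conv scaleR_scaleR scaleR_one)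
  qed
  assume "((\<lambda>x. Fin (g x)) \<longlongrightarrow> Fin l) F"
  then have "((\<lambda>x. stereo (Fin (g x))) \<longlongrightarrow> stereo (Fin l)) F" by (simp only: tendsto_stereo_iff)
  then have "((\<lambda>x. (1 / (1 - snd (stereo (Fin (g x))))) *\<^sub>R fst (stereo (Fin (g x)))) \<longlongrightarrow>
      (1 / (1 - snd (stereo (Fin l)))) *\<^sub>R fst (stereo (Fin l))) F"
  proof (intro tendsto_intros)
    have "1 + (cmod l)\<^sup>2 > 0" by (simp add: add_pos_nonneg)
    then show "1 - snd (stereo (Fin l)) \<noteq> 0" by (auto simp: field_simps)
  qed
  then show "(g \<longlongrightarrow> l) F" unfolding eq[symmetric] .
qed

section \<open>Inversion and charts of the sphere\<close>

definition sinv :: "rsphere \<Rightarrow> rsphere" where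
  "sinv x = (case x of Infty \<Rightarrow> Fin 0 | Fin z \<Rightarrow> if z = 0 then Infty else Fin (1 / z))"

lemma sinv_simps [simp]: "sinv Infty = Fin 0" "sinv (Fin 0) = Infty"
    "z \<noteq> 0 \<Longrightarrow> sinv (Fin z) = Fin (1 / z)"
  by (simp_all add: sinv_def)

lemma sinv_sinv [simp]: "sinv (sinv x) = x"
  by (cases x) (auto simp: sinv_def)

lemma sinv_eq_iff [simp]: "sinv x = sinv y \<longleftrightarrow> x = y"
  by (metis sinv_sinv)

text \<open>On the unit sphere the inversion is a half-turn about the real axis. Hence it is a
  chordal isometry, and every limit at infinity becomes a limit at 0.\<close>

lemma stereo_sinv: "stereo (sinv x) = (cnj (fst (stereo x)), - snd (stereo x))"
proof (cases x)
  case (Fin z)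
  show ?thesis
  proof (cases "z = 0")
    case False
    have p: "1 + (cmod z)\<^sup>2 > 0" "(cmod z)\<^sup>2 > 0" using False by (simp_all add: add_pos_nonneg)
    have "(2 / (1 + (cmod (1/z))\<^sup>2)) *\<^sub>R (1 / z) = (2 / (1 + (cmod z)\<^sup>2)) *\<^sub>R cnj z"
    proof -
      have "1 / z = (1 / (cmod z)\<^sup>2) *\<^sub>R cnj z"
        using False complex_norm_square[of z] by (simp add: scaleR_conv_of_real field_simps)
      moreover have "2 / (1 + (cmod (1/z))\<^sup>2) * (1 / (cmod z)\<^sup>2) = 2 / (1 + (cmod z)\<^sup>2)"
        using p by (simp add: norm_divide field_simps)
      ultimately show ?thesis by (metis scaleR_scaleR)
    qed
    moreover have "((cmod (1/z))\<^sup>2 - 1) / ((cmod (1/z))\<^sup>2 + 1) = - (((cmod z)\<^sup>2 - 1) / ((cmod z)\<^sup>2 + 1))"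
    proof -
      have "(1 / u - 1) / (1 / u + 1) = - ((u - 1) / (u + 1))" if "u > 0" for u :: real
        using that by (simp add: divide_simps)
      from this[OF p(2)] show ?thesis by (simp add: norm_divide power_divide)
    qed
    ultimately show ?thesis using Fin False by simp
  qed (simp add: Fin)
qed simp

lemma dist_sinv [simp]: "dist (sinv x) (sinv y) = dist x y"
  by (simp add: dist_rsphere_def stereo_sinv dist_prod_def dist_norm flip: complex_cnj_diff)
     (simp add: power2_commute)

lemma tendsto_sinv_iff: "((\<lambda>x. sinv (g x)) \<longlongrightarrow> sinv l) F \<longleftrightarrow> (g \<longlongrightarrow> l) F"
  unfolding tendsto_iff by simp

lemma continuous_on_sinv [continuous_intros]:
  "continuous_on A g \<Longrightarrow> continuous_on A (\<lambda>z. sinv (g z))"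
  by (simp add: continuous_on_def tendsto_sinv_iff)

lemma tendsto_Infty_iff: "(g \<longlongrightarrow> Infty) F \<longleftrightarrow> ((\<lambda>x. sinv (g x)) \<longlongrightarrow> Fin 0) F"
  using tendsto_sinv_iff[of g Infty] by simp

lemma open_Fin_UNIV: "open (range Fin)"
proof -
  have "range Fin = - {Infty}" by (auto intro: rsphere.exhaust)
  then show ?thesis by (simp add: open_Compl)
qed

lemma eventually_nhds_Fin: "eventually P (nhds (Fin z)) \<longleftrightarrow> eventually (\<lambda>w. P (Fin w)) (nhds z)"
proof
  assume "eventually P (nhds (Fin z))"
  moreover have "filterlim Fin (nhds (Fin z)) (nhds z)"
    using tendsto_Fin_iff[of id z "nhds z"] by (simp add: filterlim_ident id_def)
  ultimately show "eventually (\<lambda>w. P (Fin w)) (nhds z)" by (simp add: filterlim_iff)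
next
  assume ev: "eventually (\<lambda>w. P (Fin w)) (nhds z)"
  have fin: "eventually (\<lambda>x. x \<in> range Fin) (nhds (Fin z))"
    using open_Fin_UNIV by (intro eventually_nhds_in_open) auto
  \<comment> \<open>Near \<open>Fin z\<close> all points are finite, so the identity is
    \<open>Fin (fin x)\<close> there and its continuity is that of \<open>fin\<close>.\<close>
  have "((\<lambda>x. x) \<longlongrightarrow> Fin z) (nhds (Fin z))" by (simp add: filterlim_ident)
  then have "((\<lambda>x. Fin (fin x)) \<longlongrightarrow> Fin z) (nhds (Fin z))"
    by (rule Lim_transform_eventually) (use fin in eventually_elim, auto)
  then have "filterlim fin (nhds z) (nhds (Fin z))" by (simp add: tendsto_Fin_iff)
  then have "eventually (\<lambda>x. P (Fin (fin x))) (nhds (Fin z))"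
    using ev unfolding filterlim_iff by blast
  with fin show "eventually P (nhds (Fin z))"
    by eventually_elim auto
qed

lemma open_Fin_image [simp]: "open (Fin ` A) \<longleftrightarrow> open A"
proof -
  have "(\<forall>y\<in>Fin ` A. eventually (\<lambda>x. x \<in> Fin ` A) (nhds y)) \<longleftrightarrow>
      (\<forall>z\<in>A. eventually (\<lambda>w. w \<in> A) (nhds z))"
    by (simp add: eventually_nhds_Fin image_iff)
  then show ?thesis
    by (simp add: eventually_nhds_in_open open_subopen[of A] open_subopen[of "Fin ` A"] eventually_nhds)
       (meson subset_eq)
qed

lemma open_sinv_image: "open (sinv ` A)" if "open A"
proof -
  have "sinv ` A = sinv -` A" by (auto simp: image_iff) (metis sinv_sinv)
  moreover have "continuous_on UNIV sinv" using continuous_on_sinv[OF continuous_on_id] by simp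
  ultimately show ?thesis
    using that open_vimage by metis
qed

text \<open>A coordinate centred at \<open>x\<close>, so that 0 always goes to \<open>x\<close>. It
  is an injective open map of the whole plane, which lets finite points and infinity be treated
  alike.\<close>

definition chart :: "rsphere \<Rightarrow> complex \<Rightarrow> rsphere" where
  "chart x w = (case x of Fin z \<Rightarrow> Fin (z + w) | Infty \<Rightarrow> sinv (Fin w))"

lemma chart_simps [simp]: "chart (Fin z) w = Fin (z + w)" "chart Infty w = sinv (Fin w)"
  by (simp_all add: chart_def)

lemma chart_0 [simp]: "chart x 0 = x"
  by (cases x) auto

lemma chart_eq_iff [simp]: "chart x w = chart x w' \<longleftrightarrow> w = w'"
  by (cases x) auto

lemma Fin_in_chart_Infty:
  assumes "r > 0" "norm z > 1 / r"
  shows "Fin z \<in> chart Infty ` cball 0 r"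
proof -
  have "1 / r > 0" using assms(1) by simp
  then have "z \<noteq> 0" using assms(2) by auto
  moreover from this have "norm (1 / z) \<le> r" using assms by (simp add: norm_divide field_simps)
  ultimately show ?thesis by (auto intro!: image_eqI[of _ _ "1 / z"])
qed

lemma continuous_on_chart [continuous_intros]:
  "continuous_on A g \<Longrightarrow> continuous_on A (\<lambda>z. chart x (g z))"
  by (cases x) (auto intro!: continuous_intros)

lemma open_chart_image: "open A \<Longrightarrow> open (chart x ` A)"
proof (cases x)
  case (Fin z)
  assume "open A"
  moreover have "chart x ` A = Fin ` ((+) z ` A)" by (auto simp: Fin image_image)
  ultimately show ?thesis by (simp add: open_translation)
next
  case Infty
  assume "open A"
  moreover have "chart x ` A = sinv ` (Fin ` A)" by (auto simp: Infty image_image)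
  ultimately show ?thesis by (simp add: open_sinv_image)
qed

lemma tendsto_chart_iff: "((\<lambda>t. chart x (g t)) \<longlongrightarrow> chart x l) F \<longleftrightarrow> (g \<longlongrightarrow> l) F"
proof (cases x)
  case (Fin z)
  have "((\<lambda>t. z + g t) \<longlongrightarrow> z + l) F \<longleftrightarrow> (g \<longlongrightarrow> l) F"
    using tendsto_add[OF tendsto_const[of "-z" F], of "\<lambda>t. z + g t" "z + l"]
      tendsto_add[OF tendsto_const[of z F], of g l] by auto
  then show ?thesis by (simp add: Fin tendsto_Fin_iff)
qed (simp add: tendsto_Fin_iff tendsto_sinv_iff)

lemma eventually_nhds_chart: "eventually P (nhds x) \<longleftrightarrow> eventually (\<lambda>w. P (chart x w)) (nhds 0)"
proof
  assume "eventually P (nhds x)"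
  moreover have "filterlim (chart x) (nhds x) (nhds 0)"
    using tendsto_chart_iff[of x id 0 "nhds 0"] by (simp add: filterlim_ident id_def)
  ultimately show "eventually (\<lambda>w. P (chart x w)) (nhds 0)" by (simp add: filterlim_iff)
next
  assume "eventually (\<lambda>w. P (chart x w)) (nhds 0)"
  then obtain S where S: "open S" "0 \<in> S" "\<And>w. w \<in> S \<Longrightarrow> P (chart x w)"
    by (auto simp: eventually_nhds)
  show "eventually P (nhds x)" unfolding eventually_nhds
    by (rule exI[of _ "chart x ` S"]) (use S open_chart_image in \<open>auto simp: image_iff intro!: bexI[of _ 0]\<close>)
qed

lemma nhds_obtain_chart_ball:
  assumes "open U" "x \<in> U"
  obtains r where "r > 0" "chart x ` cball 0 r \<subseteq> U"
proof -
  have "eventually (\<lambda>w. chart x w \<in> U) (nhds 0)"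
    using eventually_nhds_in_open[OF assms] by (simp add: eventually_nhds_chart)
  then obtain e where e: "e > 0" "\<And>w. dist w 0 < e \<Longrightarrow> chart x w \<in> U"
    by (auto simp: eventually_nhds_metric)
  show thesis
    by (rule that[of "e/2"]) (use e in \<open>auto simp: dist_norm\<close>)
qed

text \<open>Two compact pieces suffice: the closed unit disk and its image under inversion.\<close>

lemma compact_UNIV_rsphere: "compact (UNIV :: rsphere set)"
proof -
  have "compact (Fin ` cball 0 1)"
    by (intro compact_continuous_image continuous_intros) auto
  moreover from this have "compact (sinv ` (Fin ` cball 0 1))"
    by (intro compact_continuous_image continuous_intros) auto
  moreover have "UNIV = Fin ` cball 0 1 \<union> sinv ` (Fin ` cball 0 1)"
  proof -
    have "x \<in> Fin ` cball 0 1 \<union> sinv ` (Fin ` cball 0 1)" for x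
    proof (cases x)
      case (Fin z)
      show ?thesis
      proof (cases "norm z \<le> 1")
        case False
        then have "x = sinv (Fin (1/z))" "1/z \<in> cball 0 1"
          by (cases "z = 0"; force simp: Fin norm_divide divide_simps)+
        then show ?thesis by blast
      qed (auto simp: Fin)
    next
      case Infty
      then have "x = sinv (Fin 0)" by simp
      then show ?thesis by (auto simp del: sinv_simps)
    qed
    then show ?thesis by blast
  qed
  ultimately show ?thesis by (metis compact_Un)
qed

section \<open>Local representation of the dynamics\<close>

text \<open>The recursion of \<open>iter\<close> applies \<open>f\<close> last. Pulling back along
  an orbit needs the first step split off instead.\<close>

lemma iter_Suc': "iter f (Suc n) = iter f n \<circ>\<^sub>m sphere_map f"
proof (induction n)
  case (Suc n)
  have "iter f (Suc (Suc n)) = sphere_map f \<circ>\<^sub>m (iter f n \<circ>\<^sub>m sphere_map f)" using Suc by simp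
  also have "\<dots> = iter f (Suc n) \<circ>\<^sub>m sphere_map f"
    by (rule ext) (simp add: map_comp_def split: option.splits)
  finally show ?case .
qed (rule ext, simp add: map_comp_def split: option.splits)

lemma iter_add: "iter f (m + n) = iter f m \<circ>\<^sub>m iter f n"
  by (induction m) (auto simp: map_comp_def fun_eq_iff split: option.splits)

lemma iter_add_Some: "iter f n x = Some y \<Longrightarrow> iter f (m + n) x = iter f m y"
  by (simp add: iter_add map_comp_def)

lemma iter_1 [simp]: "iter f (Suc 0) = sphere_map f"
  by (rule ext) (simp add: map_comp_def)

lemma sphere_map_Fin [simp]: "sphere_map f (Fin z) = Some (to_sphere f z)"
  by (simp add: sphere_map_def)

lemma preimage_iff: "x \<in> preimage f n A \<longleftrightarrow> (\<exists>y\<in>A. iter f n x = Some y)"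
  by (auto simp: preimage_def)

lemma iter_SucE:
  assumes "iter f (Suc n) x = Some y"
  obtains u where "sphere_map f x = Some u" "iter f n u = Some y"
  using assms unfolding iter_Suc' by (auto simp: map_comp_def split: option.splits)

lemma iter_SucE':
  assumes "iter f (Suc n) x = Some y"
  obtains u where "iter f n x = Some u" "sphere_map f u = Some y"
  using assms by (auto simp: map_comp_def split: option.splits)

text \<open>The local expression of a partial map in the charts centred at a point and at its image.
  That the map is defined near the point is part of the claim.\<close>

definition chart_rep ::
    "(rsphere \<rightharpoonup> rsphere) \<Rightarrow> rsphere \<Rightarrow> rsphere \<Rightarrow> (complex \<Rightarrow> complex) \<Rightarrow> real \<Rightarrow> bool" where
  "chart_rep F x y \<phi> r \<longleftrightarrow> r > 0 \<and> \<phi> holomorphic_on ball 0 r \<and> \<phi> 0 = 0 \<and>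
     (\<forall>w\<in>ball 0 r. F (chart x w) = Some (chart y (\<phi> w)))"

lemma chart_rep_comp:
  assumes "chart_rep F x y \<phi> r" "chart_rep G y z \<psi> s"
  shows "\<exists>t. chart_rep (G \<circ>\<^sub>m F) x z (\<psi> \<circ> \<phi>) t"
proof -
  have r: "r > 0" "\<phi> holomorphic_on ball 0 r" "\<phi> 0 = 0"
      "\<And>w. w \<in> ball 0 r \<Longrightarrow> F (chart x w) = Some (chart y (\<phi> w))"
    and s: "s > 0" "\<psi> holomorphic_on ball 0 s" "\<psi> 0 = 0"
      "\<And>w. w \<in> ball 0 s \<Longrightarrow> G (chart y w) = Some (chart z (\<psi> w))"
    using assms by (auto simp: chart_rep_def)
  have "isCont \<phi> 0"
    using r holomorphic_on_imp_continuous_on[OF r(2)] by (simp add: continuous_on_eq_continuous_at)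
  then obtain d where d: "d > 0" "\<And>w. dist w 0 < d \<Longrightarrow> dist (\<phi> w) (\<phi> 0) < s"
    using s(1) unfolding continuous_at_eps_delta by blast
  have "\<psi> \<circ> \<phi> holomorphic_on ball 0 (min r d)"
    by (rule holomorphic_on_compose_gen[OF holomorphic_on_subset[OF r(2)] s(2)])
       (use d r(3) in auto)
  then show ?thesis
    unfolding chart_rep_def
    by (intro exI[of _ "min r d"]) (use r s d in \<open>auto simp: map_comp_def\<close>)
qed

text \<open>Being nonconstant is what the local theory asks of \<open>f\<close>: it yields open
  mappings and discrete fibres. Both kinds of function in the theorem satisfy it.\<close>

locale meromorphic_dynamics =
  fixes f :: "complex \<Rightarrow> complex"
  assumes mero: "f nicely_meromorphic_on UNIV"
    and nonconstant: "\<not> f constant_on UNIV"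
begin

lemma analytic_at_nonpole: "\<not> is_pole f z \<Longrightarrow> f analytic_on {z}"
  using nicely_meromorphic_on_imp_analytic_at[OF mero] by auto

lemma pole_value: "is_pole f z \<Longrightarrow> f z = 0"
  using mero is_pole_def not_tendsto_and_filterlim_at_infinity[OF at_neq_bot]
  unfolding nicely_meromorphic_on_def by blast

text \<open>Identity theorem for meromorphic functions on the connected plane.\<close>

lemma not_locally_constant: "\<not> (\<exists>\<^sub>F z in at x. f z = c)"
proof
  assume "\<exists>\<^sub>F z in at x. f z = c"
  from frequently_eq_meromorphic_imp_constant[OF this mero]
  have "f w = c" for w by (simp add: connected_UNIV)
  then show False using nonconstant by (auto simp: constant_on_def)
qed

text \<open>The dummy value 0 at a pole suits the reciprocal: \<open>inverse 0 = 0\<close> is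
  exactly the limit of \<open>inverse (f w)\<close> at the pole.\<close>

lemma inverse_analytic_at_pole: "is_pole f z \<Longrightarrow> (\<lambda>z. inverse (f z)) analytic_on {z}"
proof -
  assume z: "is_pole f z"
  have "(\<lambda>z. inverse (f z)) nicely_meromorphic_on UNIV"
    using mero by (rule nicely_meromorphic_on_inverse)
  moreover have "((\<lambda>z. inverse (f z)) \<longlongrightarrow> 0) (at z)"
    using z tendsto_inverse_0 unfolding is_pole_def by (rule filterlim_compose[rotated])
  then have "\<not> is_pole (\<lambda>z. inverse (f z)) z"
    unfolding is_pole_def using not_tendsto_and_filterlim_at_infinity[OF at_neq_bot] by blast
  ultimately show ?thesis
    using nicely_meromorphic_on_imp_analytic_at by blast
qed

lemma inverse_analytic_at: "to_sphere f z \<noteq> Fin 0 \<Longrightarrow> (\<lambda>z. inverse (f z)) analytic_on {z}"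
  using inverse_analytic_at_pole analytic_at_nonpole
  by (cases "is_pole f z") (auto simp: to_sphere_def intro!: analytic_on_inverse)

lemma to_sphere_eq_sinv: "to_sphere f z \<noteq> Fin 0 \<Longrightarrow> to_sphere f z = sinv (Fin (inverse (f z)))"
  using pole_value[of z] by (auto simp: to_sphere_def divide_simps sinv_def split: if_splits)

lemma chart_rep_sphere_map_Fin: "\<exists>\<phi> r. chart_rep (sphere_map f) (Fin z) (to_sphere f z) \<phi> r"
proof (cases "is_pole f z")
  case False
  obtain r where r: "r > 0" "f holomorphic_on ball z r"
    using analytic_at_nonpole[OF False] by (auto simp: analytic_on_def)
  have np: "\<not> is_pole f w" if "w \<in> ball z r" for w
    using r(2) that by (meson centre_in_ball holomorphic_on_imp_analytic_at not_is_pole_holomorphic open_ball)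
  have "(\<lambda>w. f (z + w) - f z) holomorphic_on ball 0 r"
    by (intro holomorphic_intros holomorphic_on_compose_gen[OF _ r(2), unfolded o_def])
       (auto simp: dist_norm)
  then have "chart_rep (sphere_map f) (Fin z) (to_sphere f z) (\<lambda>w. f (z + w) - f z) r"
    unfolding chart_rep_def using r(1) False np by (auto simp: to_sphere_def dist_norm)
  then show ?thesis by blast
next
  case True
  obtain r where r: "r > 0" "(\<lambda>z. inverse (f z)) holomorphic_on ball z r"
    using inverse_analytic_at_pole[OF True] by (auto simp: analytic_on_def)
  have "\<forall>\<^sub>F w in at z. f w \<noteq> 0" using True by (rule non_zero_neighbour_pole)
  then obtain d where d: "d > 0" "\<And>w. w \<noteq> z \<Longrightarrow> dist w z < d \<Longrightarrow> f w \<noteq> 0"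
    by (auto simp: eventually_at)
  \<comment> \<open>The disk must avoid zeros of \<open>f\<close>: there
    \<open>inverse (f w)\<close> has the default value 0 and would stand for infinity.\<close>
  have nz: "to_sphere f w \<noteq> Fin 0" if "dist w z < d" for w
    using d(2)[of w] that True by (auto simp: to_sphere_def split: if_splits)
  have "(\<lambda>w. inverse (f (z + w))) holomorphic_on ball 0 (min d r)"
    by (intro holomorphic_on_compose_gen[OF _ r(2), unfolded o_def] holomorphic_intros)
       (auto simp: dist_norm)
  then have "chart_rep (sphere_map f) (Fin z) (to_sphere f z) (\<lambda>w. inverse (f (z + w))) (min d r)"
    unfolding chart_rep_def using r(1) d(1) True nz
    by (auto simp: to_sphere_eq_sinv[OF nz] dist_norm pole_value)
  then show ?thesis by blast
qed

text \<open>In the coordinate \<open>1 / w\<close> the limit on the sphere makes the singularity at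
  0 removable, for \<open>f - v\<close> if the limit is a finite \<open>v\<close> and for the
  reciprocal of \<open>f\<close> if it is infinity.\<close>

lemma chart_rep_sphere_map_Infty:
  assumes "(to_sphere f \<longlongrightarrow> l) at_infinity"
  shows "\<exists>\<phi> r. chart_rep (sphere_map f) Infty l \<phi> r"
proof -
  have map_Infty: "sphere_map f Infty = Some l"
    using tendsto_Lim[OF trivial_limit_at_infinity assms] assms by (auto simp: sphere_map_def transcendental_def)
  have lim0: "((\<lambda>w. to_sphere f (inverse w)) \<longlongrightarrow> l) (at 0)"
    using assms filterlim_inverse_at_infinity by (rule filterlim_compose)
  show ?thesis
  proof (cases l)
    case (Fin v)
    have "\<forall>\<^sub>F w in at 0. to_sphere f (inverse w) \<in> range Fin"
      using topological_tendstoD[OF lim0 open_Fin_UNIV] Fin by auto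
    then obtain r where r: "r > 0" "\<And>w. w \<noteq> 0 \<Longrightarrow> norm w < r \<Longrightarrow> to_sphere f (inverse w) \<in> range Fin"
      by (auto simp: eventually_at)
    have np: "\<not> is_pole f (inverse w)" if "w \<noteq> 0" "norm w < r" for w
      using r(2)[OF that] by (auto simp: to_sphere_def)
    let ?\<phi> = "\<lambda>w. if w = 0 then 0 else f (inverse w) - v"
    have "((\<lambda>w. Fin (f (inverse w))) \<longlongrightarrow> Fin v) (at 0)"
      by (rule Lim_transform_eventually[OF lim0[unfolded Fin]])
         (use r(1) np in \<open>auto simp: eventually_at to_sphere_def intro!: exI[of _ r]\<close>)
    then have lim: "((\<lambda>w. f (inverse w) - v) \<longlongrightarrow> 0) (at 0)"
      unfolding tendsto_Fin_iff by (simp add: LIM_zero)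
    have "(\<lambda>w. f (inverse w) - v) analytic_on {w}" if w: "w \<in> ball 0 r - {0}" for w
    proof (rule analytic_on_diff[OF analytic_at_compose_inverse analytic_on_const])
      show "f analytic_on {inverse w}" by (rule analytic_at_nonpole, rule np) (use w in auto)
      show "w \<noteq> 0" using w by simp
    qed
    then have "?\<phi> holomorphic_on ball 0 r" by (rule holomorphic_extend_limit[OF _ lim])
    then have "chart_rep (sphere_map f) Infty l ?\<phi> r"
      unfolding chart_rep_def using r(1) map_Infty np
      by (auto simp: Fin to_sphere_def sinv_def inverse_eq_divide)
    then show ?thesis by blast
  next
    case Infty
    have "\<forall>\<^sub>F w in at 0. to_sphere f (inverse w) \<in> -{Fin 0}"
      using lim0 Infty by (intro topological_tendstoD) auto
    then obtain r where r: "r > 0" "\<And>w. w \<noteq> 0 \<Longrightarrow> norm w < r \<Longrightarrow> to_sphere f (inverse w) \<noteq> Fin 0"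
      by (auto simp: eventually_at)
    let ?\<phi> = "\<lambda>w. if w = 0 then 0 else inverse (f (inverse w))"
    have "((\<lambda>w. sinv (to_sphere f (inverse w))) \<longlongrightarrow> Fin 0) (at 0)"
      using lim0[unfolded Infty tendsto_Infty_iff] .
    then have "((\<lambda>w. Fin (inverse (f (inverse w)))) \<longlongrightarrow> Fin 0) (at 0)"
      by (rule Lim_transform_eventually)
         (use r in \<open>auto simp: eventually_at to_sphere_eq_sinv intro!: exI[of _ r]\<close>)
    then have lim: "((\<lambda>w. inverse (f (inverse w))) \<longlongrightarrow> 0) (at 0)" by (simp only: tendsto_Fin_iff)
    have "(\<lambda>w. inverse (f (inverse w))) analytic_on {w}" if "w \<in> ball 0 r - {0}" for w
      using that inverse_analytic_at[OF r(2)]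
      by (intro analytic_at_compose_inverse[of "\<lambda>z. inverse (f z)"]) auto
    then have "?\<phi> holomorphic_on ball 0 r" by (rule holomorphic_extend_limit[OF _ lim])
    then have "chart_rep (sphere_map f) Infty l ?\<phi> r" unfolding chart_rep_def using r map_Infty
      by (auto simp: Infty to_sphere_eq_sinv sinv_def inverse_eq_divide)
    then show ?thesis by blast
  qed
qed

lemma chart_rep_sphere_map:
  assumes "sphere_map f x = Some y"
  obtains \<phi> r where "chart_rep (sphere_map f) x y \<phi> r"
proof (cases x)
  case (Fin z)
  then show thesis using chart_rep_sphere_map_Fin[of z] assms that by auto
next
  case Infty
  then have "\<not> transcendental f" using assms by (auto simp: sphere_map_def split: if_splits)
  then obtain l where l: "(to_sphere f \<longlongrightarrow> l) at_infinity" by (auto simp: transcendental_def)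
  then have "sphere_map f Infty = Some l"
    using tendsto_Lim[OF trivial_limit_at_infinity l] by (auto simp: sphere_map_def transcendental_def)
  then show thesis using chart_rep_sphere_map_Infty[OF l] assms Infty that by auto
qed

lemma chart_rep_iter:
  assumes "iter f n x = Some y"
  obtains \<phi> r where "chart_rep (iter f n) x y \<phi> r"
proof -
  have "\<exists>\<phi> r. chart_rep (iter f n) x y \<phi> r" using assms
  proof (induction n arbitrary: y)
    case 0
    then have "chart_rep (iter f 0) x y (\<lambda>w. w) 1"
      by (auto simp: chart_rep_def intro!: holomorphic_intros)
    then show ?case by blast
  next
    case (Suc n)
    obtain u where u: "iter f n x = Some u" "sphere_map f u = Some y"
      using iter_SucE'[OF Suc.prems] by blast
    obtain \<phi> r \<psi> s where "chart_rep (iter f n) x u \<phi> r" "chart_rep (sphere_map f) u y \<psi> s"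
      using Suc.IH[OF u(1)] chart_rep_sphere_map[OF u(2)] by metis
    from chart_rep_comp[OF this] show ?case by auto
  qed
  then show thesis using that by blast
qed

lemma chart_rep_not_constant:
  assumes "chart_rep (sphere_map f) x y \<phi> r" "0 < s" "s \<le> r"
  shows "\<not> \<phi> constant_on ball 0 s"
proof
  assume "\<phi> constant_on ball 0 s"
  then have eq: "sphere_map f (chart x w) = Some y" if "w \<in> ball 0 s" for w
  proof -
    obtain c where "\<And>w. w \<in> ball 0 s \<Longrightarrow> \<phi> w = c"
      using \<open>\<phi> constant_on ball 0 s\<close> unfolding constant_on_def by blast
    then have "\<phi> w = \<phi> 0" using that assms(2) by simp
    moreover have "w \<in> ball 0 r" using that assms(3) by auto
    ultimately show ?thesis using assms(1) unfolding chart_rep_def by simp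
  qed
  \<comment> \<open>A point off the centre is finite in either chart, so the constancy can be read
    in the plane, where the identity theorem applies.\<close>
  define w where "w = complex_of_real (s/2)"
  have w: "w \<in> ball 0 s" "w \<noteq> 0" using assms by (auto simp: w_def)
  obtain z where z: "chart x w = Fin z" using w by (cases x) auto
  have "\<forall>\<^sub>F u in nhds (Fin z). u \<in> chart x ` ball 0 s"
    by (rule eventually_nhds_in_open[OF open_chart_image[OF open_ball]]) (use w z in \<open>metis imageI\<close>)
  then have "\<forall>\<^sub>F u in nhds z. Fin u \<in> chart x ` ball 0 s" by (simp add: eventually_nhds_Fin)
  then have "\<forall>\<^sub>F u in nhds z. sphere_map f (Fin u) = Some y"
    by eventually_elim (auto simp del: sphere_map_Fin simp: eq)
  \<comment> \<open>A constant value infinity also becomes a constant value of \<open>f\<close>,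
    namely the dummy value 0 at poles.\<close>
  then have "\<forall>\<^sub>F u in nhds z. f u = (case y of Fin v \<Rightarrow> v | Infty \<Rightarrow> 0)"
    by eventually_elim (auto simp: to_sphere_def pole_value split: if_splits)
  then have "\<exists>\<^sub>F u in at z. f u = (case y of Fin v \<Rightarrow> v | Infty \<Rightarrow> 0)"
    by (intro eventually_frequently at_neq_bot) (simp add: eventually_nhds_conv_at)
  then show False using not_locally_constant by blast
qed

lemma sphere_map_open:
  assumes "sphere_map f x = Some y" "open U" "x \<in> U"
  shows "\<exists>V. open V \<and> y \<in> V \<and> (\<forall>v\<in>V. \<exists>u\<in>U. sphere_map f u = Some v)"
proof -
  obtain \<phi> r where rep: "chart_rep (sphere_map f) x y \<phi> r"
    using chart_rep_sphere_map[OF assms(1)] .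
  obtain s where s: "s > 0" "chart x ` cball 0 s \<subseteq> U"
    using nhds_obtain_chart_ball[OF assms(2,3)] .
  define t where "t = min r s"
  have t: "0 < t" "t \<le> r" "t \<le> s" using s rep by (auto simp: t_def chart_rep_def)
  have "\<phi> holomorphic_on ball 0 t"
    using rep t(2) unfolding chart_rep_def by (meson holomorphic_on_subset subset_ball)
  then have "open (\<phi> ` ball 0 t)" using chart_rep_not_constant[OF rep t(1,2)]
    by (intro open_mapping_thm[of _ "ball 0 t"]) auto
  then have "open (chart y ` \<phi> ` ball 0 t)" by (rule open_chart_image)
  moreover have "y \<in> chart y ` \<phi> ` ball 0 t"
    using rep t by (force simp: chart_rep_def image_iff intro!: bexI[of _ 0])
  moreover have "\<exists>u\<in>U. sphere_map f u = Some v" if v: "v \<in> chart y ` \<phi> ` ball 0 t" for v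
  proof -
    obtain w where w: "w \<in> ball 0 t" "v = chart y (\<phi> w)" using v by auto
    then have "sphere_map f (chart x w) = Some v" "chart x w \<in> U"
      using rep t s by (auto simp: chart_rep_def)
    then show ?thesis by blast
  qed
  ultimately show ?thesis by blast
qed

lemma iter_open:
  assumes "iter f n x = Some y" "open U" "x \<in> U"
  shows "\<exists>V. open V \<and> y \<in> V \<and> (\<forall>v\<in>V. \<exists>u\<in>U. iter f n u = Some v)"
  using assms(1)
proof (induction n arbitrary: y)
  case 0
  then show ?case using assms(2,3) by auto
next
  case (Suc n)
  obtain u where u: "iter f n x = Some u" "sphere_map f u = Some y"
    using iter_SucE'[OF Suc.prems] by blast
  obtain V where V: "open V" "u \<in> V" "\<And>v. v \<in> V \<Longrightarrow> \<exists>u\<in>U. iter f n u = Some v"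
    using Suc.IH[OF u(1)] by blast
  obtain W where W: "open W" "y \<in> W" "\<And>w. w \<in> W \<Longrightarrow> \<exists>v\<in>V. sphere_map f v = Some w"
    using sphere_map_open[OF u(2) V(1,2)] by blast
  have "\<exists>u\<in>U. iter f (Suc n) u = Some w" if w: "w \<in> W" for w
  proof -
    obtain v where v: "v \<in> V" "sphere_map f v = Some w" using W(3)[OF w] by blast
    obtain u where "u \<in> U" "iter f n u = Some v" using V(3)[OF v(1)] by blast
    with v show ?thesis by (intro bexI[of _ u]) (simp_all add: map_comp_def)
  qed
  then show ?case using W by blast
qed

text \<open>Phrased through \<open>preimage\<close> so that it also says that the iterate is defined
  near \<open>x\<close>.\<close>

lemma iter_continuous:
  assumes "iter f n x = Some y" "open V" "y \<in> V"
  shows "\<forall>\<^sub>F u in nhds x. u \<in> preimage f n V"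
proof -
  obtain \<phi> r where rep: "chart_rep (iter f n) x y \<phi> r" using chart_rep_iter[OF assms(1)] .
  then have r: "r > 0" "\<phi> holomorphic_on ball 0 r" "\<phi> 0 = 0"
      "\<And>w. w \<in> ball 0 r \<Longrightarrow> iter f n (chart x w) = Some (chart y (\<phi> w))"
    by (auto simp: chart_rep_def)
  have "continuous_on (ball 0 r) (\<lambda>w. chart y (\<phi> w))"
    using r by (intro continuous_intros holomorphic_on_imp_continuous_on)
  then have "isCont (\<lambda>w. chart y (\<phi> w)) 0"
    using r(1) by (simp add: continuous_on_eq_continuous_at)
  then have "filterlim (\<lambda>w. chart y (\<phi> w)) (nhds (chart y (\<phi> 0))) (nhds 0)"
    unfolding isCont_def by (subst (asm) tendsto_at_iff_tendsto_nhds)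
  moreover have "\<forall>\<^sub>F v in nhds (chart y (\<phi> 0)). v \<in> V"
    using assms(2,3) r(3) by (intro eventually_nhds_in_open) auto
  ultimately have "\<forall>\<^sub>F w in nhds 0. chart y (\<phi> w) \<in> V" unfolding filterlim_iff by blast
  moreover have "\<forall>\<^sub>F w in nhds 0. w \<in> ball (0::complex) r"
    using r(1) by (intro eventually_nhds_in_open) auto
  ultimately have "\<forall>\<^sub>F w in nhds 0. chart x w \<in> preimage f n V"
    by eventually_elim (simp add: preimage_iff r(4))
  then show ?thesis by (simp add: eventually_nhds_chart[of _ x])
qed

lemma open_preimage: "open V \<Longrightarrow> open (preimage f n V)"
  unfolding open_subopen[of "preimage f n V"]
proof
  fix x assume "open V" "x \<in> preimage f n V"
  then have "\<forall>\<^sub>F u in nhds x. u \<in> preimage f n V"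
    using iter_continuous by (auto simp: preimage_iff)
  then show "\<exists>T. open T \<and> x \<in> T \<and> T \<subseteq> preimage f n V" by (auto simp: eventually_nhds)
qed

lemma tendsto_iter:
  assumes "iter f n x = Some y" "(g \<longlongrightarrow> x) F"
  shows "((\<lambda>t. the (iter f n (g t))) \<longlongrightarrow> y) F"
proof (rule topological_tendstoI)
  fix S assume "open S" "y \<in> S"
  then have "\<forall>\<^sub>F u in nhds x. u \<in> preimage f n S" using iter_continuous[OF assms(1)] by blast
  then have "\<forall>\<^sub>F t in F. g t \<in> preimage f n S" using assms(2) unfolding filterlim_iff by blast
  then show "\<forall>\<^sub>F t in F. the (iter f n (g t)) \<in> S" by eventually_elim (auto simp: preimage_def)
qed

lemma continuous_on_iter: "A \<subseteq> dom (iter f n) \<Longrightarrow> continuous_on A (\<lambda>x. the (iter f n x))"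
proof -
  assume A: "A \<subseteq> dom (iter f n)"
  have "((\<lambda>x. the (iter f n x)) \<longlongrightarrow> the (iter f n x)) (at x within A)" if "x \<in> A" for x
  proof (rule tendsto_iter)
    show "iter f n x = Some (the (iter f n x))" using that A by auto
  qed (rule tendsto_ident_at)
  then show ?thesis unfolding continuous_on_def by blast
qed

lemma plane_iter_eq: "iter f n (Fin z) = Some (Fin y) \<Longrightarrow> plane_iter f n z = y"
  by (simp add: plane_iter_def)

lemma plane_iter_near:
  assumes "iter f n (Fin z) = Some (Fin y)"
  shows "\<forall>\<^sub>F w in nhds z. iter f n (Fin w) = Some (Fin (plane_iter f n w))"
proof -
  have "\<forall>\<^sub>F u in nhds (Fin z). u \<in> preimage f n (range Fin)"
    using iter_continuous[OF assms open_Fin_UNIV] by simp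
  then show ?thesis
    unfolding eventually_nhds_Fin by eventually_elim (auto simp: preimage_iff plane_iter_def)
qed

lemma plane_iter_analytic:
  assumes "iter f n (Fin z) = Some (Fin y)"
  shows "plane_iter f n analytic_on {z}"
proof -
  obtain \<phi> r where rep: "chart_rep (iter f n) (Fin z) (Fin y) \<phi> r"
    using chart_rep_iter[OF assms] .
  have hol: "(\<lambda>w. y + \<phi> (w - z)) holomorphic_on ball z r"
    using rep by (intro holomorphic_intros holomorphic_on_compose_gen[of "\<lambda>w. w - z" _ \<phi>, unfolded o_def])
      (auto simp: chart_rep_def dist_norm norm_minus_commute)
  have eq: "plane_iter f n w = y + \<phi> (w - z)" if "w \<in> ball z r" for w
  proof -
    have "w - z \<in> ball 0 r" using that by (auto simp: dist_norm norm_minus_commute)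
    then have "iter f n (chart (Fin z) (w - z)) = Some (chart (Fin y) (\<phi> (w - z)))"
      using rep unfolding chart_rep_def by blast
    then show ?thesis by (simp add: plane_iter_def)
  qed
  have "plane_iter f n holomorphic_on ball z r"
    by (rule holomorphic_transform[OF hol]) (simp only: eq)
  then show ?thesis
    using rep by (auto simp: analytic_on_def chart_rep_def)
qed

end

section \<open>Normal families\<close>

lemma normal_familyI:
  assumes "\<And>g. range g \<subseteq> A \<Longrightarrow> \<exists>h r. strict_mono (r :: nat \<Rightarrow> nat) \<and>
      (\<forall>K. compact K \<longrightarrow> K \<subseteq> U \<longrightarrow> uniform_limit K (g \<circ> r) h sequentially)"
  shows "normal_family U A"
  unfolding normal_family_def imp_conjL using assms by simp

lemma normal_familyE:
  assumes "normal_family U A" "range g \<subseteq> A"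
  obtains h r where "strict_mono (r :: nat \<Rightarrow> nat)"
    "\<And>K. compact K \<Longrightarrow> K \<subseteq> U \<Longrightarrow> uniform_limit K (g \<circ> r) h sequentially"
  using assms(1)[unfolded normal_family_def, rule_format, OF assms(2)] by blast

lemma normal_family_subset:
  assumes "normal_family U F" "V \<subseteq> U" "G \<subseteq> F"
  shows "normal_family V G"
proof (rule normal_familyI)
  fix g :: "nat \<Rightarrow> rsphere \<Rightarrow> rsphere" assume "range g \<subseteq> G"
  then have "range g \<subseteq> F" using assms(3) by blast
  from normal_familyE[OF assms(1) this] obtain r h where r: "strict_mono (r :: nat \<Rightarrow> nat)"
      "\<And>K. compact K \<Longrightarrow> K \<subseteq> U \<Longrightarrow> uniform_limit K (g \<circ> r) h sequentially"
    by metis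
  show "\<exists>h r. strict_mono (r :: nat \<Rightarrow> nat) \<and>
           (\<forall>K. compact K \<longrightarrow> K \<subseteq> V \<longrightarrow> uniform_limit K (g \<circ> r) h sequentially)"
    using assms(2) by (intro exI[of _ h] exI[of _ r] conjI r(1) allI impI r(2)) auto
qed

text \<open>By the pigeonhole principle some subsequence stays in one of the two families. This
  allows the iterates to be sorted into classes that are treated separately.\<close>

lemma normal_family_Un:
  assumes "normal_family U A" "normal_family U B"
  shows "normal_family U (A \<union> B)"
proof -
  have *: "\<exists>h r. strict_mono (r :: nat \<Rightarrow> nat) \<and>
           (\<forall>K. compact K \<longrightarrow> K \<subseteq> U \<longrightarrow> uniform_limit K (g \<circ> r) h sequentially)"
    if C: "normal_family U C" "infinite {k. g k \<in> C}" for C and g :: "nat \<Rightarrow> rsphere \<Rightarrow> rsphere"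
  proof -
    obtain r :: "nat \<Rightarrow> nat" where r: "strict_mono r" "\<And>n. r n \<in> {k. g k \<in> C}"
      using infinite_enumerate[OF C(2)] by blast
    have "range (g \<circ> r) \<subseteq> C" using r(2) by auto
    from normal_familyE[OF C(1) this] obtain s h where s: "strict_mono (s :: nat \<Rightarrow> nat)"
        "\<And>K. compact K \<Longrightarrow> K \<subseteq> U \<Longrightarrow> uniform_limit K ((g \<circ> r) \<circ> s) h sequentially"
      by metis
    have "uniform_limit K (g \<circ> (r \<circ> s)) h sequentially" if "compact K" "K \<subseteq> U" for K
      using s(2)[OF that] by (simp only: o_assoc)
    then show ?thesis using strict_mono_o[OF r(1) s(1)] by blast
  qed
  show ?thesis
  proof (rule normal_familyI)
    fix g :: "nat \<Rightarrow> rsphere \<Rightarrow> rsphere" assume "range g \<subseteq> A \<union> B"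
    then have "UNIV = {k. g k \<in> A} \<union> {k. g k \<in> B}" by auto
    then have "infinite {k. g k \<in> A} \<or> infinite {k. g k \<in> B}"
      by (metis finite_Un infinite_UNIV_nat)
    then show "\<exists>h r. strict_mono (r :: nat \<Rightarrow> nat) \<and>
           (\<forall>K. compact K \<longrightarrow> K \<subseteq> U \<longrightarrow> uniform_limit K (g \<circ> r) h sequentially)"
      using *[OF assms(1)] *[OF assms(2)] by blast
  qed
qed

lemma normal_family_singleton: "normal_family U {h}"
proof (rule normal_familyI)
  fix g :: "nat \<Rightarrow> rsphere \<Rightarrow> rsphere" assume "range g \<subseteq> {h}"
  then have "g = (\<lambda>_. h)" by auto
  then show "\<exists>k r. strict_mono (r :: nat \<Rightarrow> nat) \<and>
           (\<forall>K. compact K \<longrightarrow> K \<subseteq> U \<longrightarrow> uniform_limit K (g \<circ> r) k sequentially)"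
    by (intro exI[of _ h] exI[of _ id]) (auto simp: strict_mono_def uniform_limit_iff o_def)
qed

text \<open>A continuous map sends compact sets to compact sets, so locally uniform convergence can
  be pulled back along it.\<close>

lemma normal_family_transfer:
  assumes "normal_family U A" "continuous_on V \<phi>" "\<phi> ` V \<subseteq> U"
    and B: "\<And>g. g \<in> B \<Longrightarrow> \<exists>h\<in>A. \<forall>x\<in>V. g x = h (\<phi> x)"
  shows "normal_family V B"
proof (rule normal_familyI)
  fix g :: "nat \<Rightarrow> rsphere \<Rightarrow> rsphere" assume "range g \<subseteq> B"
  then have "\<forall>k. \<exists>h\<in>A. \<forall>x\<in>V. g k x = h (\<phi> x)" using B by blast
  then obtain h where h: "\<And>k. h k \<in> A" "\<And>k x. x \<in> V \<Longrightarrow> g k x = h k (\<phi> x)" by metis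
  have "range h \<subseteq> A" using h(1) by auto
  from normal_familyE[OF assms(1) this] obtain r h0 where r: "strict_mono (r :: nat \<Rightarrow> nat)"
      "\<And>K. compact K \<Longrightarrow> K \<subseteq> U \<Longrightarrow> uniform_limit K (h \<circ> r) h0 sequentially"
    by metis
  have "uniform_limit K (g \<circ> r) (h0 \<circ> \<phi>) sequentially" if K: "compact K" "K \<subseteq> V" for K
  proof -
    have "compact (\<phi> ` K)"
      using K continuous_on_subset[OF assms(2)] by (intro compact_continuous_image)
    then have "uniform_limit (\<phi> ` K) (h \<circ> r) h0 sequentially"
      using K assms(3) by (intro r(2)) auto
    then show ?thesis
      unfolding uniform_limit_iff using h(2) K by (auto simp: subset_iff)
  qed
  then show "\<exists>h r. strict_mono (r :: nat \<Rightarrow> nat) \<and>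
           (\<forall>K. compact K \<longrightarrow> K \<subseteq> V \<longrightarrow> uniform_limit K (g \<circ> r) h sequentially)"
    using r(1) by blast
qed

section \<open>Invariance of the Fatou and Julia sets\<close>

lemma open_Fatou: "open (Fatou f)"
  unfolding open_subopen[of "Fatou f"] by (auto simp: Fatou_def)

lemma closed_Julia: "closed (Julia f)"
proof -
  have "Julia f = Fin -` (- Fatou f)" by (auto simp: Julia_def)
  moreover have "continuous_on UNIV Fin" using continuous_on_Fin[OF continuous_on_id] by simp
  ultimately show ?thesis
    using open_Fatou by (metis closed_Compl closed_vimage)
qed

lemma Fatou_imp_dom: "x \<in> Fatou f \<Longrightarrow> x \<in> dom (iter f n)"
  by (auto simp: Fatou_def)

context meromorphic_dynamics
begin

lemma Fatou_backward:
  assumes "sphere_map f x = Some y" "y \<in> Fatou f"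
  shows "x \<in> Fatou f"
proof -
  obtain U where U: "open U" "y \<in> U" "\<And>n. U \<subseteq> dom (iter f n)"
      "normal_family U (range (\<lambda>n x. the (iter f n x)))"
    using assms(2) by (auto simp: Fatou_def)
  define V where "V = preimage f 1 U"
  have V: "\<exists>v\<in>U. sphere_map f u = Some v" if "u \<in> V" for u
    using that by (auto simp: V_def preimage_iff)
  have "open V" "x \<in> V"
    using U assms(1) unfolding V_def by (auto intro!: open_preimage simp: preimage_iff)
  moreover have "V \<subseteq> dom (iter f n)" for n
  proof
    fix u assume "u \<in> V"
    then obtain v where v: "v \<in> U" "sphere_map f u = Some v" using V by blast
    have "v \<in> dom (iter f m)" for m using v U(3) by blast
    then show "u \<in> dom (iter f n)"
      by (cases n) (use v(2) in \<open>auto simp: iter_Suc' map_comp_def dom_def simp del: iter.simps(2)\<close>)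
  qed
  moreover have "normal_family V (range (\<lambda>n x. the (iter f n x)))"
  proof -
    have "normal_family V (range (\<lambda>n x. the (iter f (Suc n) x)))"
    proof (rule normal_family_transfer[OF U(4)])
      show "continuous_on V (\<lambda>x. the (sphere_map f x))"
        using continuous_on_iter[of V 1] V by (fastforce simp: dom_def)
      show "(\<lambda>x. the (sphere_map f x)) ` V \<subseteq> U" using V by fastforce
      fix g assume "g \<in> range (\<lambda>n x. the (iter f (Suc n) x))"
      then obtain n where n: "g = (\<lambda>x. the (iter f (Suc n) x))" by blast
      have "g x = the (iter f n (the (sphere_map f x)))" if "x \<in> V" for x
        using V[OF that] by (auto simp: n iter_Suc' map_comp_def simp del: iter.simps(2))
      then show "\<exists>h\<in>range (\<lambda>n x. the (iter f n x)). \<forall>x\<in>V. g x = h (the (sphere_map f x))" by auto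
    qed
    \<comment> \<open>Pulling back along \<open>f\<close> yields the iterates from the first one on;
      the identity has to be added.\<close>
    then have "normal_family V (range (\<lambda>n x. the (iter f (Suc n) x)) \<union> {\<lambda>x. the (iter f 0 x)})"
      by (intro normal_family_Un normal_family_singleton)
    moreover have "range (\<lambda>n x. the (iter f n x)) \<subseteq> range (\<lambda>n x. the (iter f (Suc n) x)) \<union> {\<lambda>x. the (iter f 0 x)}"
    proof
      fix g assume "g \<in> range (\<lambda>n x. the (iter f n x))"
      then obtain n where "g = (\<lambda>x. the (iter f n x))" by blast
      then show "g \<in> range (\<lambda>n x. the (iter f (Suc n) x)) \<union> {\<lambda>x. the (iter f 0 x)}"
        by (cases n) blast+
    qed
    ultimately show ?thesis using normal_family_subset by blast
  qed
  ultimately show ?thesis by (auto simp: Fatou_def)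
qed

text \<open>By the open mapping theorem every \<open>v\<close> near \<open>y\<close> has a preimage
  \<open>\<sigma> v\<close> in a fixed compact neighbourhood of \<open>x\<close>. The iterates at
  \<open>v\<close> are shifted iterates at \<open>\<sigma> v\<close>, and these converge uniformly
  on that whole neighbourhood, however irregular the choice of \<open>\<sigma>\<close> is.\<close>

lemma Fatou_forward:
  assumes "sphere_map f x = Some y" "x \<in> Fatou f"
  shows "y \<in> Fatou f"
proof -
  obtain U where U: "open U" "x \<in> U" "\<And>n. U \<subseteq> dom (iter f n)"
      "normal_family U (range (\<lambda>n x. the (iter f n x)))"
    using assms(2) by (auto simp: Fatou_def)
  obtain s where s: "s > 0" "chart x ` cball 0 s \<subseteq> U" using nhds_obtain_chart_ball[OF U(1,2)] .
  have "open (chart x ` ball 0 s)" "x \<in> chart x ` ball 0 s"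
    using s(1) by (auto intro!: open_chart_image simp: image_iff intro!: bexI[of _ 0])
  from sphere_map_open[OF assms(1) this] obtain V where V: "open V" "y \<in> V"
      "\<And>v. v \<in> V \<Longrightarrow> \<exists>u\<in>chart x ` ball 0 s. sphere_map f u = Some v"
    by blast
  then obtain \<sigma> where \<sigma>: "\<And>v. v \<in> V \<Longrightarrow> \<sigma> v \<in> chart x ` ball 0 s"
      "\<And>v. v \<in> V \<Longrightarrow> sphere_map f (\<sigma> v) = Some v"
    by metis
  have it: "iter f n v = iter f (Suc n) (\<sigma> v)" if "v \<in> V" for n v
    using \<sigma>(2)[OF that] by (simp add: iter_Suc' map_comp_def del: iter.simps(2))
  have "V \<subseteq> dom (iter f n)" for n
  proof
    fix v assume v: "v \<in> V"
    then have "\<sigma> v \<in> dom (iter f (Suc n))"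
      using \<sigma>(1)[OF v] s(2) U(3)[of "Suc n"] ball_subset_cball[of 0 s] by blast
    then show "v \<in> dom (iter f n)" using it[OF v] by (simp add: dom_def)
  qed
  moreover have "normal_family V (range (\<lambda>n x. the (iter f n x)))"
  proof (rule normal_familyI)
    fix g :: "nat \<Rightarrow> rsphere \<Rightarrow> rsphere" assume "range g \<subseteq> range (\<lambda>n x. the (iter f n x))"
    then have "\<forall>k. \<exists>n. g k = (\<lambda>x. the (iter f n x))" by blast
    then obtain n where n: "\<And>k. g k = (\<lambda>x. the (iter f (n k) x))" by metis
    have "range (\<lambda>k. (\<lambda>m x. the (iter f m x)) (Suc (n k))) \<subseteq> range (\<lambda>n x. the (iter f n x))"
      by (rule image_subsetI, rule rangeI)
    then obtain r h where r: "strict_mono (r :: nat \<Rightarrow> nat)"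
        "\<And>K. compact K \<Longrightarrow> K \<subseteq> U \<Longrightarrow>
           uniform_limit K ((\<lambda>k x. the (iter f (Suc (n k)) x)) \<circ> r) h sequentially"
      by (rule normal_familyE[OF U(4)]) blast
    have "compact (chart x ` cball 0 s)"
      by (intro compact_continuous_image continuous_intros) auto
    then have lim: "uniform_limit (chart x ` cball 0 s)
        ((\<lambda>k x. the (iter f (Suc (n k)) x)) \<circ> r) h sequentially"
      by (rule r(2)[OF _ s(2)])
    have "uniform_limit K (g \<circ> r) (h \<circ> \<sigma>) sequentially" if "K \<subseteq> V" for K
      unfolding uniform_limit_iff
    proof (intro allI impI)
      fix e :: real assume "e > 0"
      then have "\<forall>\<^sub>F k in sequentially. \<forall>x\<in>chart x ` cball 0 s.
          dist (the (iter f (Suc (n (r k))) x)) (h x) < e"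
        using lim unfolding uniform_limit_iff by (simp del: iter.simps(2))
      then show "\<forall>\<^sub>F k in sequentially. \<forall>v\<in>K. dist ((g \<circ> r) k v) ((h \<circ> \<sigma>) v) < e"
      proof eventually_elim
        case (elim k)
        show ?case
        proof
          fix v assume "v \<in> K"
          then have v: "v \<in> V" using that by blast
          then have "\<sigma> v \<in> chart x ` cball 0 s" using \<sigma>(1) by fastforce
          with elim have "dist (the (iter f (Suc (n (r k))) (\<sigma> v))) (h (\<sigma> v)) < e"
            by blast
          then show "dist ((g \<circ> r) k v) ((h \<circ> \<sigma>) v) < e"
            by (simp add: n it[OF v] del: iter.simps(2))
        qed
      qed
    qed
    then show "\<exists>h r. strict_mono (r :: nat \<Rightarrow> nat) \<and>
           (\<forall>K. compact K \<longrightarrow> K \<subseteq> V \<longrightarrow> uniform_limit K (g \<circ> r) h sequentially)"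
      using r(1) by blast
  qed
  ultimately show ?thesis
    using V(1,2) unfolding Fatou_def by blast
qed

lemma Fatou_iter_iff: "iter f n x = Some y \<Longrightarrow> y \<in> Fatou f \<longleftrightarrow> x \<in> Fatou f"
proof (induction n arbitrary: y)
  case (Suc n)
  then obtain u where u: "iter f n x = Some u" "sphere_map f u = Some y" using iter_SucE' by blast
  then show ?case using Suc.IH Fatou_backward Fatou_forward by blast
qed auto

lemma Julia_iter_iff:
  "iter f n (Fin z) = Some (Fin y) \<Longrightarrow> y \<in> Julia f \<longleftrightarrow> z \<in> Julia f"
  using Fatou_iter_iff by (auto simp: Julia_def)

end

section \<open>Uniform expansion implies hyperbolicity\<close>

text \<open>The right-hand side of the equivalence.\<close>

definition uniformly_expanding :: "(complex \<Rightarrow> complex) \<Rightarrow> bool" where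
  "uniformly_expanding f \<longleftrightarrow>
    (\<exists>c>0. \<exists>\<mu>>1. \<exists>\<delta>>0. \<forall>n::nat. \<forall>a\<in>Julia f.
       \<forall>U\<in>components (preimage f n (Fin ` ball a \<delta>)). \<forall>z w :: complex.
         Fin z \<in> U \<and> Fin w \<in> U \<longrightarrow>
           dist (plane_iter f n z) (plane_iter f n w) \<ge> c * \<mu> ^ n * dist z w)"

lemma field_derivative_norm_ge:
  assumes "(g has_field_derivative D) (at z)"
    and "\<forall>\<^sub>F w in nhds z. dist (g w) (g z) \<ge> L * dist w z"
  shows "norm D \<ge> L"
proof (rule tendsto_lowerbound[of "\<lambda>w. norm ((g w - g z) / (w - z))" _ "at z"])
  show "((\<lambda>w. norm ((g w - g z) / (w - z))) \<longlongrightarrow> norm D) (at z)"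
    using assms(1) unfolding has_field_derivative_iff by (rule tendsto_norm)
  have "\<forall>\<^sub>F w in at z. dist (g w) (g z) \<ge> L * dist w z"
    using assms(2) by (simp add: eventually_nhds_conv_at)
  moreover have "\<forall>\<^sub>F w in at z. w \<noteq> z" by (simp add: eventually_at_filter)
  ultimately show "\<forall>\<^sub>F w in at z. norm ((g w - g z) / (w - z)) \<ge> L"
    by eventually_elim (simp add: dist_norm norm_divide pos_le_divide_eq)
qed auto

lemma component_subset_obtain:
  assumes "connected C" "C \<subseteq> S" "x \<in> C"
  obtains U where "U \<in> components S" "C \<subseteq> U"
  using assms by (meson componentsI connected_component_maximal in_mono subset_iff)

context meromorphic_dynamics
begin

context
  fixes c \<mu> \<delta> :: real
  assumes c: "c > 0" and \<mu>: "\<mu> > 1" and \<delta>: "\<delta> > 0"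
    and expand: "\<And>n a U z w. a \<in> Julia f \<Longrightarrow> U \<in> components (preimage f n (Fin ` ball a \<delta>)) \<Longrightarrow>
        Fin z \<in> U \<Longrightarrow> Fin w \<in> U \<Longrightarrow>
        dist (plane_iter f n z) (plane_iter f n w) \<ge> c * \<mu> ^ n * dist z w"
begin

text \<open>A connected set lies in one component. Its image lies in a disk of diameter
  \<open>2 * \<delta>\<close>, so expansion bounds the diameter of its finite part; this is what
  excludes paths to infinity.\<close>

lemma expand_connected:
  assumes "a \<in> Julia f" "connected C" "C \<subseteq> preimage f n (Fin ` ball a \<delta>)" "Fin z \<in> C" "Fin w \<in> C"
  shows "dist (plane_iter f n z) (plane_iter f n w) \<ge> c * \<mu> ^ n * dist z w"
    and "dist z w \<le> 2 * \<delta> / (c * \<mu> ^ n)"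
proof -
  show 1: "dist (plane_iter f n z) (plane_iter f n w) \<ge> c * \<mu> ^ n * dist z w"
    using component_subset_obtain[OF assms(2,3,4)] expand[OF assms(1)] assms(4,5)
    by (metis subsetD)
  have "plane_iter f n z \<in> ball a \<delta>" "plane_iter f n w \<in> ball a \<delta>"
    using assms(3-5) by (auto simp: subset_iff preimage_iff plane_iter_def)
  then have "dist (plane_iter f n z) (plane_iter f n w) < 2 * \<delta>"
    using dist_triangle_half_r[of a _ "2 * \<delta>"] by auto
  then have "c * \<mu> ^ n * dist z w \<le> 2 * \<delta>" using 1 by linarith
  moreover have "c * \<mu> ^ n > 0" using c \<mu> by simp
  ultimately show "dist z w \<le> 2 * \<delta> / (c * \<mu> ^ n)" by (simp add: pos_le_divide_eq mult.commute)
qed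

text \<open>A small disk about \<open>z\<close> lies in one component, so the difference quotients
  at \<open>z\<close> are bounded below.\<close>

lemma expand_deriv:
  assumes "a \<in> Julia f" "iter f n (Fin z) = Some (Fin y)" "y \<in> ball a \<delta>"
  shows "cmod (deriv (plane_iter f n) z) \<ge> c * \<mu> ^ n"
proof (rule field_derivative_norm_ge)
  show "(plane_iter f n has_field_derivative deriv (plane_iter f n) z) (at z)"
    using plane_iter_analytic[OF assms(2)] analytic_on_imp_differentiable_at DERIV_deriv_iff_field_differentiable
    by blast
  have "open (preimage f n (Fin ` ball a \<delta>))" by (rule open_preimage) simp
  moreover have "Fin z \<in> preimage f n (Fin ` ball a \<delta>)" using assms by (auto simp: preimage_iff)
  ultimately obtain r where r: "r > 0" "chart (Fin z) ` cball 0 r \<subseteq> preimage f n (Fin ` ball a \<delta>)"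
    using nhds_obtain_chart_ball by blast
  have C: "connected (chart (Fin z) ` cball 0 r)"
    by (intro connected_continuous_image continuous_intros) auto
  have inC: "Fin w \<in> chart (Fin z) ` cball 0 r" if "w \<in> cball z r" for w
    using that by (auto simp: dist_norm norm_minus_commute intro!: image_eqI[of _ _ "w - z"])
  have "\<forall>\<^sub>F w in nhds z. w \<in> ball z r" using r by (intro eventually_nhds_in_open) auto
  then show "\<forall>\<^sub>F w in nhds z. dist (plane_iter f n w) (plane_iter f n z) \<ge> c * \<mu> ^ n * dist w z"
  proof eventually_elim
    case (elim w)
    then show ?case
      using expand_connected(1)[OF assms(1) C r(2) inC inC, of w z] r(1) by auto
  qed
qed

text \<open>Otherwise a whole neighbourhood of infinity would be a connected part of the preimage,
  although it is unbounded.\<close>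

lemma expand_Infty:
  assumes "a \<in> Julia f"
  shows "Infty \<notin> preimage f n (Fin ` ball a \<delta>)"
proof
  assume "Infty \<in> preimage f n (Fin ` ball a \<delta>)"
  moreover have "open (preimage f n (Fin ` ball a \<delta>))" by (rule open_preimage) simp
  ultimately obtain r where r: "r > 0" "chart Infty ` cball 0 r \<subseteq> preimage f n (Fin ` ball a \<delta>)"
    using nhds_obtain_chart_ball by blast
  have C: "connected (chart Infty ` cball 0 r)"
    by (intro connected_continuous_image continuous_intros) auto
  \<comment> \<open>The diameter bound; the contradiction comes from two real points of the
    neighbourhood at distance \<open>b + 1\<close>.\<close>
  define b where "b = 2 * \<delta> / (c * \<mu> ^ n)"
  have inC: "Fin (complex_of_real t) \<in> chart Infty ` cball 0 r" if "t \<ge> 1 / r" for t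
  proof -
    have "t > 0" using r(1) that by (meson divide_pos_pos less_le_trans zero_less_one)
    then have "norm (1 / complex_of_real t) \<le> r"
      using that r(1) by (simp add: norm_divide field_simps)
    then show ?thesis
      using \<open>t > 0\<close> by (auto intro!: image_eqI[of _ _ "1 / complex_of_real t"])
  qed
  have "b > 0" using \<delta> c \<mu> by (auto simp: b_def)
  have "dist (complex_of_real (1 / r)) (complex_of_real (1 / r + b + 1)) \<le> b"
    unfolding b_def[symmetric] using \<open>b > 0\<close>
    by (intro expand_connected(2)[OF assms C r(2), folded b_def] inC) auto
  moreover have "dist (complex_of_real (1 / r)) (complex_of_real (1 / r + b + 1)) = b + 1"
    using \<open>b > 0\<close> unfolding dist_norm of_real_diff[symmetric] norm_of_real by simp
  ultimately show False by simp
qed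

text \<open>By the chain rule the next iterate would have derivative 0 at a finite critical point
  over \<open>v\<close>. A critical point at infinity would put infinity into a preimage of the
  disk.\<close>

lemma expand_no_critical_value:
  assumes "a \<in> Julia f" "v \<in> finite_critical_values f"
  shows "Fin v \<notin> preimage f n (Fin ` ball a \<delta>)"
proof
  assume "Fin v \<in> preimage f n (Fin ` ball a \<delta>)"
  then obtain y where y: "y \<in> ball a \<delta>" "iter f n (Fin v) = Some (Fin y)"
    by (auto simp: preimage_iff)
  consider z where "v = f z" "\<not> is_pole f z" "deriv f z = 0" | "sphere_map f Infty = Some (Fin v)"
    using assms(2) by (auto simp: finite_critical_values_def)
  then show False
  proof cases
    case 1
    have s: "sphere_map f (Fin z) = Some (Fin v)" using 1 by (simp add: to_sphere_def)
    then have it: "iter f (Suc n) (Fin z) = Some (Fin y)"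
      using y(2) by (simp add: iter_Suc' map_comp_def del: iter.simps(2) sphere_map_Fin)
    have "\<forall>\<^sub>F w in nhds z. plane_iter f (Suc n) w = (plane_iter f n \<circ> f) w"
    proof -
      have "\<forall>\<^sub>F w in nhds z. iter f 1 (Fin w) = Some (Fin (plane_iter f 1 w))"
        using s by (intro plane_iter_near) auto
      then show ?thesis
        by eventually_elim
           (auto simp: plane_iter_def iter_Suc' map_comp_def to_sphere_def simp del: iter.simps(2) split: if_splits)
    qed
    then have "deriv (plane_iter f (Suc n)) z = deriv (plane_iter f n \<circ> f) z"
      by (rule deriv_cong_ev) simp
    also have "\<dots> = deriv (plane_iter f n) (f z) * deriv f z"
      using analytic_at_nonpole[OF 1(2)] plane_iter_analytic[OF y(2)] 1(1)
      by (intro deriv_chain) (auto intro: analytic_on_imp_differentiable_at)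
    finally have "deriv (plane_iter f (Suc n)) z = 0" using 1 by simp
    moreover have "c * \<mu> ^ Suc n > 0" using c \<mu> by simp
    ultimately show False
      using expand_deriv[OF assms(1) it y(1)] by simp
  next
    case 2
    then have "Infty \<in> preimage f (Suc n) (Fin ` ball a \<delta>)"
      using y by (auto simp: preimage_iff iter_Suc' map_comp_def simp del: iter.simps(2))
    then show False using expand_Infty[OF assms(1)] by blast
  qed
qed

text \<open>The tail of the asymptotic path would be a connected unbounded subset of the preimage
  under one more iterate.\<close>

lemma expand_no_asymptotic_value:
  assumes "a \<in> Julia f" "v \<in> finite_asymptotic_values f"
  shows "Fin v \<notin> preimage f n (Fin ` ball a \<delta>)"
proof
  assume v: "Fin v \<in> preimage f n (Fin ` ball a \<delta>)"
  obtain \<gamma> :: "real \<Rightarrow> complex" where \<gamma>: "continuous_on {0..} \<gamma>" "filterlim \<gamma> at_infinity at_top"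
      "((\<lambda>t. to_sphere f (\<gamma> t)) \<longlongrightarrow> Fin v) at_top"
    using assms(2) by (auto simp: finite_asymptotic_values_def)
  have "open (preimage f n (Fin ` ball a \<delta>))" by (rule open_preimage) simp
  then have "\<forall>\<^sub>F t in at_top. to_sphere f (\<gamma> t) \<in> preimage f n (Fin ` ball a \<delta>)"
    using v \<gamma>(3) by (intro topological_tendstoD)
  then obtain T0 where T0: "\<And>t. t \<ge> T0 \<Longrightarrow> to_sphere f (\<gamma> t) \<in> preimage f n (Fin ` ball a \<delta>)"
    by (auto simp: eventually_at_top_linorder)
  define T where "T = max 0 T0"
  define C where "C = Fin ` \<gamma> ` {T..}"
  have "connected C" unfolding C_def
    by (intro connected_continuous_image continuous_intros continuous_on_subset[OF \<gamma>(1)])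
       (auto simp: T_def)
  moreover have "C \<subseteq> preimage f (Suc n) (Fin ` ball a \<delta>)"
  proof -
    have "Fin (\<gamma> t) \<in> preimage f (Suc n) (Fin ` ball a \<delta>)" if "t \<ge> T" for t
      using T0[of t] that by (auto simp: T_def preimage_iff iter_Suc' map_comp_def simp del: iter.simps(2))
    then show ?thesis by (auto simp: C_def)
  qed
  ultimately have bd: "dist (\<gamma> T) (\<gamma> t) \<le> 2 * \<delta> / (c * \<mu> ^ Suc n)" if "t \<ge> T" for t
    by (rule expand_connected(2)[OF assms(1)]) (use that in \<open>auto simp: C_def\<close>)
  have "filterlim (\<lambda>t. norm (\<gamma> t)) at_top at_top"
    using \<gamma>(2) by (rule filterlim_at_infinity_imp_norm_at_top)
  then have "\<forall>\<^sub>F t in at_top. norm (\<gamma> t) > norm (\<gamma> T) + 2 * \<delta> / (c * \<mu> ^ Suc n)"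
    by (simp only: filterlim_at_top_dense)
  moreover have "\<forall>\<^sub>F t in at_top. t \<ge> T" by (rule eventually_ge_at_top)
  ultimately have "\<forall>\<^sub>F t in at_top. norm (\<gamma> t) > norm (\<gamma> T) + 2 * \<delta> / (c * \<mu> ^ Suc n) \<and> t \<ge> T"
    by (rule eventually_conj)
  then obtain t where t: "norm (\<gamma> t) > norm (\<gamma> T) + 2 * \<delta> / (c * \<mu> ^ Suc n)" "t \<ge> T"
    by (auto simp only: eventually_at_top_linorder)
  have "norm (\<gamma> t) \<le> norm (\<gamma> T) + dist (\<gamma> T) (\<gamma> t)"
    by (metis dist_commute dist_norm norm_triangle_sub)
  then show False using t(1) bd[OF t(2)] by linarith
qed

lemma expand_post_singular:
  assumes "a \<in> Julia f" "Fin y \<in> post_singular f"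
  shows "y \<notin> ball a \<delta>"
proof
  assume y: "y \<in> ball a \<delta>"
  let ?O = "\<Union>n. (\<lambda>x. the (iter f n x)) ` (Fin ` sing_inv f - (\<Union>j<n. preimage f j {Infty}))"
  have op0: "open (Fin ` ball a \<delta>)" by simp
  have "Fin y \<in> Fin ` ball a \<delta> \<inter> closure ?O" using y assms(2) by (simp add: post_singular_def)
  then have "Fin ` ball a \<delta> \<inter> closure ?O \<noteq> {}" by (metis empty_iff)
  then have "Fin ` ball a \<delta> \<inter> ?O \<noteq> {}"
    \<comment> \<open>An open set that meets a closure meets the set itself. This disposes of the
      closure in \<open>post_singular\<close>, and below of the one in
      \<open>sing_inv\<close>.\<close>
    by (simp only: open_Int_closure_eq_empty[OF op0] not_False_eq_True simp_thms)
  then obtain x where x: "x \<in> Fin ` ball a \<delta>" "x \<in> ?O" by (metis (no_types, lifting) IntE ex_in_conv)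
  then obtain n where "x \<in> (\<lambda>x. the (iter f n x)) ` (Fin ` sing_inv f - (\<Union>j<n. preimage f j {Infty}))"
    by (elim UN_E)
  then obtain u where u: "x = the (iter f n u)" "u \<in> Fin ` sing_inv f" "u \<notin> (\<Union>j<n. preimage f j {Infty})"
    by (elim imageE DiffE) blast
  then obtain s where n: "s \<in> sing_inv f" "Fin s \<notin> (\<Union>j<n. preimage f j {Infty})"
      "the (iter f n (Fin s)) \<in> Fin ` ball a \<delta>"
    using x(1) by (elim imageE[of u]) simp
  \<comment> \<open>Only infinity can lie outside the domain of the map, so an orbit that avoids
    infinity before time \<open>n\<close> can be continued up to time \<open>n\<close>.\<close>
  have "Fin s \<in> dom (iter f k)" if "k \<le> n" for k
    using that
  proof (induction k)
    case (Suc k)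
    then obtain u where u: "iter f k (Fin s) = Some u" by auto
    then have "u \<noteq> Infty" using n(2) Suc.prems by (auto simp: preimage_iff)
    then show ?case using u by (cases u) (auto simp: map_comp_def)
  qed auto
  then have s: "Fin s \<in> preimage f n (Fin ` ball a \<delta>)" using n(3) by (simp add: preimage_def)
  have op: "open (Fin -` preimage f n (Fin ` ball a \<delta>))"
  proof (rule open_vimage)
    show "open (preimage f n (Fin ` ball a \<delta>))" by (rule open_preimage) simp
    show "continuous_on UNIV Fin" using continuous_on_Fin[OF continuous_on_id] by simp
  qed
  have "s \<in> Fin -` preimage f n (Fin ` ball a \<delta>) \<inter> closure (finite_critical_values f \<union> finite_asymptotic_values f)"
    using s n(1) by (simp add: sing_inv_def)
  then have "Fin -` preimage f n (Fin ` ball a \<delta>) \<inter> (finite_critical_values f \<union> finite_asymptotic_values f) \<noteq> {}"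
    using open_Int_closure_eq_empty[OF op] by blast
  then show False
    using expand_no_critical_value[OF assms(1)] expand_no_asymptotic_value[OF assms(1)] by blast
qed

lemma expand_imp_hyperbolic: "euclidean_hyperbolic f"
  unfolding euclidean_hyperbolic_def
proof (intro conjI exI allI ballI impI)
  have "ereal \<delta> \<le> set_distance {z. Fin z \<in> post_singular f} (Julia f)" unfolding set_distance_def
  proof (rule INF_greatest)
    fix p assume "p \<in> {z. Fin z \<in> post_singular f} \<times> Julia f"
    then obtain y a where "p = (y, a)" "Fin y \<in> post_singular f" "a \<in> Julia f" by auto
    then show "ereal \<delta> \<le> (case p of (x, y) \<Rightarrow> ereal (dist x y))"
      using expand_post_singular[of a y] by (simp add: dist_commute)
  qed
  then show "0 < set_distance {z. Fin z \<in> post_singular f} (Julia f)"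
    using \<delta> by (metis ereal_less(2) less_le_trans)
  fix n z assume z: "z \<in> Julia f" "Fin z \<notin> Julia_infty f" "(1::nat) \<le> n"
  have dm: "\<exists>y. iter f k (Fin z) = Some (Fin y)" for k
  proof (induction k)
    case (Suc k)
    then obtain u where "iter f k (Fin z) = Some (Fin u)" by auto
    then have "iter f (Suc k) (Fin z) = Some (to_sphere f u)" by (simp add: map_comp_def)
    moreover have "iter f (Suc k) (Fin z) \<noteq> Some Infty"
    proof
      assume "iter f (Suc k) (Fin z) = Some Infty"
      then have "Fin z \<in> preimage f (Suc k) {Infty}"
        by (simp add: preimage_iff del: iter.simps(2))
      then show False using z(2) unfolding Julia_infty_def by (metis UNIV_I UN_I)
    qed
    ultimately show ?case by (cases "to_sphere f u") auto
  qed auto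
  obtain y where y: "iter f n (Fin z) = Some (Fin y)" using dm by blast
  then have "y \<in> Julia f" using Julia_iter_iff z(1) by blast
  then show "c * \<mu> ^ n \<le> cmod (deriv (plane_iter f n) z)" using expand_deriv[OF _ y] \<delta> by auto
qed (use c \<mu> in auto)

end

lemma uniformly_expanding_imp_hyperbolic:
  assumes "uniformly_expanding f"
  shows "euclidean_hyperbolic f"
proof -
  obtain c \<mu> \<delta> where *: "c > 0" "\<mu> > 1" "\<delta> > 0" "\<forall>n::nat. \<forall>a\<in>Julia f.
       \<forall>U\<in>components (preimage f n (Fin ` ball a \<delta>)). \<forall>z w :: complex.
         Fin z \<in> U \<and> Fin w \<in> U \<longrightarrow>
           dist (plane_iter f n z) (plane_iter f n w) \<ge> c * \<mu> ^ n * dist z w"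
    using assms unfolding uniformly_expanding_def by (elim exE conjE) (rule that)
  show ?thesis
    by (rule expand_imp_hyperbolic[OF *(1-3)]) (intro *(4)[rule_format] conjI)
qed

end

section \<open>Koebe distortion from Schottky's theorem\<close>

text \<open>Schottky's bound on the disk of radius \<open>2/3\<close> for
  \<open>(g - \<alpha>) / (\<beta> - \<alpha>)\<close>, which omits 0 and 1, carried back to
  \<open>g\<close>.\<close>

definition omit_bound :: "complex \<Rightarrow> complex \<Rightarrow> real \<Rightarrow> real" where
  "omit_bound \<alpha> \<beta> M = norm \<alpha> + norm (\<beta> - \<alpha>) *
     exp (pi * exp (pi * (2 + 2 * ((M + norm \<alpha>) / norm (\<beta> - \<alpha>)) + 12 * (2/3) / (1 - 2/3))))"

lemma omit_two_values_bound:
  assumes hol: "g holomorphic_on ball 0 r" and "r > 0" and neq: "\<alpha> \<noteq> \<beta>"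
    and omit: "\<And>z. z \<in> ball 0 r \<Longrightarrow> g z \<noteq> \<alpha> \<and> g z \<noteq> \<beta>"
    and M: "norm (g 0) \<le> M" and z: "norm z < r / 2"
  shows "norm (g z) \<le> omit_bound \<alpha> \<beta> M"
proof -
  \<comment> \<open>Scaling by \<open>3 * r / 4\<close> keeps the closed unit disk inside the domain
    of \<open>g\<close>, as Schottky's theorem requires, and turns \<open>norm z < r / 2\<close>
    into radius at most \<open>2/3\<close>.\<close>
  define F where "F = (\<lambda>u. (g (complex_of_real (3 * r / 4) * u) - \<alpha>) / (\<beta> - \<alpha>))"
  have inb: "complex_of_real (3 * r / 4) * u \<in> ball 0 r" if "u \<in> cball 0 1" for u
  proof -
    have "norm (complex_of_real (3 * r / 4) * u) \<le> 3 * r / 4 * 1"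
      unfolding norm_mult norm_of_real using that \<open>r > 0\<close> by (intro mult_mono) auto
    then show ?thesis using \<open>r > 0\<close> by simp
  qed
  have F: "F holomorphic_on cball 0 1" unfolding F_def
    by (intro holomorphic_intros holomorphic_on_compose_gen[OF _ hol, unfolded o_def])
       (use neq inb in auto)
  have F0: "norm (F 0) \<le> (M + norm \<alpha>) / norm (\<beta> - \<alpha>)"
  proof -
    have "norm (g 0 - \<alpha>) \<le> M + norm \<alpha>" using M norm_triangle_ineq4[of "g 0" \<alpha>] by linarith
    then show ?thesis by (simp add: F_def norm_divide divide_right_mono)
  qed
  have F01: "\<not> (F u = 0 \<or> F u = 1)" if "u \<in> cball 0 1" for u
    using omit[OF inb[OF that]] neq by (auto simp: F_def divide_simps)
  define u where "u = z / complex_of_real (3 * r / 4)"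
  have u: "norm u \<le> 2/3" using z \<open>r > 0\<close> by (simp add: u_def norm_divide field_simps)
  have "norm (F u) \<le> exp (pi * exp (pi * (2 + 2 * ((M + norm \<alpha>) / norm (\<beta> - \<alpha>)) + 12 * (2/3) / (1 - 2/3))))"
    using Schottky[OF F F0 F01 _ _ u] by simp
  moreover have "g z = \<alpha> + (\<beta> - \<alpha>) * F u" using neq \<open>r > 0\<close> by (simp add: F_def u_def)
  then have "norm (g z) \<le> norm \<alpha> + norm (\<beta> - \<alpha>) * norm (F u)"
    by (metis norm_mult norm_triangle_ineq)
  ultimately show ?thesis
    unfolding omit_bound_def by (meson add_left_mono mult_left_mono norm_ge_zero order_trans)
qed

text \<open>If the image contained the disk of radius 2, the inverse function precomposed with
  doubling would map the unit disk into itself, fix 0 and have derivative 2 there, against Schwarz's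
  lemma.\<close>

lemma univalent_omits:
  assumes hol: "h holomorphic_on ball 0 1" and inj: "inj_on h (ball 0 1)"
    and h: "h 0 = 0" "deriv h 0 = 1"
  obtains w where "norm w < 2" "w \<notin> h ` ball 0 1"
proof -
  have False if sub: "ball 0 2 \<subseteq> h ` ball 0 1"
  proof -
    obtain g where g: "g holomorphic_on h ` ball 0 1"
        "\<And>z. z \<in> ball 0 1 \<Longrightarrow> deriv h z * deriv g (h z) = 1"
        "\<And>z. z \<in> ball 0 1 \<Longrightarrow> g (h z) = z"
      using holomorphic_has_inverse[OF hol open_ball inj] by metis
    define G where "G = (\<lambda>u. g (2 * u))"
    have gb: "g holomorphic_on ball 0 2" using g(1) sub by (rule holomorphic_on_subset)
    have G: "G holomorphic_on ball 0 1" unfolding G_def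
      by (intro holomorphic_intros holomorphic_on_compose_gen[OF _ gb, unfolded o_def])
         (auto simp: norm_mult)
    have G0: "G 0 = 0" using g(3)[of 0] h by (simp add: G_def)
    have G1: "norm (G u) < 1" if "norm u < 1" for u
    proof -
      have "2 * u \<in> ball 0 2" using that by (simp add: norm_mult)
      then obtain z where "z \<in> ball 0 1" "2 * u = h z" using sub by blast
      then show ?thesis using g(3)[of z] by (simp add: G_def)
    qed
    have "deriv g 0 = 1" using g(2)[of 0] h by simp
    moreover have "g field_differentiable at 0"
      using gb by (rule holomorphic_on_imp_differentiable_at) auto
    ultimately have dg: "(g has_field_derivative 1) (at 0)"
      by (metis DERIV_deriv_iff_field_differentiable)
    have "((\<lambda>u. g (2 * u)) has_field_derivative 1 * 2) (at 0)"
      by (rule DERIV_chain2[of g _ "\<lambda>u. 2 * u"]) (use dg in \<open>auto intro!: derivative_eq_intros\<close>)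
    then have "deriv G 0 = 2" unfolding G_def using DERIV_imp_deriv by fastforce
    moreover have "norm (deriv G 0) \<le> 1" using Schwarz_Lemma(2)[OF G G0 G1, of 0] by simp
    ultimately show False by simp
  qed
  then show thesis using that unfolding subset_iff mem_ball dist_0_norm by blast
qed

text \<open>
  The square root of \<open>1 - h / w\<close>, where \<open>w\<close> is an omitted value, omits \<open>0\<close> and
  also the value at \<open>0\<close> of the other branch, so Schottky's theorem bounds it.
\<close>

lemma univalent_bound:
  assumes hol: "h holomorphic_on ball 0 1" and inj: "inj_on h (ball 0 1)"
    and h: "h 0 = 0" "deriv h 0 = 1" and z: "norm z < 1 / 2"
  shows "norm (h z) \<le> 2 * (1 + (omit_bound 0 1 1)\<^sup>2)"
proof -
  obtain w where w: "norm w < 2" "w \<notin> h ` ball 0 1" using univalent_omits[OF hol inj h] .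
  have "w \<noteq> 0" using w(2) h(1) by (metis centre_in_ball imageI zero_less_one)
  have nz: "1 - h u / w \<noteq> 0" if "u \<in> ball 0 1" for u
    using w(2) that \<open>w \<noteq> 0\<close> by (auto simp: field_simps)
  have "(\<lambda>u. 1 - h u / w) holomorphic_on ball 0 1"
    using \<open>w \<noteq> 0\<close> by (intro holomorphic_intros hol) auto
  then obtain \<psi> where \<psi>: "\<psi> holomorphic_on ball 0 1" "\<And>u. u \<in> ball 0 1 \<Longrightarrow> 1 - h u / w = (\<psi> u)\<^sup>2"
    using contractible_imp_holomorphic_sqrt[OF _ convex_imp_contractible[OF convex_ball], of "\<lambda>u. 1 - h u / w" 0 1] nz
    by metis
  have \<psi>0: "(\<psi> 0)\<^sup>2 = 1" using \<psi>(2)[of 0] h by simp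
  then have \<psi>0': "\<psi> 0 \<noteq> 0" by auto
  \<comment> \<open>Normalised to \<open>\<xi> 0 = -1\<close>, so the other branch has value 1 at 0.
    Where \<open>\<xi> u = 1\<close>, the square gives \<open>h u = 0\<close>, hence
    \<open>u = 0\<close> by injectivity.\<close>
  define \<xi> where "\<xi> = (\<lambda>u. - \<psi> u / \<psi> 0)"
  have \<xi>sq: "(\<xi> u)\<^sup>2 = 1 - h u / w" if "u \<in> ball 0 1" for u
    using \<psi>(2)[OF that] \<psi>0 by (simp add: \<xi>_def power_divide)
  have \<xi>0: "\<xi> 0 = -1" using \<psi>0' by (simp add: \<xi>_def)
  have "\<xi> u \<noteq> 0 \<and> \<xi> u \<noteq> 1" if u: "u \<in> ball 0 1" for u
  proof -
    have "\<xi> u \<noteq> 0" using nz[OF u] \<xi>sq[OF u] by auto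
    moreover have "\<xi> u \<noteq> 1"
    proof
      assume 1: "\<xi> u = 1"
      then have "h u = 0" using \<xi>sq[OF u] \<open>w \<noteq> 0\<close> by simp
      then have "u = 0" using inj_onD[OF inj, of u 0] h u by simp
      then show False using 1 \<xi>0 by simp
    qed
    ultimately show ?thesis by blast
  qed
  moreover have "\<xi> holomorphic_on ball 0 1"
    unfolding \<xi>_def using \<psi>0' by (intro holomorphic_intros \<psi>(1)) auto
  ultimately have "norm (\<xi> z) \<le> omit_bound 0 1 1"
    using z \<xi>0 by (intro omit_two_values_bound[of \<xi> 1 0 1]) auto
  then have "norm ((\<xi> z)\<^sup>2) \<le> (omit_bound 0 1 1)\<^sup>2" by (simp add: norm_power power_mono)
  moreover have "h z = w * (1 - (\<xi> z)\<^sup>2)" using \<xi>sq[of z] z \<open>w \<noteq> 0\<close> by simp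
  then have "norm (h z) \<le> norm w * (1 + norm ((\<xi> z)\<^sup>2))"
    by (metis norm_mult norm_one norm_triangle_ineq4 mult_left_mono norm_ge_zero)
  ultimately have "norm (h z) \<le> norm w * (1 + (omit_bound 0 1 1)\<^sup>2)"
    by (meson add_left_mono mult_left_mono norm_ge_zero order_trans)
  also have "\<dots> \<le> 2 * (1 + (omit_bound 0 1 1)\<^sup>2)" using w(1) by (intro mult_right_mono) auto
  finally show ?thesis .
qed

text \<open>The bound \<open>2 * (1 + ...)\<close> for normalised univalent functions times 8, the
  factor from Cauchy's inequality on a circle of radius \<open>\<rho> / 8\<close>.\<close>

definition Koebe_const :: real where
  "Koebe_const = 16 * (1 + (omit_bound 0 1 1)\<^sup>2)"

lemma Koebe_const_pos: "Koebe_const > 0"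
  by (simp add: Koebe_const_def add_pos_nonneg)

text \<open>Rescaled to the unit disk and normalised, \<open>g\<close> is bounded on the half disk
  by \<open>univalent_bound\<close>; Cauchy's inequality turns this into a bound for the
  derivative.\<close>

lemma Koebe_distortion:
  assumes hol: "g holomorphic_on ball a \<rho>" and inj: "inj_on g (ball a \<rho>)" and "\<rho> > 0"
    and z: "z \<in> ball a (\<rho> / 4)"
  shows "norm (deriv g z) \<le> Koebe_const * norm (deriv g a)"
proof -
  have d: "deriv g a \<noteq> 0"
    using holomorphic_injective_imp_regular[OF hol open_ball inj] \<open>\<rho> > 0\<close> by simp
  define h where "h = (\<lambda>u. (g (a + complex_of_real \<rho> * u) - g a) / (complex_of_real \<rho> * deriv g a))"
  have inb: "a + complex_of_real \<rho> * u \<in> ball a \<rho>" if "u \<in> ball 0 1" for u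
    using that \<open>\<rho> > 0\<close> by (simp add: dist_norm norm_mult)
  have h_hol: "h holomorphic_on ball 0 1" unfolding h_def using d \<open>\<rho> > 0\<close> inb
    by (intro holomorphic_intros holomorphic_on_compose_gen[OF _ hol, unfolded o_def]) auto
  have h_inj: "inj_on h (ball 0 1)"
  proof (rule inj_onI)
    fix x y assume xy: "x \<in> ball 0 1" "y \<in> ball 0 1" "h x = h y"
    then have "g (a + complex_of_real \<rho> * x) = g (a + complex_of_real \<rho> * y)"
      using d \<open>\<rho> > 0\<close> by (simp add: h_def)
    then show "x = y" using inj_onD[OF inj _ inb[OF xy(1)] inb[OF xy(2)]] \<open>\<rho> > 0\<close> by simp
  qed
  have dg: "(g has_field_derivative deriv g a) (at a)"
    using holomorphic_derivI[OF hol open_ball, of a] \<open>\<rho> > 0\<close> by simp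
  have "((\<lambda>u. g (a + complex_of_real \<rho> * u)) has_field_derivative deriv g a * complex_of_real \<rho>) (at 0)"
    by (rule DERIV_chain2[of g _ "\<lambda>u. a + complex_of_real \<rho> * u"]) (use dg in \<open>auto intro!: derivative_eq_intros\<close>)
  then have "(h has_field_derivative (deriv g a * complex_of_real \<rho> - 0) / (complex_of_real \<rho> * deriv g a)) (at 0)"
    unfolding h_def by (intro DERIV_cdivide DERIV_diff DERIV_const)
  then have h1: "deriv h 0 = 1" using d \<open>\<rho> > 0\<close> by (simp add: DERIV_imp_deriv)
  have h0: "h 0 = 0" by (simp add: h_def)
  have bd: "norm (g u - g a) \<le> \<rho> * norm (deriv g a) * (Koebe_const / 8)" if "u \<in> ball a (\<rho> / 2)" for u
  proof -
    define v where "v = (u - a) / complex_of_real \<rho>"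
    have "norm v < 1 / 2"
      using that \<open>\<rho> > 0\<close> by (simp add: v_def norm_divide dist_norm norm_minus_commute field_simps)
    from univalent_bound[OF h_hol h_inj h0 h1 this]
    have "norm (h v) \<le> Koebe_const / 8" by (simp add: Koebe_const_def)
    moreover have "g u - g a = complex_of_real \<rho> * deriv g a * h v"
      using d \<open>\<rho> > 0\<close> by (simp add: h_def v_def)
    ultimately show ?thesis
      using \<open>\<rho> > 0\<close> by (simp add: norm_mult mult_left_mono)
  qed
  \<comment> \<open>The circle for Cauchy's inequality stays where \<open>bd\<close> holds, since
    1/4 + 1/8 < 1/2.\<close>
  have sub: "cball z (\<rho> / 8) \<subseteq> ball a (\<rho> / 2)"
  proof
    fix x assume "x \<in> cball z (\<rho> / 8)"
    then show "x \<in> ball a (\<rho> / 2)" using z dist_triangle[of a x z] \<open>\<rho> > 0\<close> by simp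
  qed
  have gz: "(\<lambda>u. g u - g a) holomorphic_on ball a \<rho>" by (intro holomorphic_intros hol)
  have sub': "cball z (\<rho> / 8) \<subseteq> ball a \<rho>"
    using \<open>\<rho> > 0\<close> by (intro order_trans[OF sub subset_ball]) simp
  have "norm ((deriv ^^ 1) (\<lambda>u. g u - g a) z) \<le>
      fact 1 * (\<rho> * norm (deriv g a) * (Koebe_const / 8)) / (\<rho> / 8) ^ 1"
  proof (rule Cauchy_inequality)
    show "(\<lambda>u. g u - g a) holomorphic_on ball z (\<rho> / 8)"
      using gz by (rule holomorphic_on_subset) (use sub' in auto)
    show "continuous_on (cball z (\<rho> / 8)) (\<lambda>u. g u - g a)"
      using gz sub' by (meson holomorphic_on_imp_continuous_on holomorphic_on_subset)
    show "norm (g x - g a) \<le> \<rho> * norm (deriv g a) * (Koebe_const / 8)" if "norm (z - x) = \<rho> / 8" for x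
      using that sub by (intro bd) (auto simp: dist_norm)
  qed (use \<open>\<rho> > 0\<close> in auto)
  moreover have "deriv (\<lambda>u. g u - g a) z = deriv g z"
  proof -
    have "z \<in> ball a \<rho>" using z \<open>\<rho> > 0\<close> by simp
    then have "g field_differentiable at z"
      using hol holomorphic_on_imp_differentiable_at by blast
    then show ?thesis by (simp add: deriv_diff)
  qed
  ultimately show ?thesis using \<open>\<rho> > 0\<close> by (simp add: mult.commute)
qed

section \<open>Lifting along a function off its singular values\<close>

lemma filterlim_at_infinity_failE:
  fixes \<gamma> :: "real \<Rightarrow> complex"
  assumes "\<not> filterlim \<gamma> at_infinity at_top"
  obtains t l where "filterlim t at_top sequentially" "(\<lambda>n::nat. \<gamma> (t n)) \<longlonglongrightarrow> l"
proof -
  obtain r where r: "\<not> (\<forall>\<^sub>F x in at_top. r \<le> norm (\<gamma> x))"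
    using assms filterlim_at_infinity[of 0 \<gamma> at_top] by auto
  have "\<exists>x\<ge>N. norm (\<gamma> x) < r" for N
    using r by (auto simp: eventually_at_top_linorder not_le)
  then obtain t where t: "\<And>N. t N \<ge> N \<and> norm (\<gamma> (t N)) < r" by metis
  have "compact (cball (0::complex) r)" by simp
  moreover have "\<forall>n. \<gamma> (t (real n)) \<in> cball 0 r" using t by (auto intro: less_imp_le)
  ultimately obtain l \<sigma> where \<sigma>: "strict_mono (\<sigma> :: nat \<Rightarrow> nat)"
      "((\<lambda>n. \<gamma> (t (real n))) \<circ> \<sigma>) \<longlonglongrightarrow> l"
    unfolding compact_def by metis
  show thesis
  proof (rule that)
    show "filterlim (\<lambda>n. t (real (\<sigma> n))) at_top sequentially"
    proof (rule filterlim_at_top_mono[OF filterlim_real_sequentially])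
      have "real n \<le> t (real (\<sigma> n))" for n
        using t[of "real (\<sigma> n)"] seq_suble[OF \<sigma>(1), of n] by linarith
      then show "\<forall>\<^sub>F n in sequentially. real n \<le> t (real (\<sigma> n))" by simp
    qed
    show "(\<lambda>n. \<gamma> (t (real (\<sigma> n)))) \<longlonglongrightarrow> l" using \<sigma>(2) by (simp add: o_def)
  qed
qed

lemma real_fraction_tendsto_1: "((\<lambda>t::real. t / (1 + t)) \<longlongrightarrow> 1) at_top"
proof -
  have "((\<lambda>t::real. 1 - inverse (1 + t)) \<longlongrightarrow> 1 - 0) at_top"
    by (intro tendsto_intros tendsto_inverse_0_at_top filterlim_tendsto_add_at_top[OF tendsto_const filterlim_ident])
  moreover have "\<forall>\<^sub>F t in at_top. 1 - inverse (1 + t) = t / (1 + t :: real)"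
    using eventually_ge_at_top[of 0] by eventually_elim (simp add: field_simps)
  ultimately show ?thesis by (simp add: tendsto_cong)
qed

context meromorphic_dynamics
begin

text \<open>A general \<open>\<phi>\<close> in place of the identity permits induction: a lift of a
  branch of one iterate is a branch of the next. Poles are excluded because their dummy value would
  make them count as preimages of 0.\<close>

definition is_lift :: "(complex \<Rightarrow> complex) \<Rightarrow> complex set \<Rightarrow> (complex \<Rightarrow> complex) \<Rightarrow> bool" where
  "is_lift \<phi> S \<psi> \<longleftrightarrow> \<psi> holomorphic_on S \<and> (\<forall>w\<in>S. \<not> is_pole f (\<psi> w) \<and> f (\<psi> w) = \<phi> w)"

lemma is_lift_subset: "is_lift \<phi> T \<psi> \<Longrightarrow> S \<subseteq> T \<Longrightarrow> is_lift \<phi> S \<psi>"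
  unfolding is_lift_def using holomorphic_on_subset by blast

lemma is_lift_local:
  assumes "\<And>w. w \<in> S \<Longrightarrow> \<exists>V h. open V \<and> w \<in> V \<and> is_lift \<phi> V h \<and> (\<forall>v\<in>V. \<psi> v = h v)"
  shows "is_lift \<phi> S \<psi>"
proof -
  have "\<psi> analytic_on {w} \<and> \<not> is_pole f (\<psi> w) \<and> f (\<psi> w) = \<phi> w" if w: "w \<in> S" for w
  proof -
    obtain V h where V: "open V" "w \<in> V" "is_lift \<phi> V h" "\<And>v. v \<in> V \<Longrightarrow> \<psi> v = h v"
      using assms[OF w] by metis
    have "h holomorphic_on V" using V(3) by (simp add: is_lift_def)
    then have "\<psi> holomorphic_on V" by (rule holomorphic_transform) (simp add: V(4))
    then have "\<psi> analytic_on {w}" using V(1,2) by (rule holomorphic_on_imp_analytic_at)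
    then show ?thesis using V(2,3) V(4)[OF V(2)] by (auto simp: is_lift_def)
  qed
  then show ?thesis unfolding is_lift_def by (blast intro: holomorphic_onI_analytic_at)
qed

lemma local_inverse:
  assumes "\<not> is_pole f z" "deriv f z \<noteq> 0"
  obtains N s h where "open N" "z \<in> N" "s > 0" "h holomorphic_on ball (f z) s"
    "\<And>w. w \<in> ball (f z) s \<Longrightarrow> h w \<in> N \<and> f (h w) = w \<and> \<not> is_pole f (h w)"
    "\<And>x. x \<in> N \<Longrightarrow> f x \<in> ball (f z) s \<and> h (f x) = x"
proof -
  obtain r0 where r0: "r0 > 0" "f holomorphic_on ball z r0"
    using analytic_at_nonpole[OF assms(1)] by (auto simp: analytic_on_def)
  obtain r1 where r1: "r1 > 0" "ball z r1 \<subseteq> ball z r0" "inj_on f (ball z r1)"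
    using has_complex_derivative_locally_injective[OF r0(2) _ open_ball assms(2)] r0(1)
    by (metis centre_in_ball)
  have hol: "f holomorphic_on ball z r1" using r0(2) r1(2) holomorphic_on_subset by blast
  obtain h where h: "h holomorphic_on f ` ball z r1" "\<And>x. x \<in> ball z r1 \<Longrightarrow> h (f x) = x"
    using holomorphic_has_inverse[OF hol open_ball r1(3)] by metis
  have "open (f ` ball z r1)" using open_mapping_thm3[OF hol open_ball r1(3)] .
  moreover have "f z \<in> f ` ball z r1" using r1(1) by simp
  ultimately obtain s where s: "s > 0" "ball (f z) s \<subseteq> f ` ball z r1" by (meson openE)
  define N where "N = ball z r1 \<inter> f -` ball (f z) s"
  have "continuous_on (ball z r1) f" using hol by (rule holomorphic_on_imp_continuous_on)
  then have "open N" unfolding N_def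
    by (simp add: continuous_on_open_vimage Int_commute)
  show thesis
  proof (rule that[of N s h])
    show "h holomorphic_on ball (f z) s" using h(1) s(2) by (rule holomorphic_on_subset)
    show "h w \<in> N \<and> f (h w) = w \<and> \<not> is_pole f (h w)" if "w \<in> ball (f z) s" for w
    proof -
      obtain x where x: "x \<in> ball z r1" "w = f x" using s(2) \<open>w \<in> ball (f z) s\<close> by blast
      have "\<not> is_pole f x"
        using hol x(1) by (meson holomorphic_on_imp_analytic_at not_is_pole_holomorphic open_ball)
      then show ?thesis using x h(2)[OF x(1)] that by (simp add: N_def)
    qed
    show "f x \<in> ball (f z) s \<and> h (f x) = x" if "x \<in> N" for x
      using that h(2) by (auto simp: N_def)
  qed (use \<open>open N\<close> s r1 in \<open>auto simp: N_def\<close>)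
qed

lemma regular_of_not_sing:
  assumes "\<not> is_pole f z" "f z \<notin> sing_inv f"
  shows "deriv f z \<noteq> 0"
proof
  assume "deriv f z = 0"
  then have "f z \<in> finite_critical_values f"
    using assms(1) by (auto simp: finite_critical_values_def)
  then have "f z \<in> sing_inv f" unfolding sing_inv_def by (intro subsetD[OF closure_subset]) simp
  then show False using assms(2) by simp
qed

text \<open>Since \<open>\<phi> w\<close> is not singular, \<open>f\<close> is injective near the
  common value at \<open>w\<close>. So the lifts agree near \<open>w\<close>, and then on
  \<open>S\<close> by the identity theorem.\<close>

lemma lifts_agree:
  assumes \<psi>: "is_lift \<phi> S \<psi>" and \<psi>': "is_lift \<phi> S \<psi>'"
    and S: "open S" "connected S" "w \<in> S" and eq: "\<psi> w = \<psi>' w"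
    and sing: "\<phi> w \<notin> sing_inv f" and x: "x \<in> S"
  shows "\<psi> x = \<psi>' x"
proof -
  have w: "\<not> is_pole f (\<psi> w)" "f (\<psi> w) = \<phi> w" using \<psi> S(3) by (auto simp: is_lift_def)
  have "deriv f (\<psi> w) \<noteq> 0" using sing w(2) by (intro regular_of_not_sing[OF w(1)]) simp
  then obtain N h where N: "open N" "\<psi> w \<in> N" "\<And>x. x \<in> N \<Longrightarrow> h (f x) = x"
    by (rule local_inverse[OF w(1)]) blast
  have c: "continuous_on S \<psi>" "continuous_on S \<psi>'"
    using \<psi> \<psi>' by (auto simp: is_lift_def intro: holomorphic_on_imp_continuous_on)
  define V where "V = (S \<inter> \<psi> -` N) \<inter> (S \<inter> \<psi>' -` N)"
  have V: "open V" unfolding V_def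
    using c S(1) N(1) by (intro open_Int continuous_open_preimage)
  have V_ne: "V \<noteq> {}" using N(2) eq S(3) by (auto simp: V_def)
  have V_sub: "V \<subseteq> S" by (auto simp: V_def)
  have V_eq: "\<psi> v = \<psi>' v" if "v \<in> V" for v
  proof -
    have v: "v \<in> S" "\<psi> v \<in> N" "\<psi>' v \<in> N" using that by (auto simp: V_def)
    have "f (\<psi> v) = f (\<psi>' v)" using \<psi> \<psi>' v(1) by (simp add: is_lift_def)
    then show ?thesis using N(3)[OF v(2)] N(3)[OF v(3)] by metis
  qed
  have hol: "\<psi> holomorphic_on S" "\<psi>' holomorphic_on S" using \<psi> \<psi>' by (simp_all add: is_lift_def)
  show ?thesis
    using analytic_continuation_open[of V S \<psi> \<psi>' x, OF V S(1) V_ne S(2) V_sub hol V_eq x] .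
qed

lemma lift_local:
  assumes "\<phi> holomorphic_on T" "open T" "b \<in> T" "\<not> is_pole f z" "f z = \<phi> b" "\<phi> b \<notin> sing_inv f"
  obtains N s h where "open N" "z \<in> N" "s > 0" "ball b s \<subseteq> T" "is_lift \<phi> (ball b s) (h \<circ> \<phi>)"
    "\<And>x. x \<in> N \<Longrightarrow> h (f x) = x" "h (\<phi> b) = z"
proof -
  have "deriv f z \<noteq> 0" using assms(5,6) by (intro regular_of_not_sing[OF assms(4)]) simp
  then obtain N s h where N: "open N" "z \<in> N" "s > 0" "h holomorphic_on ball (f z) s"
    "\<And>w. w \<in> ball (f z) s \<Longrightarrow> h w \<in> N \<and> f (h w) = w \<and> \<not> is_pole f (h w)"
    "\<And>x. x \<in> N \<Longrightarrow> f x \<in> ball (f z) s \<and> h (f x) = x"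
    by (rule local_inverse[OF assms(4)]) blast
  have "continuous_on T \<phi>" using assms(1) by (rule holomorphic_on_imp_continuous_on)
  then have "open (T \<inter> \<phi> -` ball (f z) s)"
    using assms(2) by (simp add: continuous_on_open_vimage Int_commute)
  moreover have "b \<in> T \<inter> \<phi> -` ball (f z) s" using assms(3,5) N(3) by simp
  ultimately obtain t where t: "t > 0" "ball b t \<subseteq> T \<inter> \<phi> -` ball (f z) s" by (meson openE)
  have "h \<circ> \<phi> holomorphic_on ball b t"
    by (rule holomorphic_on_compose_gen[OF holomorphic_on_subset[OF assms(1)] N(4)]) (use t in auto)
  then have "is_lift \<phi> (ball b t) (h \<circ> \<phi>)"
    unfolding is_lift_def using t N(5) by (auto simp: subset_iff)
  moreover have "h (\<phi> b) = z" using N(6)[OF N(2)] assms(5) by simp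
  ultimately show thesis using that[OF N(1,2) t(1)] t(2) N(6) by (metis le_inf_iff)
qed

text \<open>Infinity is either outside the domain or fixed. So an orbit that ends at a finite point
  has been finite throughout.\<close>

definition no_return :: bool where
  "no_return \<longleftrightarrow> transcendental f \<or> sphere_map f Infty = Some Infty"

lemma no_return_tendsto:
  assumes "no_return" "\<not> transcendental f"
  shows "(to_sphere f \<longlongrightarrow> Infty) at_infinity"
proof -
  obtain l where "(to_sphere f \<longlongrightarrow> l) at_infinity" using assms(2) by (auto simp: transcendental_def)
  moreover from this have "sphere_map f Infty = Some l"
    using tendsto_Lim[OF trivial_limit_at_infinity] assms(2) by (auto simp: sphere_map_def)
  ultimately show ?thesis using assms by (simp add: no_return_def)
qed

text \<open>Follow the lift along the radius to \<open>b\<close>. If it tended to infinity,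
  \<open>\<phi> b\<close> would be an asymptotic value of a transcendental \<open>f\<close>, or
  equal infinity by continuity of a rational one. So the lift accumulates at a finite point over
  \<open>\<phi> b\<close>, and the local inverse of \<open>f\<close> there continues it.\<close>

lemma lift_extends_at_boundary:
  assumes nr: no_return and "0 < \<rho>" "\<rho> < R"
    and \<phi>: "\<phi> holomorphic_on ball w0 R" and sing: "\<And>w. w \<in> ball w0 R \<Longrightarrow> \<phi> w \<notin> sing_inv f"
    and \<psi>: "is_lift \<phi> (ball w0 \<rho>) \<psi>" and b: "dist w0 b = \<rho>"
  obtains s h where "s > 0" "ball b s \<subseteq> ball w0 R" "is_lift \<phi> (ball b s) h"
    "\<And>w. w \<in> ball b s \<inter> ball w0 \<rho> \<Longrightarrow> h w = \<psi> w"
proof -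
  \<comment> \<open>The radius is parametrised by \<open>t / (1 + t)\<close> over the half-line, as
    the definition of asymptotic values asks.\<close>
  define p where "p = (\<lambda>t. w0 + complex_of_real (t / (1 + t)) * (b - w0))"
  define \<gamma> where "\<gamma> = (\<lambda>t. \<psi> (p t))"
  have bR: "b \<in> ball w0 R" using b \<open>\<rho> < R\<close> by simp
  have p_ball: "p t \<in> ball w0 \<rho>" if "t \<ge> 0" for t
  proof -
    have "\<bar>t / (1 + t)\<bar> < 1" using that by simp
    then have "\<bar>t / (1 + t)\<bar> * norm (b - w0) < 1 * norm (b - w0)"
      using b \<open>0 < \<rho>\<close> by (intro mult_strict_right_mono) (auto simp: dist_norm norm_minus_commute)
    moreover have "norm (b - w0) = \<rho>" using b by (simp add: dist_norm norm_minus_commute)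
    ultimately show ?thesis
      by (simp add: p_def dist_norm norm_mult del: of_real_divide)
  qed
  have "(p \<longlongrightarrow> w0 + complex_of_real 1 * (b - w0)) at_top"
    unfolding p_def by (intro tendsto_intros real_fraction_tendsto_1)
  then have p_lim: "(p \<longlongrightarrow> b) at_top" by simp
  have "isCont \<phi> b"
    using holomorphic_on_imp_continuous_on[OF \<phi>] bR by (simp add: continuous_on_eq_continuous_at)
  then have \<phi>_lim: "((\<lambda>t. \<phi> (p t)) \<longlongrightarrow> \<phi> b) at_top" using p_lim by (rule isCont_tendsto_compose)
  have lift: "\<not> is_pole f (\<gamma> t)" "f (\<gamma> t) = \<phi> (p t)" if "t \<ge> 0" for t
    using \<psi> p_ball[OF that] by (auto simp: is_lift_def \<gamma>_def)
  have f_lim: "((\<lambda>t. to_sphere f (\<gamma> t)) \<longlongrightarrow> Fin (\<phi> b)) at_top"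
  proof (rule Lim_transform_eventually)
    show "((\<lambda>t. Fin (\<phi> (p t))) \<longlongrightarrow> Fin (\<phi> b)) at_top" using \<phi>_lim by (simp add: tendsto_Fin_iff)
    show "\<forall>\<^sub>F t in at_top. Fin (\<phi> (p t)) = to_sphere f (\<gamma> t)"
      using eventually_ge_at_top[of 0] by eventually_elim (simp add: to_sphere_def lift)
  qed
  have "\<not> filterlim \<gamma> at_infinity at_top"
  proof
    assume inf: "filterlim \<gamma> at_infinity at_top"
    show False
    proof (cases "transcendental f")
      case True
      have "continuous_on {0..} p" unfolding p_def by (intro continuous_intros) auto
      then have "continuous_on {0..} \<gamma>" unfolding \<gamma>_def using \<psi> p_ball
        by (intro continuous_on_compose2[OF holomorphic_on_imp_continuous_on, of \<psi> "ball w0 \<rho>"])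
           (auto simp: is_lift_def)
      then have "\<phi> b \<in> finite_asymptotic_values f"
        unfolding finite_asymptotic_values_def using True inf f_lim by blast
      then have "\<phi> b \<in> sing_inv f"
        unfolding sing_inv_def by (intro subsetD[OF closure_subset]) simp
      then show False using sing[OF bR] by simp
    next
      case False
      have "((\<lambda>t. to_sphere f (\<gamma> t)) \<longlongrightarrow> Infty) at_top"
        using no_return_tendsto[OF nr False] inf by (rule filterlim_compose)
      then show False using f_lim tendsto_unique[OF trivial_limit_at_top_linorder] by blast
    qed
  qed
  then obtain t z where t: "filterlim t at_top sequentially" "(\<lambda>n::nat. \<gamma> (t n)) \<longlonglongrightarrow> z"
    by (rule filterlim_at_infinity_failE)
  have "(\<lambda>n. to_sphere f (\<gamma> (t n))) \<longlonglongrightarrow> Fin (\<phi> b)" using f_lim t(1) by (rule filterlim_compose)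
  moreover have "(\<lambda>n. to_sphere f (\<gamma> (t n))) \<longlonglongrightarrow> to_sphere f z"
    using tendsto_iter[of 1 "Fin z" "to_sphere f z" "\<lambda>n. Fin (\<gamma> (t n))" sequentially] t(2)
    by (simp add: tendsto_Fin_iff)
  ultimately have "to_sphere f z = Fin (\<phi> b)" using LIMSEQ_unique by blast
  then have z: "\<not> is_pole f z" "f z = \<phi> b" by (auto simp: to_sphere_def split: if_splits)
  obtain N s h where N: "open N" "z \<in> N" "s > 0" "ball b s \<subseteq> ball w0 R"
    "is_lift \<phi> (ball b s) (h \<circ> \<phi>)" "\<And>x. x \<in> N \<Longrightarrow> h (f x) = x"
    using lift_local[OF \<phi> open_ball bR z sing[OF bR]] by metis
  have "\<forall>\<^sub>F n in sequentially. \<gamma> (t n) \<in> N" using topological_tendstoD[OF t(2) N(1,2)] .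
  moreover have "\<forall>\<^sub>F n in sequentially. p (t n) \<in> ball b s"
    using topological_tendstoD[OF filterlim_compose[OF p_lim t(1)] open_ball] N(3) by simp
  moreover have "\<forall>\<^sub>F n in sequentially. t n \<ge> 0" using t(1) unfolding filterlim_at_top by blast
  ultimately have "\<forall>\<^sub>F n in sequentially. \<gamma> (t n) \<in> N \<and> p (t n) \<in> ball b s \<and> t n \<ge> 0"
    by eventually_elim auto
  \<comment> \<open>Accumulation along a sequence is enough: one point where both lifts agree
    identifies them on the connected intersection of the two disks.\<close>
  then obtain n where n: "\<gamma> (t n) \<in> N" "p (t n) \<in> ball b s" "t n \<ge> 0"
    by (auto simp only: eventually_sequentially)
  show thesis
  proof (rule that[OF N(3,4,5)])
    fix w assume w: "w \<in> ball b s \<inter> ball w0 \<rho>"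
    let ?S = "ball b s \<inter> ball w0 \<rho>"
    have "is_lift \<phi> ?S (h \<circ> \<phi>)" "is_lift \<phi> ?S \<psi>" using N(5) \<psi> by (auto intro: is_lift_subset)
    moreover have "(h \<circ> \<phi>) (p (t n)) = \<psi> (p (t n))"
      using N(6)[OF n(1)] lift(2)[OF n(3)] by (simp add: \<gamma>_def)
    moreover have "connected ?S" by (intro convex_connected convex_Int convex_ball)
    moreover have "p (t n) \<in> ?S" using n(2) p_ball[OF n(3)] by simp
    moreover have "\<phi> (p (t n)) \<notin> sing_inv f" using n(2) N(4) sing by blast
    ultimately show "(h \<circ> \<phi>) w = \<psi> w" using lifts_agree[of \<phi> ?S "h \<circ> \<phi>" \<psi> "p (t n)" w] w by auto
  qed
qed

text \<open>A Lebesgue number \<open>e\<close> of the boundary circle gives local extensions of one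
  common radius. Overlapping ones agree since each of them continues \<open>\<psi>\<close>, so they
  glue to a lift on a larger disk.\<close>

lemma lift_extends:
  assumes nr: no_return and \<rho>: "0 < \<rho>" "\<rho> < R"
    and \<phi>: "\<phi> holomorphic_on ball w0 R" and sing: "\<And>w. w \<in> ball w0 R \<Longrightarrow> \<phi> w \<notin> sing_inv f"
    and \<psi>: "is_lift \<phi> (ball w0 \<rho>) \<psi>"
  obtains \<rho>' \<psi>' where "\<rho> < \<rho>'" "\<rho>' < R" "is_lift \<phi> (ball w0 \<rho>') \<psi>'" "\<psi>' w0 = \<psi> w0"
proof -
  define good where "good = (\<lambda>b s h. ball b s \<subseteq> ball w0 R \<and> is_lift \<phi> (ball b s) h \<and>
      (\<forall>w\<in>ball b s \<inter> ball w0 \<rho>. h w = \<psi> w))"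
  have "\<forall>b\<in>sphere w0 \<rho>. \<exists>s h. s > 0 \<and> good b s h"
  proof
    fix b assume "b \<in> sphere w0 \<rho>"
    then have "dist w0 b = \<rho>" by simp
    from lift_extends_at_boundary[OF nr \<rho> \<phi> sing \<psi> this] show "\<exists>s h. s > 0 \<and> good b s h"
      unfolding good_def by metis
  qed
  then obtain s H where sH: "\<And>b. b \<in> sphere w0 \<rho> \<Longrightarrow> s b > 0 \<and> good b (s b) (H b)" by metis
  have "compact (sphere w0 \<rho>)" "sphere w0 \<rho> \<subseteq> \<Union> ((\<lambda>b. ball b (s b)) ` sphere w0 \<rho>)"
    using sH by force+
  then obtain e where e: "e > 0"
      "\<And>x. x \<in> sphere w0 \<rho> \<Longrightarrow> \<exists>B\<in>(\<lambda>b. ball b (s b)) ` sphere w0 \<rho>. ball x e \<subseteq> B"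
    by (rule Heine_Borel_lemma) auto
  have "\<exists>h. good b e h" if b: "b \<in> sphere w0 \<rho>" for b
  proof -
    obtain b' where b': "b' \<in> sphere w0 \<rho>" "ball b e \<subseteq> ball b' (s b')" using e(2)[OF b] by auto
    then have "good b e (H b')" using sH[OF b'(1)] is_lift_subset unfolding good_def by blast
    then show ?thesis by blast
  qed
  then obtain h where h: "\<And>b. b \<in> sphere w0 \<rho> \<Longrightarrow> good b e (h b)" by metis
  \<comment> \<open>Radial projection to the circle; outside the disk the extension at the projected
    point is used.\<close>
  define p where "p = (\<lambda>w. w0 + (complex_of_real (\<rho> / norm (w - w0))) * (w - w0))"
  define \<psi>' where "\<psi>' = (\<lambda>w. if w \<in> ball w0 \<rho> then \<psi> w else h (p w) w)"
  have p: "p w \<in> sphere w0 \<rho>" "dist (p w) w = dist w0 w - \<rho>" if "\<rho> \<le> dist w0 w" for w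
  proof -
    have n: "norm (w - w0) \<noteq> 0" "norm (w - w0) = dist w0 w"
      using that \<rho>(1) by (auto simp: dist_norm norm_minus_commute)
    then show "p w \<in> sphere w0 \<rho>" using \<rho>(1) by (simp add: p_def dist_norm norm_mult norm_divide)
    have "p w - w = complex_of_real (\<rho> / norm (w - w0) - 1) * (w - w0)"
      by (simp add: p_def algebra_simps)
    then have "dist (p w) w = \<bar>\<rho> / norm (w - w0) - 1\<bar> * norm (w - w0)"
      by (simp only: dist_norm norm_mult norm_of_real)
    also have "\<dots> = \<bar>(\<rho> / norm (w - w0) - 1) * norm (w - w0)\<bar>" by (simp add: abs_mult)
    also have "(\<rho> / norm (w - w0) - 1) * norm (w - w0) = \<rho> - norm (w - w0)"
      using n by (simp add: field_simps)
    finally show "dist (p w) w = dist w0 w - \<rho>" using that n(2) by simp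
  qed
  have key: "\<psi>' w = h b w"
    if b: "b \<in> sphere w0 \<rho>" and wb: "w \<in> ball b (e / 4)" and w: "dist w0 w < \<rho> + e / 4" for b w
  proof (cases "w \<in> ball w0 \<rho>")
    case True
    then show ?thesis using h[OF b] wb e(1) by (simp add: good_def \<psi>'_def)
  next
    case False
    define q where "q = p w"
    have q: "q \<in> sphere w0 \<rho>" "dist q w < e / 4" using p[of w] False w by (auto simp: q_def)
    define \<epsilon> where "\<epsilon> = min (1 / 2) (e / (8 * \<rho>))"
    have \<epsilon>: "0 < \<epsilon>" "\<epsilon> < 1" "\<epsilon> * \<rho> < e / 4"
    proof -
      show "0 < \<epsilon>" "\<epsilon> < 1" using e(1) \<rho>(1) by (auto simp: \<epsilon>_def)
      have "\<epsilon> * \<rho> \<le> e / (8 * \<rho>) * \<rho>" using \<rho>(1) by (intro mult_right_mono) (auto simp: \<epsilon>_def)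
      then show "\<epsilon> * \<rho> < e / 4" using \<rho>(1) e(1) by simp
    qed
    \<comment> \<open>The point \<open>b\<close> pushed inwards by less than \<open>e / 4\<close>.
      It lies in the old disk and in both disks of radius \<open>e\<close>, so both extensions equal
      \<open>\<psi>\<close> there.\<close>
    define m where "m = b - complex_of_real \<epsilon> * (b - w0)"
    have nb: "norm (b - w0) = \<rho>" using b by (simp add: dist_norm norm_minus_commute)
    have mb: "dist m b = \<epsilon> * \<rho>" using \<epsilon> nb by (simp add: m_def dist_norm norm_mult)
    have "m - w0 = complex_of_real (1 - \<epsilon>) * (b - w0)" by (simp add: m_def algebra_simps)
    then have "norm (m - w0) = \<bar>1 - \<epsilon>\<bar> * \<rho>" using nb by (simp only: norm_mult norm_of_real)
    then have mw: "m \<in> ball w0 \<rho>" using \<epsilon> \<rho>(1) by (simp add: dist_norm norm_minus_commute)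
    have "dist q m \<le> dist q w + dist w b + dist b m"
      using dist_triangle[of q m w] dist_triangle[of w m b] by linarith
    then have mq: "m \<in> ball q e" using q(2) wb mb \<epsilon>(3) e(1) by (simp add: dist_commute)
    let ?S = "ball b e \<inter> ball q e"
    have "is_lift \<phi> ?S (h b)" "is_lift \<phi> ?S (h q)"
      using h[OF b] h[OF q(1)] by (auto simp: good_def intro: is_lift_subset)
    moreover have "connected ?S" by (intro convex_connected convex_Int convex_ball)
    moreover have mS: "m \<in> ?S" using mq mb \<epsilon>(3) e(1) by (simp add: dist_commute)
    moreover have "h b m = h q m" using h[OF b] h[OF q(1)] mS mw by (simp add: good_def)
    moreover have "\<phi> m \<notin> sing_inv f" using mw \<rho>(2) by (intro sing) simp
    moreover have "w \<in> ?S" using wb q(2) e(1) by simp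
    ultimately have "h b w = h q w" using lifts_agree[of \<phi> ?S "h b" "h q" m w] by auto
    then show ?thesis using False by (simp add: \<psi>'_def q_def)
  qed
  define \<rho>' where "\<rho>' = min (\<rho> + e / 4) ((\<rho> + R) / 2)"
  have \<rho>': "\<rho> < \<rho>'" "\<rho>' < R" "\<rho>' \<le> \<rho> + e / 4" using e(1) \<rho> by (auto simp: \<rho>'_def min_less_iff_disj)
  have "is_lift \<phi> (ball w0 \<rho>') \<psi>'"
  proof (rule is_lift_local)
    fix w assume w: "w \<in> ball w0 \<rho>'"
    show "\<exists>V h. open V \<and> w \<in> V \<and> is_lift \<phi> V h \<and> (\<forall>v\<in>V. \<psi>' v = h v)"
    proof (cases "w \<in> ball w0 \<rho>")
    case True
    then show ?thesis
      using \<psi> by (intro exI[of _ "ball w0 \<rho>"] exI[of _ \<psi>]) (auto simp: \<psi>'_def)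
  next
    case False
    define b where "b = p w"
    have b: "b \<in> sphere w0 \<rho>" "dist b w < e / 4" using p[of w] False w \<rho>'(3) by (auto simp: b_def)
    let ?V = "ball b (e / 4) \<inter> ball w0 \<rho>'"
    have "is_lift \<phi> (ball b e) (h b)" using h[OF b(1)] by (simp add: good_def)
    moreover have "?V \<subseteq> ball b e" using e(1) by auto
    ultimately have "is_lift \<phi> ?V (h b)" by (rule is_lift_subset)
    moreover have "\<psi>' v = h b v" if "v \<in> ?V" for v
      using that \<rho>'(3) by (intro key[OF b(1)]) auto
    moreover have "w \<in> ?V" using b(2) w by simp
    ultimately show ?thesis by (intro exI[of _ ?V] exI[of _ "h b"]) auto
  qed
  qed
  moreover have "\<psi>' w0 = \<psi> w0" using \<rho>(1) by (simp add: \<psi>'_def)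
  ultimately show thesis using that \<rho>' by blast
qed

text \<open>Take the supremum of the radii of disks that carry a lift with value \<open>z0\<close>
  at the centre. By uniqueness these lifts glue to one on the disk of that radius, and
  \<open>lift_extends\<close> forbids the radius to be less than \<open>R\<close>.\<close>

lemma lift_exists:
  assumes nr: no_return and R: "R > 0"
    and \<phi>: "\<phi> holomorphic_on ball w0 R" and sing: "\<And>w. w \<in> ball w0 R \<Longrightarrow> \<phi> w \<notin> sing_inv f"
    and z0: "\<not> is_pole f z0" "f z0 = \<phi> w0"
  obtains \<psi> where "is_lift \<phi> (ball w0 R) \<psi>" "\<psi> w0 = z0"
proof -
  define P where "P = {\<rho>. 0 < \<rho> \<and> \<rho> \<le> R \<and> (\<exists>\<psi>. is_lift \<phi> (ball w0 \<rho>) \<psi> \<and> \<psi> w0 = z0)}"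
  have w0: "w0 \<in> ball w0 R" using R by simp
  obtain s \<psi>0 where s: "s > 0" "ball w0 s \<subseteq> ball w0 R" "is_lift \<phi> (ball w0 s) \<psi>0" "\<psi>0 w0 = z0"
    using lift_local[OF \<phi> open_ball w0 z0 sing[OF w0]] by (metis comp_apply)
  have "s \<le> R" using s(1,2) by (simp add: ball_subset_ball_iff)
  then have sP: "s \<in> P" using s by (auto simp: P_def)
  have bdd: "bdd_above P" by (auto simp: P_def)
  define r where "r = Sup P"
  have "0 < r" using cSup_upper[OF sP bdd] s(1) by (simp add: r_def)
  moreover have "r \<le> R" unfolding r_def by (rule cSup_least) (use sP in \<open>auto simp: P_def\<close>)
  ultimately have r: "0 < r" "r \<le> R" .
  have "\<forall>\<rho>\<in>P. \<exists>\<psi>. is_lift \<phi> (ball w0 \<rho>) \<psi> \<and> \<psi> w0 = z0" by (auto simp: P_def)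
  then obtain \<Psi> where \<Psi>: "\<And>\<rho>. \<rho> \<in> P \<Longrightarrow> is_lift \<phi> (ball w0 \<rho>) (\<Psi> \<rho>) \<and> \<Psi> \<rho> w0 = z0" by metis
  have agree: "\<Psi> \<rho> w = \<Psi> \<rho>' w" if "\<rho> \<in> P" "\<rho>' \<in> P" "w \<in> ball w0 \<rho>" "w \<in> ball w0 \<rho>'" for \<rho> \<rho>' w
  proof -
    let ?m = "min \<rho> \<rho>'"
    have "is_lift \<phi> (ball w0 ?m) (\<Psi> \<rho>)" "is_lift \<phi> (ball w0 ?m) (\<Psi> \<rho>')"
      using \<Psi>[OF that(1)] \<Psi>[OF that(2)] by (auto intro: is_lift_subset)
    then show ?thesis
      using lifts_agree[of \<phi> "ball w0 ?m" "\<Psi> \<rho>" "\<Psi> \<rho>'" w0 w] \<Psi>[OF that(1)] \<Psi>[OF that(2)] sing[OF w0] that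
      by (auto simp: P_def)
  qed
  have "\<exists>\<rho>\<in>P. dist w0 w < \<rho>" if "w \<in> ball w0 r" for w
    using that less_cSup_iff[OF _ bdd, of "dist w0 w"] sP by (auto simp: r_def)
  then obtain \<rho> where \<rho>: "\<And>w. w \<in> ball w0 r \<Longrightarrow> \<rho> w \<in> P \<and> dist w0 w < \<rho> w" by metis
  define \<psi> where "\<psi> = (\<lambda>w. \<Psi> (\<rho> w) w)"
  have \<psi>: "\<psi> v = \<Psi> t v" if "t \<in> P" "v \<in> ball w0 t" "v \<in> ball w0 r" for t v
    unfolding \<psi>_def using \<rho>[OF that(3)] that by (intro agree) auto
  have lift_r: "is_lift \<phi> (ball w0 r) \<psi>"
  proof (rule is_lift_local)
    fix w assume w: "w \<in> ball w0 r"
    let ?V = "ball w0 (\<rho> w) \<inter> ball w0 r"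
    have "is_lift \<phi> ?V (\<Psi> (\<rho> w))" using \<Psi> \<rho>[OF w] by (auto intro: is_lift_subset)
    moreover have "open ?V" "w \<in> ?V" using w \<rho>[OF w] by auto
    moreover have "\<forall>v\<in>?V. \<psi> v = \<Psi> (\<rho> w) v" using \<psi> \<rho>[OF w] by auto
    ultimately show "\<exists>V h. open V \<and> w \<in> V \<and> is_lift \<phi> V h \<and> (\<forall>v\<in>V. \<psi> v = h v)" by blast
  qed
  have \<psi>0: "\<psi> w0 = z0" using \<Psi> \<rho>[of w0] r(1) by (simp add: \<psi>_def)
  have "r = R"
  proof (rule ccontr)
    assume "r \<noteq> R"
    then have "r < R" using r(2) by simp
    from lift_extends[OF nr r(1) this \<phi> sing lift_r] obtain \<rho>' \<psi>' where *:
      "r < \<rho>'" "\<rho>' < R" "is_lift \<phi> (ball w0 \<rho>') \<psi>'" "\<psi>' w0 = \<psi> w0" by metis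
    then have "\<rho>' \<in> P" using r(1) \<psi>0 by (auto simp: P_def)
    then show False using cSup_upper[OF _ bdd, of \<rho>'] *(1) by (simp add: r_def)
  qed
  then show thesis using that lift_r \<psi>0 by blast
qed

end

section \<open>Inverse branches\<close>

lemma DERIV_mult_inverse_function:
  assumes "g field_differentiable at w" "F field_differentiable at (g w)"
    and "\<forall>\<^sub>F v in nhds w. F (g v) = v"
  shows "deriv F (g w) * deriv g w = 1"
proof -
  have "deriv (F \<circ> g) w = deriv F (g w) * deriv g w" by (rule deriv_chain[OF assms(1,2)])
  moreover have "deriv (F \<circ> g) w = deriv (\<lambda>v. v) w"
    using assms(3) by (intro deriv_cong_ev) (auto elim: eventually_mono)
  ultimately show ?thesis by simp
qed

context meromorphic_dynamics
begin

text \<open>Every point over the disk lies on a branch defined on the whole disk, with a Lipschitz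
  constant that is the reciprocal of an expansion rate. As \<open>x\<close> ranges over the sphere,
  this also says that infinity is not a preimage of a point of the disk.\<close>

definition branches_at :: "nat \<Rightarrow> real \<Rightarrow> real \<Rightarrow> bool" where
  "branches_at n R L \<longleftrightarrow> (\<forall>a x y. a \<in> Julia f \<longrightarrow> iter f n x = Some (Fin y) \<longrightarrow> y \<in> ball a R \<longrightarrow>
     (\<exists>g. g holomorphic_on ball a R \<and> x = Fin (g y) \<and>
       (\<forall>w\<in>ball a R. iter f n (Fin (g w)) = Some (Fin w)) \<and>
       (\<forall>w\<in>ball a R. \<forall>w'\<in>ball a R. dist (g w) (g w') \<le> L * dist w w')))"

lemma branches_atE:
  assumes "branches_at n R L" "a \<in> Julia f" "iter f n x = Some (Fin y)" "y \<in> ball a R"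
  obtains g where "g holomorphic_on ball a R" "x = Fin (g y)"
    "\<And>w. w \<in> ball a R \<Longrightarrow> iter f n (Fin (g w)) = Some (Fin w)"
    "\<And>w w'. w \<in> ball a R \<Longrightarrow> w' \<in> ball a R \<Longrightarrow> dist (g w) (g w') \<le> L * dist w w'"
  using assms unfolding branches_at_def by metis

lemma continuous_on_fin_iter:
  "continuous_on (preimage f n (range Fin)) (\<lambda>x. fin (the (iter f n x)))"
  unfolding continuous_on_def
proof
  let ?S = "preimage f n (range Fin)"
  fix x assume "x \<in> ?S"
  then obtain y where y: "iter f n x = Some (Fin y)" by (auto simp: preimage_iff)
  have "((\<lambda>u. the (iter f n u)) \<longlongrightarrow> Fin y) (at x within ?S)"
    using y tendsto_ident_at by (rule tendsto_iter)
  moreover have "\<forall>\<^sub>F u in at x within ?S. the (iter f n u) = Fin (fin (the (iter f n u)))"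
    unfolding eventually_at_filter by (rule always_eventually) (auto simp: preimage_iff)
  ultimately have "((\<lambda>u. Fin (fin (the (iter f n u)))) \<longlongrightarrow> Fin y) (at x within ?S)"
    by (rule Lim_transform_eventually)
  then show "((\<lambda>u. fin (the (iter f n u))) \<longlongrightarrow> fin (the (iter f n x))) (at x within ?S)"
    using y by (simp add: tendsto_Fin_iff)
qed

text \<open>The image of the branch is open, and within \<open>U\<close> it is the fixed-point set
  of the continuous map \<open>G\<close>, the iterate followed by \<open>g\<close>; so it is also
  relatively closed and, as \<open>U\<close> is connected, contains \<open>U\<close>.\<close>

lemma component_subset_branch:
  assumes U: "U \<in> components (preimage f n (Fin ` ball a R))"
    and g: "g holomorphic_on ball a R" "\<And>w. w \<in> ball a R \<Longrightarrow> iter f n (Fin (g w)) = Some (Fin w)"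
    and y: "y \<in> ball a R" "Fin (g y) \<in> U"
  shows "U \<subseteq> Fin ` g ` ball a R"
proof -
  have inj: "inj_on g (ball a R)" by (rule inj_onI) (metis g(2) option.inject rsphere.inject)
  have "open (g ` ball a R)" using open_mapping_thm3[OF g(1) open_ball inj] .
  then have op: "open (Fin ` g ` ball a R)" by simp
  define G where "G = (\<lambda>x. Fin (g (fin (the (iter f n x)))))"
  have UP: "U \<subseteq> preimage f n (Fin ` ball a R)" using U by (rule in_components_subset)
  have in_ball: "fin (the (iter f n x)) \<in> ball a R" if "x \<in> U" for x
    using that UP by (auto simp: preimage_iff subset_iff)
  have "U \<subseteq> preimage f n (range Fin)" using UP by (force simp: preimage_iff)
  then have "continuous_on U (\<lambda>x. fin (the (iter f n x)))"
    using continuous_on_fin_iter continuous_on_subset by blast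
  then have "continuous_on U (\<lambda>x. g (fin (the (iter f n x))))"
    using in_ball by (intro continuous_on_compose2[OF holomorphic_on_imp_continuous_on[OF g(1)]]) auto
  then have cont: "continuous_on U (\<lambda>x. dist (G x) x)"
    unfolding G_def by (intro continuous_intros)
  have eq: "U \<inter> Fin ` g ` ball a R = U \<inter> (\<lambda>x. dist (G x) x) -` {0}"
  proof (intro equalityI subsetI)
    fix x assume x: "x \<in> U \<inter> Fin ` g ` ball a R"
    then obtain w where "w \<in> ball a R" "x = Fin (g w)" by blast
    then have "G x = x" using g(2) by (simp add: G_def)
    then show "x \<in> U \<inter> (\<lambda>x. dist (G x) x) -` {0}" using x by simp
  next
    fix x assume x: "x \<in> U \<inter> (\<lambda>x. dist (G x) x) -` {0}"
    then have "x = Fin (g (fin (the (iter f n x))))" by (simp add: G_def)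
    then show "x \<in> U \<inter> Fin ` g ` ball a R" using x in_ball by blast
  qed
  have "openin (top_of_set U) (U \<inter> Fin ` g ` ball a R)" using op by (rule openin_open_Int)
  moreover have "closedin (top_of_set U) (U \<inter> Fin ` g ` ball a R)"
    unfolding eq using cont by (intro continuous_closedin_preimage) auto
  moreover have "U \<inter> Fin ` g ` ball a R \<noteq> {}" using y by blast
  moreover have "connected U" using U by (rule in_components_connected)
  ultimately have "U \<inter> Fin ` g ` ball a R = U" unfolding connected_clopen by blast
  then show ?thesis by blast
qed

lemma branches_imp_expanding:
  assumes "\<And>n. branches_at n R (C / \<mu> ^ n)" "R > 0" "C > 0" "\<mu> > 1"
  shows "uniformly_expanding f"
proof -
  have "dist (plane_iter f n z) (plane_iter f n w) \<ge> 1 / C * \<mu> ^ n * dist z w"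
    if a: "a \<in> Julia f" and U: "U \<in> components (preimage f n (Fin ` ball a R))"
      and z: "Fin z \<in> U" and w: "Fin w \<in> U" for n a U z w
  proof -
    have UP: "U \<subseteq> preimage f n (Fin ` ball a R)" using U by (rule in_components_subset)
    then obtain y where y: "iter f n (Fin z) = Some (Fin y)" "y \<in> ball a R"
      using z by (auto simp: preimage_iff subset_iff)
    obtain g where g: "g holomorphic_on ball a R" "Fin z = Fin (g y)"
       "\<And>w. w \<in> ball a R \<Longrightarrow> iter f n (Fin (g w)) = Some (Fin w)"
       "\<And>w w'. w \<in> ball a R \<Longrightarrow> w' \<in> ball a R \<Longrightarrow> dist (g w) (g w') \<le> C / \<mu> ^ n * dist w w'"
      by (rule branches_atE[OF assms(1) a y]) blast
    have "Fin (g y) \<in> U" using z g(2) by simp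
    with component_subset_branch[OF U g(1,3) y(2)] w have "Fin w \<in> Fin ` g ` ball a R" by blast
    then obtain v where v: "v \<in> ball a R" "w = g v" by auto
    have "plane_iter f n z = y" "plane_iter f n w = v"
      using y(1) g(3)[OF v(1)] v(2) by (auto intro: plane_iter_eq)
    moreover have "dist z w \<le> C / \<mu> ^ n * dist y v" using g(2) v g(4)[OF y(2) v(1)] by simp
    then have "1 / C * \<mu> ^ n * dist z w \<le> 1 / C * \<mu> ^ n * (C / \<mu> ^ n * dist y v)"
      using assms by (intro mult_left_mono) auto
    ultimately show ?thesis using assms by simp
  qed
  moreover have "1 / C > 0" using assms by simp
  ultimately show ?thesis
    unfolding uniformly_expanding_def using assms by blast
qed

section \<open>Branches off the post-singular set\<close>

lemma no_return_iter_Infty: "no_return \<Longrightarrow> iter f n Infty \<noteq> Some (Fin y)"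
proof (induction n)
  case (Suc n)
  then show ?case
    by (cases "transcendental f")
       (auto simp: no_return_def iter_Suc' map_comp_def sphere_map_def simp del: iter.simps(2))
qed auto

lemma no_return_iter_finite:
  assumes no_return "iter f n x = Some (Fin y)" "k \<le> n"
  obtains u where "iter f k x = Some (Fin u)" "iter f (n - k) (Fin u) = Some (Fin y)"
proof -
  have "iter f n = iter f (n - k) \<circ>\<^sub>m iter f k" using assms(3) by (simp flip: iter_add)
  then obtain v where v: "iter f k x = Some v" "iter f (n - k) v = Some (Fin y)"
    using assms(2) by (auto simp: map_comp_def split: option.splits)
  moreover have "v \<noteq> Infty" using no_return_iter_Infty[OF assms(1)] v(2) by metis
  ultimately show thesis using that by (cases v) auto
qed

text \<open>An orbit that ends at a finite point has not met infinity before, so it is not among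
  those that \<open>post_singular\<close> discards.\<close>

lemma no_return_post_singular:
  assumes no_return "s \<in> sing_inv f" "iter f n (Fin s) = Some (Fin y)"
  shows "Fin y \<in> post_singular f"
proof -
  have "Fin s \<notin> preimage f j {Infty}" if "j < n" for j
  proof -
    have "j \<le> n" using that by simp
    then obtain u where "iter f j (Fin s) = Some (Fin u)"
      by (rule no_return_iter_finite[OF assms(1,3)])
    then show ?thesis by (simp add: preimage_iff)
  qed
  then have "Fin s \<in> Fin ` sing_inv f - (\<Union>j<n. preimage f j {Infty})" using assms(2) by simp
  moreover have "Fin y = the (iter f n (Fin s))" using assms(3) by simp
  ultimately have "Fin y \<in> (\<Union>n. (\<lambda>x. the (iter f n x)) ` (Fin ` sing_inv f - (\<Union>j<n. preimage f j {Infty})))"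
    by (intro UN_I[of n] image_eqI[of _ _ "Fin s"]) simp_all
  then show ?thesis unfolding post_singular_def by (rule subsetD[OF closure_subset])
qed

text \<open>A branch \<open>g\<close> of one iterate takes no singular values, because its points
  are carried by that iterate to points off the post-singular set. So \<open>g\<close> can be lifted
  along \<open>f\<close> to a branch of the next iterate.\<close>

lemma no_return_inverse_branch:
  assumes nr: no_return and R: "R > 0" and P: "\<And>w. w \<in> ball w0 R \<Longrightarrow> Fin w \<notin> post_singular f"
    and z: "iter f n (Fin z) = Some (Fin w0)"
  shows "\<exists>g. g holomorphic_on ball w0 R \<and> g w0 = z \<and>
    (\<forall>w\<in>ball w0 R. iter f n (Fin (g w)) = Some (Fin w))"
  using z
proof (induction n arbitrary: z)
  case 0
  then show ?case by (intro exI[of _ "\<lambda>w. w"]) auto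
next
  case (Suc n)
  obtain u where u: "iter f 1 (Fin z) = Some (Fin u)" "iter f n (Fin u) = Some (Fin w0)"
    using no_return_iter_finite[OF nr Suc.prems, of 1] by auto
  obtain g where g: "g holomorphic_on ball w0 R" "g w0 = u"
      "\<And>w. w \<in> ball w0 R \<Longrightarrow> iter f n (Fin (g w)) = Some (Fin w)"
    using Suc.IH[OF u(2)] by blast
  have sing: "g w \<notin> sing_inv f" if "w \<in> ball w0 R" for w
    using no_return_post_singular[OF nr _ g(3)[OF that]] P[OF that] by blast
  have z: "\<not> is_pole f z" "f z = g w0"
    using u(1) g(2) by (auto simp: to_sphere_def split: if_splits)
  obtain \<psi> where \<psi>: "is_lift g (ball w0 R) \<psi>" "\<psi> w0 = z"
    using lift_exists[OF nr R g(1) sing z] by metis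
  have "iter f (Suc n) (Fin (\<psi> w)) = Some (Fin w)" if "w \<in> ball w0 R" for w
    using \<psi>(1) g(3)[OF that] that
    by (simp add: iter_Suc' map_comp_def is_lift_def to_sphere_def del: iter.simps(2))
  then show ?case using \<psi> by (intro exI[of _ \<psi>]) (auto simp: is_lift_def)
qed

text \<open>This makes (ii) applicable inside every disk about a Julia point.\<close>

definition nonprepoles_dense :: bool where
  "nonprepoles_dense \<longleftrightarrow> (\<forall>a\<in>Julia f. \<forall>r>0. \<exists>a'\<in>Julia f. a' \<in> ball a r \<and> Fin a' \<notin> Julia_infty f)"

text \<open>The derivative of the branch is controlled at a non-prepole \<open>a'\<close> close to
  \<open>a\<close>: then \<open>g a'\<close> is a Julia point and no prepole either, so (ii) holds
  there and bounds the derivative of \<open>g\<close> at \<open>a'\<close>.\<close>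

lemma no_return_branches:
  assumes nr: no_return and dense: nonprepoles_dense
    and eps: "\<epsilon> > 0" "\<And>y a. Fin y \<in> post_singular f \<Longrightarrow> a \<in> Julia f \<Longrightarrow> dist y a \<ge> \<epsilon>"
    and c: "c > 0" "\<mu> > 1" and
    expand: "\<And>n z. z \<in> Julia f \<Longrightarrow> Fin z \<notin> Julia_infty f \<Longrightarrow> cmod (deriv (plane_iter f n) z) \<ge> c * \<mu> ^ n"
  shows "branches_at n (\<epsilon> / 12) (Koebe_const / c / \<mu> ^ n)"
  unfolding branches_at_def
proof (intro allI impI)
  fix a x y
  assume a: "a \<in> Julia f" and x: "iter f n x = Some (Fin y)" and y: "y \<in> ball a (\<epsilon> / 12)"
  \<comment> \<open>With \<open>\<epsilon> = 12 * R\<close> the disk of radius \<open>11 * R\<close>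
    about \<open>y\<close> is off the post-singular set. It contains the disk of radius
    \<open>8 * R\<close> about \<open>a'\<close>, and distortion holds on a quarter of that radius,
    \<open>2 * R\<close>, which covers the disk of radius \<open>R\<close> about
    \<open>a\<close>.\<close>
  define R where "R = \<epsilon> / 12"
  have R: "R > 0" "\<epsilon> = 12 * R" using eps by (auto simp: R_def)
  have y: "dist a y < R" using y by (simp add: R_def)
  obtain z where z: "x = Fin z" using no_return_iter_Infty[OF nr] x by (cases x) auto
  have P: "Fin w \<notin> post_singular f" if "w \<in> ball y (11 * R)" for w
    using eps(2)[of w a] a that y R dist_triangle[of a w y] by (auto simp: dist_commute)
  obtain g where g: "g holomorphic_on ball y (11 * R)" "g y = z"
      "\<And>w. w \<in> ball y (11 * R) \<Longrightarrow> iter f n (Fin (g w)) = Some (Fin w)"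
    using no_return_inverse_branch[OF nr _ P] x z R(1) by (metis zero_less_mult_iff zero_less_numeral)
  obtain a' where a': "a' \<in> Julia f" "dist a a' < R" "Fin a' \<notin> Julia_infty f"
    using dense a R(1) unfolding nonprepoles_dense_def by (metis mem_ball)
  have sub1: "ball a R \<subseteq> ball a' (8 * R / 4)"
  proof
    fix w assume "w \<in> ball a R"
    then show "w \<in> ball a' (8 * R / 4)" using a'(2) dist_triangle[of a' w a] by (simp add: dist_commute)
  qed
  have sub2: "ball a' (8 * R) \<subseteq> ball y (11 * R)"
  proof
    fix w assume "w \<in> ball a' (8 * R)"
    then show "w \<in> ball y (11 * R)"
      using a'(2) y dist_triangle[of y w a] dist_triangle[of a w a'] R(1) by (simp add: dist_commute)
  qed
  have sub3: "ball a R \<subseteq> ball y (11 * R)" using sub1 sub2 R(1) by (auto simp: subset_iff)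
  have hol: "g holomorphic_on ball a' (8 * R)" using g(1) sub2 by (rule holomorphic_on_subset)
  have inj: "inj_on g (ball a' (8 * R))"
    by (rule inj_onI) (metis g(3) sub2 subsetD option.inject rsphere.inject)
  have a'y: "a' \<in> ball y (11 * R)" using dist_triangle[of y a' a] a'(2) y R(1) by (simp add: dist_commute)
  have ga': "iter f n (Fin (g a')) = Some (Fin a')" using g(3)[OF a'y] .
  have gJ: "g a' \<in> Julia f" using Julia_iter_iff[OF ga'] a'(1) by simp
  \<comment> \<open>The orbit of \<open>g a'\<close> could meet infinity neither up to time
    \<open>n\<close>, by \<open>no_return\<close>, nor later, since \<open>a'\<close> is no
    prepole.\<close>
  have gJi: "Fin (g a') \<notin> Julia_infty f"
  proof
    assume "Fin (g a') \<in> Julia_infty f"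
    then obtain j where j: "iter f j (Fin (g a')) = Some Infty"
      unfolding Julia_infty_def by (auto simp: preimage_iff)
    show False
    proof (cases "j \<le> n")
      case True
      then show False using no_return_iter_finite[OF nr ga', of j] j by auto
    next
      case False
      then have "iter f (j - n) (Fin a') = Some Infty"
        using j iter_add_Some[OF ga', of "j - n"] by simp
      then have "Fin a' \<in> Julia_infty f"
        unfolding Julia_infty_def by (intro UN_I[of "j - n"]) (auto simp: preimage_iff)
      then show False using a'(3) by simp
    qed
  qed
  have "deriv (plane_iter f n) (g a') * deriv g a' = 1"
  proof (rule DERIV_mult_inverse_function)
    show "g field_differentiable at a'"
      by (rule holomorphic_on_imp_differentiable_at[OF g(1) open_ball a'y])
    show "plane_iter f n field_differentiable at (g a')"
      using plane_iter_analytic[OF ga'] analytic_on_imp_differentiable_at by blast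
    have "\<forall>\<^sub>F v in nhds a'. v \<in> ball y (11 * R)" using a'y by (intro eventually_nhds_in_open) auto
    then show "\<forall>\<^sub>F v in nhds a'. plane_iter f n (g v) = v"
      by eventually_elim (rule plane_iter_eq[OF g(3)])
  qed
  then have "cmod (deriv (plane_iter f n) (g a')) * cmod (deriv g a') = 1"
    by (metis norm_mult norm_one)
  then have "c * \<mu> ^ n * cmod (deriv g a') \<le> 1"
    using mult_right_mono[OF expand[OF gJ gJi, of n], of "cmod (deriv g a')"] by simp
  moreover have pos: "c * \<mu> ^ n > 0" using c by simp
  ultimately have dg: "cmod (deriv g a') \<le> 1 / (c * \<mu> ^ n)"
    by (simp add: pos_le_divide_eq mult.commute)
  have dgw: "cmod (deriv g w) \<le> Koebe_const / c / \<mu> ^ n" if "w \<in> ball a R" for w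
  proof -
    have "cmod (deriv g w) \<le> Koebe_const * cmod (deriv g a')"
      using sub1 that R(1) by (intro Koebe_distortion[OF hol inj]) auto
    also have "\<dots> \<le> Koebe_const * (1 / (c * \<mu> ^ n))"
      using dg Koebe_const_pos by (intro mult_left_mono) auto
    finally show ?thesis by simp
  qed
  have "dist (g w) (g w') \<le> Koebe_const / c / \<mu> ^ n * dist w w'" if "w \<in> ball a R" "w' \<in> ball a R" for w w'
    unfolding dist_norm
  proof (rule field_differentiable_bound[OF convex_ball _ dgw that])
    fix v assume "v \<in> ball a R"
    then have "v \<in> ball y (11 * R)" using sub3 by blast
    then have "(g has_field_derivative deriv g v) (at v)"
      using g(1) holomorphic_derivI open_ball by blast
    then show "(g has_field_derivative deriv g v) (at v within ball a R)"
      by (rule has_field_derivative_at_within)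
  qed
  then show "\<exists>g. g holomorphic_on ball a (\<epsilon> / 12) \<and> x = Fin (g y) \<and>
       (\<forall>w\<in>ball a (\<epsilon> / 12). iter f n (Fin (g w)) = Some (Fin w)) \<and>
       (\<forall>w\<in>ball a (\<epsilon> / 12). \<forall>w'\<in>ball a (\<epsilon> / 12). dist (g w) (g w') \<le> Koebe_const / c / \<mu> ^ n * dist w w')"
    unfolding R_def[symmetric]
    by (intro exI[of _ g] conjI holomorphic_on_subset[OF g(1) sub3] ballI g(3)) (use z g(2) sub3 in auto)
qed

lemma branches_at_weaken:
  assumes "branches_at n R L" "R' \<le> R" "L \<le> L'"
  shows "branches_at n R' L'"
  unfolding branches_at_def
proof (intro allI impI)
  fix a x y assume *: "a \<in> Julia f" "iter f n x = Some (Fin y)" "y \<in> ball a R'"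
  have sub: "ball a R' \<subseteq> ball a R" using assms(2) by (rule subset_ball)
  obtain g where g: "g holomorphic_on ball a R" "x = Fin (g y)"
    "\<And>w. w \<in> ball a R \<Longrightarrow> iter f n (Fin (g w)) = Some (Fin w)"
    "\<And>w w'. w \<in> ball a R \<Longrightarrow> w' \<in> ball a R \<Longrightarrow> dist (g w) (g w') \<le> L * dist w w'"
    by (rule branches_atE[OF assms(1) *(1,2) subsetD[OF sub *(3)]]) blast
  have "dist (g w) (g w') \<le> L' * dist w w'" if w: "w \<in> ball a R'" "w' \<in> ball a R'" for w w'
    using g(4)[OF subsetD[OF sub w(1)] subsetD[OF sub w(2)]]
      mult_right_mono[OF assms(3), of "dist w w'"] by simp
  then show "\<exists>g. g holomorphic_on ball a R' \<and> x = Fin (g y) \<and>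
       (\<forall>w\<in>ball a R'. iter f n (Fin (g w)) = Some (Fin w)) \<and>
       (\<forall>w\<in>ball a R'. \<forall>w'\<in>ball a R'. dist (g w) (g w') \<le> L' * dist w w')"
    using sub by (intro exI[of _ g] conjI holomorphic_on_subset[OF g(1)] g(2)) (auto intro: g(3))
qed

text \<open>As \<open>K \<le> 1\<close>, the first branch maps the disk about \<open>a\<close> into
  the disk of the same radius about the Julia point \<open>g a\<close>, where the second branch is
  defined. So composition does not shrink the radius.\<close>

lemma branches_at_add:
  assumes m: "branches_at m R K" and n: "branches_at n R L" and "0 \<le> K" "K \<le> 1" "0 \<le> L"
  shows "branches_at (m + n) R (L * K)"
  unfolding branches_at_def
proof (intro allI impI)
  fix a x y assume a: "a \<in> Julia f" and x: "iter f (m + n) x = Some (Fin y)" and y: "y \<in> ball a R"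
  have aR: "a \<in> ball a R" using y by (metis centre_in_ball dist_self mem_ball zero_le_dist order_le_less_trans)
  obtain u where u: "iter f n x = Some u" "iter f m u = Some (Fin y)"
    using x by (auto simp: iter_add map_comp_def split: option.splits)
  obtain g where g: "g holomorphic_on ball a R" "u = Fin (g y)"
    "\<And>w. w \<in> ball a R \<Longrightarrow> iter f m (Fin (g w)) = Some (Fin w)"
    "\<And>w w'. w \<in> ball a R \<Longrightarrow> w' \<in> ball a R \<Longrightarrow> dist (g w) (g w') \<le> K * dist w w'"
    by (rule branches_atE[OF m a u(2) y]) blast
  have ga: "g a \<in> Julia f" using Julia_iter_iff[OF g(3)[OF aR]] a by simp
  have gb: "g w \<in> ball (g a) R" if "w \<in> ball a R" for w
  proof -
    have "dist (g a) (g w) \<le> 1 * dist a w"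
      using g(4)[OF aR that] mult_right_mono[OF \<open>K \<le> 1\<close>, of "dist a w"] by simp
    then show ?thesis using that by simp
  qed
  have "iter f n x = Some (Fin (g y))" using u(1) g(2) by simp
  then obtain h where h: "h holomorphic_on ball (g a) R" "x = Fin (h (g y))"
    "\<And>w. w \<in> ball (g a) R \<Longrightarrow> iter f n (Fin (h w)) = Some (Fin w)"
    "\<And>w w'. w \<in> ball (g a) R \<Longrightarrow> w' \<in> ball (g a) R \<Longrightarrow> dist (h w) (h w') \<le> L * dist w w'"
    by (rule branches_atE[OF n ga _ gb[OF y]]) blast
  have "h \<circ> g holomorphic_on ball a R"
    by (rule holomorphic_on_compose_gen[OF g(1) h(1)]) (use gb in blast)
  moreover have "iter f (m + n) (Fin ((h \<circ> g) w)) = Some (Fin w)" if "w \<in> ball a R" for w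
    using iter_add_Some[OF h(3)[OF gb[OF that]]] g(3)[OF that] by simp
  moreover have "dist ((h \<circ> g) w) ((h \<circ> g) w') \<le> L * K * dist w w'"
    if "w \<in> ball a R" "w' \<in> ball a R" for w w'
  proof -
    have "dist ((h \<circ> g) w) ((h \<circ> g) w') \<le> L * dist (g w) (g w')"
      using h(4)[OF gb[OF that(1)] gb[OF that(2)]] by simp
    also have "\<dots> \<le> L * (K * dist w w')" using g(4)[OF that] \<open>0 \<le> L\<close> by (rule mult_left_mono)
    finally show ?thesis by simp
  qed
  ultimately show "\<exists>g. g holomorphic_on ball a R \<and> x = Fin (g y) \<and>
       (\<forall>w\<in>ball a R. iter f (m + n) (Fin (g w)) = Some (Fin w)) \<and>
       (\<forall>w\<in>ball a R. \<forall>w'\<in>ball a R. dist (g w) (g w') \<le> L * K * dist w w')"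
    using h(2) by (intro exI[of _ "h \<circ> g"]) auto
qed

section \<open>Infinity in the Fatou set: compact Julia set\<close>

lemma nontranscendental_dom:
  assumes "\<not> transcendental f"
  shows "\<exists>y. iter f n x = Some y"
proof (induction n)
  case (Suc n)
  then obtain u where "iter f n x = Some u" by blast
  moreover obtain y where "sphere_map f u = Some y"
    using assms by (cases u) (auto simp: sphere_map_def)
  ultimately show ?case by (auto simp: map_comp_def)
qed auto

lemma Fatou_Infty_nontranscendental: "Infty \<in> Fatou f \<Longrightarrow> \<not> transcendental f"
  using Fatou_imp_dom[of Infty f "Suc 0"] by (auto simp: sphere_map_def split: if_splits)

lemma compact_Julia:
  assumes "Infty \<in> Fatou f"
  shows "compact (Julia f)"
proof -
  obtain r where r: "r > 0" "chart Infty ` cball 0 r \<subseteq> Fatou f"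
    using nhds_obtain_chart_ball[OF open_Fatou assms] .
  have "norm z \<le> 1 / r" if "z \<in> Julia f" for z
    using Fin_in_chart_Infty[OF r(1), of z] r(2) that by (fastforce simp: Julia_def not_less)
  then have "bounded (Julia f)" by (auto simp: bounded_iff)
  then show ?thesis using closed_Julia by (simp add: compact_eq_bounded_closed)
qed

lemma Julia_orbit_finite:
  assumes "Infty \<in> Fatou f" "z \<in> Julia f"
  obtains u where "iter f n (Fin z) = Some (Fin u)" "u \<in> Julia f"
proof -
  obtain y where y: "iter f n (Fin z) = Some y"
    using nontranscendental_dom[OF Fatou_Infty_nontranscendental[OF assms(1)]] by blast
  moreover have "y \<notin> Fatou f" using Fatou_iter_iff[OF y] assms(2) by (simp add: Julia_def)
  ultimately show thesis using that assms(1) by (cases y) (auto simp: Julia_def)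
qed

lemma local_branch_near_Julia:
  assumes F: "Infty \<in> Fatou f" and L: "L > 0"
    and z: "z \<in> Julia f" "cmod (deriv (plane_iter f n) z) \<ge> L"
  obtains r where "r > 0" "plane_iter f n holomorphic_on ball z r" "inj_on (plane_iter f n) (ball z r)"
    "\<And>w. w \<in> ball z r \<Longrightarrow> iter f n (Fin w) = Some (Fin (plane_iter f n w))"
    "\<And>w. w \<in> ball z r \<Longrightarrow> cmod (deriv (plane_iter f n) w) \<ge> L / 2"
proof -
  obtain u where u: "iter f n (Fin z) = Some (Fin u)" using Julia_orbit_finite[OF F z(1)] by metis
  obtain r0 where r0: "r0 > 0" "plane_iter f n holomorphic_on ball z r0"
    using plane_iter_analytic[OF u] by (auto simp: analytic_on_def)
  have "deriv (plane_iter f n) z \<noteq> 0" using z(2) L by auto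
  then obtain r1 where r1: "r1 > 0" "inj_on (plane_iter f n) (ball z r1)"
    using has_complex_derivative_locally_injective[OF r0(2) _ open_ball] r0(1) by (metis centre_in_ball)
  obtain r2 where r2: "r2 > 0" "\<And>w. dist w z < r2 \<Longrightarrow> iter f n (Fin w) = Some (Fin (plane_iter f n w))"
    using plane_iter_near[OF u] by (auto simp: eventually_nhds_metric)
  have "deriv (plane_iter f n) holomorphic_on ball z r0"
    using r0(2) by (rule holomorphic_deriv) simp
  then have "isCont (deriv (plane_iter f n)) z"
    using r0(1) holomorphic_on_imp_continuous_on continuous_on_eq_continuous_at by (metis centre_in_ball open_ball)
  then obtain r3 where r3: "r3 > 0"
      "\<And>w. dist w z < r3 \<Longrightarrow> dist (deriv (plane_iter f n) w) (deriv (plane_iter f n) z) < L / 2"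
    using L unfolding continuous_at_eps_delta by (metis half_gt_zero)
  define r where "r = min (min r0 r1) (min r2 r3)"
  show thesis
  proof (rule that[of r])
    show "r > 0" using r0 r1 r2 r3 by (simp add: r_def)
    show "plane_iter f n holomorphic_on ball z r"
      by (rule holomorphic_on_subset[OF r0(2)]) (auto simp: r_def)
    show "inj_on (plane_iter f n) (ball z r)" by (rule inj_on_subset[OF r1(2)]) (auto simp: r_def)
    show "iter f n (Fin w) = Some (Fin (plane_iter f n w))" if "w \<in> ball z r" for w
      using that by (intro r2(2)) (auto simp: r_def dist_commute)
    show "cmod (deriv (plane_iter f n) w) \<ge> L / 2" if "w \<in> ball z r" for w
    proof -
      have "dist (deriv (plane_iter f n) w) (deriv (plane_iter f n) z) < L / 2"
        using that by (intro r3(2)) (auto simp: r_def dist_commute)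
      then show ?thesis
        using z(2) norm_triangle_sub[of "deriv (plane_iter f n) z" "deriv (plane_iter f n) w"]
        by (simp add: dist_norm norm_minus_commute)
    qed
  qed
qed

text \<open>The derivative of the inverse is at most \<open>2 / L\<close>. This integrates to a
  Lipschitz bound along segments, hence the restriction to disks inside the image.\<close>

lemma Lipschitz_inverse:
  assumes F: "F holomorphic_on ball z r" and inj: "inj_on F (ball z r)" and "L > 0"
    and d: "\<And>w. w \<in> ball z r \<Longrightarrow> cmod (deriv F w) \<ge> L / 2"
  shows "\<exists>h. h holomorphic_on F ` ball z r \<and> (\<forall>w\<in>ball z r. h (F w) = w) \<and>
    (\<forall>a R. ball a R \<subseteq> F ` ball z r \<longrightarrow>
      (\<forall>w\<in>ball a R. \<forall>w'\<in>ball a R. dist (h w) (h w') \<le> 2 / L * dist w w'))"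
proof -
  obtain h where h: "h holomorphic_on F ` ball z r"
      "\<And>w. w \<in> ball z r \<Longrightarrow> deriv F w * deriv h (F w) = 1" "\<And>w. w \<in> ball z r \<Longrightarrow> h (F w) = w"
    by (rule holomorphic_has_inverse[OF F open_ball inj]) blast
  have dh: "cmod (deriv h v) \<le> 2 / L" if v: "v \<in> F ` ball z r" for v
  proof -
    obtain w where w: "w \<in> ball z r" "v = F w" using v by blast
    have "cmod (deriv F w) * cmod (deriv h v) = 1"
      using h(2)[OF w(1)] w(2) by (metis norm_mult norm_one)
    then have "L / 2 * cmod (deriv h v) \<le> 1"
      using mult_right_mono[OF d[OF w(1)], of "cmod (deriv h v)"] by simp
    then show ?thesis using \<open>L > 0\<close> by (simp add: field_simps)
  qed
  have op: "open (F ` ball z r)" using open_mapping_thm3[OF F open_ball inj] .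
  show ?thesis
  proof (intro exI[of _ h] conjI ballI allI impI h(1,3))
    fix a R w w' assume *: "ball a R \<subseteq> F ` ball z r" "w \<in> ball a R" "w' \<in> ball a R"
    show "dist (h w) (h w') \<le> 2 / L * dist w w'" unfolding dist_norm
    proof (rule field_differentiable_bound[OF convex_ball _ _ *(2,3)])
      fix v assume v: "v \<in> ball a R"
      then show "cmod (deriv h v) \<le> 2 / L" using *(1) by (intro dh) blast
      have "(h has_field_derivative deriv h v) (at v)"
        using h(1) op *(1) v by (intro holomorphic_derivI) auto
      then show "(h has_field_derivative deriv h v) (at v within ball a R)"
        by (rule has_field_derivative_at_within)
    qed
  qed
qed

text \<open>
  All preimages of \<open>a\<close> lie in the compact set \<open>J\<close>; since the sphere is compact, the preimages
  of points close to \<open>a\<close> are close to those of \<open>a\<close>.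
\<close>

lemma compact_branches_at:
  assumes F: "Infty \<in> Fatou f" and L: "L > 0"
    and d: "\<And>z. z \<in> Julia f \<Longrightarrow> cmod (deriv (plane_iter f n) z) \<ge> L"
  obtains R where "R > 0" "branches_at n R (2 / L)"
proof -
  let ?F = "plane_iter f n"
  have "\<forall>z\<in>Julia f. \<exists>r. r > 0 \<and> ?F holomorphic_on ball z r \<and> inj_on ?F (ball z r) \<and>
    (\<forall>w\<in>ball z r. iter f n (Fin w) = Some (Fin (?F w))) \<and>
    (\<forall>w\<in>ball z r. cmod (deriv ?F w) \<ge> L / 2)"
  proof
    fix z assume z: "z \<in> Julia f"
    show "\<exists>r. r > 0 \<and> ?F holomorphic_on ball z r \<and> inj_on ?F (ball z r) \<and>
      (\<forall>w\<in>ball z r. iter f n (Fin w) = Some (Fin (?F w))) \<and>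
      (\<forall>w\<in>ball z r. cmod (deriv ?F w) \<ge> L / 2)"
      by (rule local_branch_near_Julia[OF F L z d[OF z]]) blast
  qed
  from bchoice[OF this] obtain r where r': "\<forall>z\<in>Julia f. r z > 0 \<and> ?F holomorphic_on ball z (r z) \<and>
    inj_on ?F (ball z (r z)) \<and> (\<forall>w\<in>ball z (r z). iter f n (Fin w) = Some (Fin (?F w))) \<and>
    (\<forall>w\<in>ball z (r z). cmod (deriv ?F w) \<ge> L / 2)" ..
  have r: "r z > 0" "?F holomorphic_on ball z (r z)" "inj_on ?F (ball z (r z))"
      "\<And>w. w \<in> ball z (r z) \<Longrightarrow> iter f n (Fin w) = Some (Fin (?F w))"
      "\<And>w. w \<in> ball z (r z) \<Longrightarrow> cmod (deriv ?F w) \<ge> L / 2"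
    if "z \<in> Julia f" for z
    using r' that by blast+
  have total: "\<exists>y. iter f n x = Some y" for x
    by (rule nontranscendental_dom[OF Fatou_Infty_nontranscendental[OF F]])
  have cont: "continuous_on A (\<lambda>x. the (iter f n x))" for A
    by (rule continuous_on_iter) (use total in blast)
  have "\<exists>s>0. \<forall>x y. iter f n x = Some (Fin y) \<longrightarrow> y \<in> ball a s \<longrightarrow>
      (\<exists>z\<in>Julia f. x \<in> Fin ` ball z (r z) \<and> ball a s \<subseteq> ?F ` ball z (r z))"
    if a: "a \<in> Julia f" for a
  proof -
    define K where "K = (\<lambda>x. the (iter f n x)) -` {Fin a}"
    have "closed K" unfolding K_def by (rule closed_vimage[OF _ cont]) simp
    then have "compact K" using compact_UNIV_rsphere compact_Int_closed by fastforce
    moreover have "K \<subseteq> (\<Union>z\<in>{z\<in>Julia f. ?F z = a}. Fin ` ball z (r z))"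
    proof
      fix x assume "x \<in> K"
      then have x: "iter f n x = Some (Fin a)" using total[of x] by (auto simp: K_def)
      then have "x \<notin> Fatou f" using Fatou_iter_iff[OF x] a by (simp add: Julia_def)
      then obtain z where z: "x = Fin z" "z \<in> Julia f" using F by (cases x) (auto simp: Julia_def)
      then have "?F z = a" using x by (simp add: plane_iter_def)
      then show "x \<in> (\<Union>z\<in>{z\<in>Julia f. ?F z = a}. Fin ` ball z (r z))"
        using z r(1)[OF z(2)] by (intro UN_I[of z]) auto
    qed
    moreover have "\<And>z. open (Fin ` ball z (r z))" by simp
    ultimately obtain Z where Z: "Z \<subseteq> {z\<in>Julia f. ?F z = a}" "finite Z" "K \<subseteq> (\<Union>z\<in>Z. Fin ` ball z (r z))"
      by (meson compactE_image)
    \<comment> \<open>The complement of this open set is compact and so is its image, which misses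
      \<open>a\<close>. Hence all preimages of points near \<open>a\<close> lie in the chosen
      disks.\<close>
    define O' where "O' = (\<Union>z\<in>Z. Fin ` ball z (r z))"
    have "open O'" unfolding O'_def by (intro open_UN) auto
    then have "compact (- O')" using compact_UNIV_rsphere by (metis closed_Compl compact_Int_closed inf_top_left)
    then have "compact ((\<lambda>x. the (iter f n x)) ` (- O'))" by (intro compact_continuous_image cont)
    then have "open (- ((\<lambda>x. the (iter f n x)) ` (- O')))" by (intro open_Compl compact_imp_closed)
    moreover have "x \<in> O'" if x: "Fin a = the (iter f n x)" for x
      using subsetD[OF Z(3), of x] x by (simp add: O'_def K_def)
    then have "Fin a \<in> - ((\<lambda>x. the (iter f n x)) ` (- O'))" by blast
    ultimately obtain s1 where s1: "s1 > 0" "chart (Fin a) ` cball 0 s1 \<subseteq> - ((\<lambda>x. the (iter f n x)) ` (- O'))"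
      by (rule nhds_obtain_chart_ball)
    have "open (\<Inter>z\<in>Z. ?F ` ball z (r z))"
      using Z(1,2) r(2,3) by (intro open_INT ballI open_mapping_thm3 open_ball) auto
    moreover have "a \<in> (\<Inter>z\<in>Z. ?F ` ball z (r z))" using Z(1) r(1) by (force intro: image_eqI)
    ultimately obtain s2 where s2: "s2 > 0" "ball a s2 \<subseteq> (\<Inter>z\<in>Z. ?F ` ball z (r z))"
      by (meson openE)
    show ?thesis
    proof (intro exI[of _ "min s1 s2"] conjI allI impI)
      show "0 < min s1 s2" using s1 s2 by simp
      fix x y assume x: "iter f n x = Some (Fin y)" "y \<in> ball a (min s1 s2)"
      have "Fin y \<in> chart (Fin a) ` cball 0 s1"
        using x(2) by (auto simp: dist_norm norm_minus_commute intro!: image_eqI[of _ _ "y - a"])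
      then have "x \<in> O'" using s1(2) x(1) by (force simp: image_iff)
      then obtain z where z: "z \<in> Z" "x \<in> Fin ` ball z (r z)" by (auto simp: O'_def)
      moreover have "ball a (min s1 s2) \<subseteq> ?F ` ball z (r z)" using s2(2) z(1) by auto
      ultimately show "\<exists>z\<in>Julia f. x \<in> Fin ` ball z (r z) \<and> ball a (min s1 s2) \<subseteq> ?F ` ball z (r z)"
        using Z(1) by blast
    qed
  qed
  then obtain s where s: "\<And>a. a \<in> Julia f \<Longrightarrow> s a > 0"
      "\<And>a x y. a \<in> Julia f \<Longrightarrow> iter f n x = Some (Fin y) \<Longrightarrow> y \<in> ball a (s a) \<Longrightarrow>
      \<exists>z\<in>Julia f. x \<in> Fin ` ball z (r z) \<and> ball a (s a) \<subseteq> ?F ` ball z (r z)"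
    by metis
  have "Julia f \<subseteq> \<Union> ((\<lambda>a. ball a (s a)) ` Julia f)" using s(1) by force
  \<comment> \<open>A Lebesgue number of the cover of the compact Julia set makes the radius
    independent of \<open>a\<close>.\<close>
  then obtain R where R: "R > 0" "\<And>x. x \<in> Julia f \<Longrightarrow> \<exists>B\<in>(\<lambda>a. ball a (s a)) ` Julia f. ball x R \<subseteq> B"
    by (rule Heine_Borel_lemma[OF compact_Julia[OF F]]) auto
  have "branches_at n R (2 / L)" unfolding branches_at_def
  proof (intro allI impI)
    fix a x y assume a: "a \<in> Julia f" and x: "iter f n x = Some (Fin y)" and y: "y \<in> ball a R"
    obtain a' where a': "a' \<in> Julia f" "ball a R \<subseteq> ball a' (s a')" using R(2)[OF a] by auto
    obtain z where z: "z \<in> Julia f" "x \<in> Fin ` ball z (r z)" "ball a' (s a') \<subseteq> ?F ` ball z (r z)"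
      using s(2)[OF a'(1) x] a'(2) y by blast
    obtain h where h: "h holomorphic_on ?F ` ball z (r z)" "\<forall>w\<in>ball z (r z). h (?F w) = w"
      "\<forall>a R. ball a R \<subseteq> ?F ` ball z (r z) \<longrightarrow>
        (\<forall>w\<in>ball a R. \<forall>w'\<in>ball a R. dist (h w) (h w') \<le> 2 / L * dist w w')"
      using Lipschitz_inverse[OF r(2)[OF z(1)] r(3)[OF z(1)] L r(5)[OF z(1)]] by blast
    obtain w where w: "w \<in> ball z (r z)" "x = Fin w" using z(2) by blast
    have "?F w = y" using x w(2) by (simp add: plane_iter_def)
    moreover have "h (?F w) = w" using h(2) w(1) by blast
    ultimately have "x = Fin (h y)" using w(2) by simp
    moreover have sub: "ball a R \<subseteq> ?F ` ball z (r z)" using a'(2) z(3) by blast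
    moreover have "iter f n (Fin (h v)) = Some (Fin v)" if v: "v \<in> ball a R" for v
    proof -
      obtain u where "u \<in> ball z (r z)" "v = ?F u" using sub v by blast
      then show ?thesis using h(2) r(4)[OF z(1)] by simp
    qed
    ultimately show "\<exists>g. g holomorphic_on ball a R \<and> x = Fin (g y) \<and>
       (\<forall>w\<in>ball a R. iter f n (Fin (g w)) = Some (Fin w)) \<and>
       (\<forall>w\<in>ball a R. \<forall>w'\<in>ball a R. dist (g w) (g w') \<le> 2 / L * dist w w')"
      using h(3) by (intro exI[of _ h] conjI ballI holomorphic_on_subset[OF h(1)]) auto
  qed
  then show thesis using that R(1) by blast
qed

text \<open>The radius from \<open>compact_branches_at\<close> may shrink with \<open>n\<close>. So
  it is used for finitely many iterates, up to an \<open>M\<close> whose branches contract by a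
  factor 2; all others are composed from these without loss of radius.\<close>

lemma compact_Julia_expanding:
  assumes F: "Infty \<in> Fatou f" and c: "c > 0" "\<mu> > 1"
    and d: "\<And>n z. z \<in> Julia f \<Longrightarrow> cmod (deriv (plane_iter f n) z) \<ge> c * \<mu> ^ n"
  shows "uniformly_expanding f"
proof -
  \<comment> \<open>The bound \<open>4 / c\<close> makes the constant
    \<open>2 / (c * \<mu> ^ M)\<close> at most \<open>1 / 2\<close>; the successor ensures
    \<open>M > 0\<close>.\<close>
  obtain m where "\<mu> ^ m > 4 / c" using real_arch_pow[OF c(2)] by blast
  moreover have "\<mu> ^ m \<le> \<mu> ^ Suc m" using c by (intro power_increasing) auto
  ultimately have "4 / c < \<mu> ^ Suc m" by (rule less_le_trans)
  then have m: "c * \<mu> ^ Suc m \<ge> 4"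
    using c by (simp only: pos_divide_less_eq mult.commute less_imp_le)
  define M where "M = Suc m"
  have "\<exists>R>0. branches_at n R (2 / (c * \<mu> ^ n))" for n
    by (rule compact_branches_at[OF F, of "c * \<mu> ^ n" n]) (use c d in auto)
  then obtain r where r: "\<And>n. r n > 0" "\<And>n. branches_at n (r n) (2 / (c * \<mu> ^ n))" by metis
  define R where "R = Min (r ` {..M})"
  have R: "R > 0" "\<And>n. n \<le> M \<Longrightarrow> R \<le> r n" using r(1) by (auto simp: R_def)
  have bM: "branches_at M R (1 / 2)"
    by (rule branches_at_weaken[OF r(2) R(2)]) (use m c in \<open>auto simp: M_def field_simps\<close>)
  have bj: "branches_at n R (2 / c)" if "n \<le> M" for n
  proof (rule branches_at_weaken[OF r(2) R(2)[OF that]])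
    have "c * 1 \<le> c * \<mu> ^ n" using c by (intro mult_left_mono one_le_power) auto
    then show "2 / (c * \<mu> ^ n) \<le> 2 / c" using c by (intro divide_left_mono) auto
  qed
  have bk: "branches_at (k * M + j) R (2 / c / 2 ^ k)" if "j \<le> M" for j k
  proof (induction k)
    case (Suc k)
    have "branches_at (M + (k * M + j)) R (2 / c / 2 ^ k * (1 / 2))"
      by (rule branches_at_add[OF bM Suc]) (use c in auto)
    then show ?case by (simp add: add.assoc mult.commute)
  qed (use bj that in simp)
  have "M > 0" by (simp add: M_def)
  \<comment> \<open>The rate per single step that doubles after \<open>M\<close> steps. Rounding
    \<open>n\<close> down to a multiple of \<open>M\<close> costs at most a factor 2, hence
    \<open>4 / c\<close> below.\<close>
  define \<nu> where "\<nu> = root M 2"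
  have \<nu>: "\<nu> ^ M = 2" "\<nu> > 1" unfolding \<nu>_def using \<open>M > 0\<close> by (simp_all add: real_root_pow_pos2)
  have "branches_at n R (4 / c / \<nu> ^ n)" for n
  proof -
    define k j where "k = n div M" and "j = n mod M"
    have n: "n = k * M + j" "j \<le> M" using \<open>M > 0\<close> by (simp_all add: k_def j_def less_imp_le)
    have "\<nu> ^ n = 2 ^ k * \<nu> ^ j"
      using \<nu>(1) by (simp add: n(1) power_add mult.commute[of k] power_mult)
    also have "\<dots> \<le> 2 ^ k * \<nu> ^ M" using \<nu>(2) n(2) by (intro mult_left_mono power_increasing) auto
    finally have "\<nu> ^ n \<le> 2 ^ k * 2" using \<nu>(1) by simp
    then have "2 / c / 2 ^ k \<le> 4 / c / \<nu> ^ n" using c \<nu>(2) by (simp add: field_simps)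
    then show ?thesis using branches_at_weaken[OF bk[OF n(2), of k] order_refl] n(1) by simp
  qed
  then show ?thesis using R(1) c \<nu>(2) by (intro branches_imp_expanding[of R "4 / c" \<nu>]) auto
qed

end

section \<open>Prepoles and isolated points of the Julia set\<close>

lemma tendsto_Fin_Infty_iff: "((\<lambda>t. Fin (g t)) \<longlongrightarrow> Infty) F \<longleftrightarrow> filterlim g at_infinity F"
proof
  assume L: "((\<lambda>t. Fin (g t)) \<longlongrightarrow> Infty) F"
  have "\<forall>\<^sub>F t in F. Fin (g t) \<in> - {Fin 0}" by (rule topological_tendstoD[OF L]) auto
  then have nz: "\<forall>\<^sub>F t in F. g t \<noteq> 0" by eventually_elim auto
  have "((\<lambda>t. sinv (Fin (g t))) \<longlongrightarrow> Fin 0) F" using L by (simp only: tendsto_Infty_iff)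
  then have "((\<lambda>t. Fin (inverse (g t))) \<longlongrightarrow> Fin 0) F"
    by (rule Lim_transform_eventually) (use nz in eventually_elim, simp add: inverse_eq_divide)
  then have "((\<lambda>t. inverse (g t)) \<longlongrightarrow> 0) F" by (simp only: tendsto_Fin_iff)
  then have "filterlim (\<lambda>t. inverse (g t)) (at 0) F"
    unfolding filterlim_at using nz by (auto elim: eventually_mono)
  then show "filterlim g at_infinity F" by (simp only: filterlim_inverse_at_iff)
next
  assume L: "filterlim g at_infinity F"
  have nz: "\<forall>\<^sub>F t in F. g t \<noteq> 0" using filterlim_at_infinity_imp_eventually_ne[OF L] .
  have "((\<lambda>t. inverse (g t)) \<longlongrightarrow> 0) F"
    using L unfolding filterlim_inverse_at_iff[symmetric] filterlim_at by simp
  then have "((\<lambda>t. Fin (inverse (g t))) \<longlongrightarrow> Fin 0) F" by (simp only: tendsto_Fin_iff)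
  then have "((\<lambda>t. sinv (Fin (g t))) \<longlongrightarrow> Fin 0) F"
    by (rule Lim_transform_eventually) (use nz in eventually_elim, simp add: inverse_eq_divide)
  then show "((\<lambda>t. Fin (g t)) \<longlongrightarrow> Infty) F" by (simp only: tendsto_Infty_iff)
qed

lemma filterlim_inverse_at_0: "filterlim inverse (at (0::complex)) at_infinity"
  unfolding filterlim_inverse_at_iff by (rule filterlim_ident)

context meromorphic_dynamics
begin

text \<open>The finite points of a fibre have no limit point in the plane, by the identity
  theorem.\<close>

lemma countable_fibre: "countable {x. sphere_map f x = Some u}"
proof -
  let ?A = "{z. to_sphere f z = u}"
  have "\<not> z islimpt ?A" for z
  proof
    assume "z islimpt ?A"
    then have "\<exists>\<^sub>F w in at z. to_sphere f w = u" by (simp add: islimpt_conv_frequently_at)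
    then have "\<exists>\<^sub>F w in at z. f w = (case u of Fin v \<Rightarrow> v | Infty \<Rightarrow> 0)"
      by (rule frequently_elim1) (auto simp: to_sphere_def pole_value split: if_splits)
    then show False using not_locally_constant by blast
  qed
  then have "countable ?A" by (rule no_limpt_imp_countable)
  moreover have "{x. sphere_map f x = Some u} \<subseteq> insert Infty (Fin ` ?A)"
    by (auto intro: rsphere.exhaust) (metis (mono_tags, lifting) image_eqI mem_Collect_eq option.inject rsphere.exhaust sphere_map_Fin)
  ultimately show ?thesis by (meson countable_image countable_insert countable_subset)
qed

lemma countable_preimage: "countable (preimage f n {y})"
proof (induction n)
  case 0
  have "preimage f 0 {y} = {y}" by (auto simp: preimage_iff)
  then show ?case by simp
next
  case (Suc n)
  have "preimage f (Suc n) {y} \<subseteq> (\<Union>u\<in>preimage f n {y}. {x. sphere_map f x = Some u})"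
  proof
    fix x assume "x \<in> preimage f (Suc n) {y}"
    then have "iter f (Suc n) x = Some y" by (simp add: preimage_iff del: iter.simps(2))
    then obtain u where "sphere_map f x = Some u" "iter f n u = Some y" by (rule iter_SucE)
    then show "x \<in> (\<Union>u\<in>preimage f n {y}. {x. sphere_map f x = Some u})" by (auto simp: preimage_iff)
  qed
  moreover have "countable (\<Union>u\<in>preimage f n {y}. {x. sphere_map f x = Some u})"
    using Suc countable_fibre by (intro countable_UN) auto
  ultimately show ?case by (rule countable_subset)
qed

lemma countable_Julia_infty: "countable {z. Fin z \<in> Julia_infty f}"
proof -
  have "countable (Julia_infty f)"
    unfolding Julia_infty_def using countable_preimage by (intro countable_UN) auto
  then have "countable (Fin ` {z. Fin z \<in> Julia_infty f})"
    by (rule countable_subset[rotated]) auto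
  then show ?thesis by (rule countable_image_inj_on) (auto simp: inj_on_def)
qed

text \<open>
  Prepoles are countable, so by Baire's theorem they can only fill a relatively open part of the
  Julia set if one of them is an isolated point.
\<close>

lemma nonprepoles_dense_or_isolated:
  assumes "\<not> nonprepoles_dense"
  obtains b r where "b \<in> Julia f" "Fin b \<in> Julia_infty f" "r > 0" "\<And>z. z \<in> ball b r \<Longrightarrow> z \<noteq> b \<Longrightarrow> z \<notin> Julia f"
proof -
  obtain a s where a: "a \<in> Julia f" "s > 0" "\<And>z. z \<in> Julia f \<Longrightarrow> z \<in> ball a s \<Longrightarrow> Fin z \<in> Julia_infty f"
    using assms unfolding nonprepoles_dense_def by blast
  define N where "N = Julia f \<inter> ball a s"
  have "\<exists>b\<in>N. \<not> b islimpt Julia f"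
  proof (rule ccontr)
    assume no: "\<not> (\<exists>b\<in>N. \<not> b islimpt Julia f)"
    \<comment> \<open>If no point of \<open>N\<close> is isolated, each of these sets is open and
      dense in the Julia set. Yet their intersection misses the disk, all of whose Julia points have
      been removed.\<close>
    define \<G> where "\<G> = (\<lambda>b. Julia f - {b}) ` N"
    have "Julia f \<subseteq> closure (\<Inter>\<G>)"
    proof (rule Baire[OF closed_Julia])
      have "countable N"
        by (rule countable_subset[OF _ countable_Julia_infty]) (use a(3) in \<open>auto simp: N_def\<close>)
      then show "countable \<G>" by (simp add: \<G>_def)
      fix T assume "T \<in> \<G>"
      then obtain b where b: "b \<in> N" "T = Julia f - {b}" by (auto simp: \<G>_def)
      have "openin (top_of_set (Julia f)) (Julia f \<inter> - {b})" by (rule openin_open_Int) auto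
      then have "openin (top_of_set (Julia f)) T" by (simp add: b(2) Diff_eq)
      moreover have "Julia f \<subseteq> closure T"
      proof
        fix z assume z: "z \<in> Julia f"
        show "z \<in> closure T"
        proof (cases "z = b")
          case True
          have "b islimpt Julia f" using no b(1) by blast
          then have "b islimpt (Julia f - {b})" by (simp add: islimpt_approachable) blast
          then show ?thesis using True b(2) by (simp add: closure_def)
        next
          case False
          then show ?thesis using z b(2) closure_subset[of T] by auto
        qed
      qed
      ultimately show "openin (top_of_set (Julia f)) T \<and> Julia f \<subseteq> closure T" ..
    qed
    moreover have "\<Inter>\<G> \<inter> ball a s = {}"
    proof (rule ccontr)
      assume "\<Inter>\<G> \<inter> ball a s \<noteq> {}"
      then obtain z where z: "z \<in> \<Inter>\<G>" "z \<in> ball a s" by blast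
      have "a \<in> N" using a(1,2) by (simp add: N_def)
      then have "Julia f - {a} \<in> \<G>" by (auto simp: \<G>_def)
      then have "z \<in> N" using z by (auto simp: N_def)
      then have "Julia f - {z} \<in> \<G>" by (auto simp: \<G>_def)
      then show False using z(1) by blast
    qed
    then have "closure (\<Inter>\<G>) \<inter> ball a s = {}"
      using open_Int_closure_eq_empty[OF open_ball, of a s "\<Inter>\<G>"] by (simp add: Int_commute)
    moreover have "a \<in> ball a s" using a(2) by simp
    ultimately show False using a(1) by blast
  qed
  then obtain b where b: "b \<in> N" "\<not> b islimpt Julia f" by blast
  then obtain r where "r > 0" "\<And>z. z \<in> Julia f \<Longrightarrow> z \<noteq> b \<Longrightarrow> \<not> dist z b < r"
    unfolding islimpt_approachable by blast
  then show thesis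
    using that[of b r] b(1) a(3) by (auto simp: N_def dist_commute)
qed

text \<open>The iterate that sends \<open>b\<close> to infinity is open, so it carries the isolation
  of \<open>b\<close> over to infinity: points near infinity are images of Fatou points near
  \<open>b\<close>.\<close>

lemma isolated_prepole:
  assumes b: "b \<in> Julia f" "Fin b \<in> Julia_infty f"
    and r: "r > 0" "\<And>z. z \<in> ball b r \<Longrightarrow> z \<noteq> b \<Longrightarrow> z \<notin> Julia f"
  shows "\<exists>R>0. \<forall>z. norm z > R \<longrightarrow> z \<notin> Julia f" "Infty \<notin> Fatou f"
proof -
  obtain k where k: "iter f k (Fin b) = Some Infty"
    using b(2) by (auto simp: Julia_infty_def preimage_iff)
  show "Infty \<notin> Fatou f" using Fatou_iter_iff[OF k] b(1) by (simp add: Julia_def)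
  have "open (Fin ` ball b r)" "Fin b \<in> Fin ` ball b r" using r(1) by auto
  from iter_open[OF k this] obtain V where V: "open V" "Infty \<in> V"
      "\<And>v. v \<in> V \<Longrightarrow> \<exists>u\<in>Fin ` ball b r. iter f k u = Some v"
    by blast
  obtain s where s: "s > 0" "chart Infty ` cball 0 s \<subseteq> V"
    using nhds_obtain_chart_ball[OF V(1,2)] .
  have "z \<notin> Julia f" if z: "norm z > 1 / s" for z
  proof -
    have "Fin z \<in> chart Infty ` cball 0 s" by (rule Fin_in_chart_Infty[OF s(1) z])
    then obtain u where u: "u \<in> ball b r" "iter f k (Fin u) = Some (Fin z)" using V(3) s(2) by blast
    then have "u \<noteq> b" using k by auto
    then show ?thesis using r(2)[OF u(1)] Julia_iter_iff[OF u(2)] by simp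
  qed
  then show "\<exists>R>0. \<forall>z. norm z > R \<longrightarrow> z \<notin> Julia f" using s(1) by (intro exI[of _ "1 / s"]) auto
qed

section \<open>Isolated prepoles of transcendental functions\<close>

lemma transcendental_Infty_notin_Fatou: "transcendental f \<Longrightarrow> Infty \<notin> Fatou f"
  using Fatou_Infty_nontranscendental by blast

text \<open>Otherwise great Picard applies at 0 to \<open>f (inverse w) - a\<close>, which would
  omit 0 and \<open>b - a\<close>. Then it or its reciprocal has a limit, so \<open>f\<close> has a
  limit on the sphere at infinity.\<close>

lemma Picard_at_infinity:
  assumes tr: "transcendental f" and R: "R > 0" and np: "\<And>z. norm z > R \<Longrightarrow> \<not> is_pole f z" and "a \<noteq> b"
  shows "\<exists>z. norm z > R \<and> (f z = a \<or> f z = b)"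
proof (rule ccontr)
  assume "\<not> (\<exists>z. norm z > R \<and> (f z = a \<or> f z = b))"
  then have omit: "f z \<noteq> a" "f z \<noteq> b" if "norm z > R" for z using that by blast+
  define M where "M = ball (0::complex) (1 / R)"
  define g where "g = (\<lambda>w. f (inverse w) - a)"
  have big: "norm (inverse w) > R" if "w \<in> M - {0}" for w
    using norm_inverse_greater[OF R] that by (simp add: M_def)
  have hol: "g holomorphic_on (M - {0})"
  proof (rule holomorphic_onI_analytic_at)
    fix w assume w: "w \<in> M - {0}"
    then have "(\<lambda>w. f (inverse w)) analytic_on {w}"
      by (intro analytic_at_compose_inverse analytic_at_nonpole np big) auto
    then show "g analytic_on {w}" unfolding g_def by (intro analytic_on_diff analytic_on_const)
  qed
  have M: "open M" "0 \<in> M" using R by (auto simp: M_def)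
  have om: "g w \<noteq> 0 \<and> g w \<noteq> b - a" if "w \<in> M - {0}" for w
    using omit[OF big[OF that]] by (auto simp: g_def)
  have inM: "\<forall>\<^sub>F w in at 0. w \<in> M - {0}" using M eventually_at_in_open by blast
  have "0 \<noteq> b - a" using \<open>a \<noteq> b\<close> by simp
  from great_Picard[OF M this hol om] obtain l
    where l: "(g \<longlongrightarrow> l) (at 0) \<or> ((inverse \<circ> g) \<longlongrightarrow> l) (at 0)" by blast
  have "\<exists>L. ((\<lambda>w. Fin (f (inverse w))) \<longlongrightarrow> L) (at 0)"
  proof (cases "\<exists>l. (g \<longlongrightarrow> l) (at 0)")
    case True
    then obtain l where "(g \<longlongrightarrow> l) (at 0)" by blast
    then have "((\<lambda>w. g w + a) \<longlongrightarrow> l + a) (at 0)" by (intro tendsto_intros)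
    then show ?thesis by (auto simp: g_def tendsto_Fin_iff[symmetric])
  next
    case False
    then have l: "((\<lambda>w. inverse (g w)) \<longlongrightarrow> l) (at 0)" using l by (auto simp: o_def)
    \<comment> \<open>A nonzero limit of the reciprocal would give \<open>g\<close> a finite limit,
      which is the case already treated.\<close>
    have "l = 0"
    proof (rule ccontr)
      assume "l \<noteq> 0"
      with l have "((\<lambda>w. inverse (inverse (g w))) \<longlongrightarrow> inverse l) (at 0)" by (rule tendsto_inverse)
      then show False using False by auto
    qed
    moreover have "\<forall>\<^sub>F w in at 0. inverse (g w) \<noteq> 0" using inM by eventually_elim (use om in auto)
    ultimately have "filterlim (\<lambda>w. inverse (g w)) (at 0) (at 0)"
      using l by (simp add: filterlim_at)
    then have "filterlim g at_infinity (at 0)" by (simp only: filterlim_inverse_at_iff)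
    then have "filterlim (\<lambda>w. a + g w) at_infinity (at 0)"
      by (rule tendsto_add_filterlim_at_infinity[OF tendsto_const])
    then have "((\<lambda>w. Fin (f (inverse w))) \<longlongrightarrow> Infty) (at 0)"
      by (simp add: g_def tendsto_Fin_Infty_iff)
    then show ?thesis by blast
  qed
  then obtain L where "((\<lambda>w. Fin (f (inverse w))) \<longlongrightarrow> L) (at 0)" by blast
  then have "((\<lambda>w. to_sphere f (inverse w)) \<longlongrightarrow> L) (at 0)" by (rule Lim_transform_eventually)
       (use inM in eventually_elim, use np big in \<open>auto simp: to_sphere_def\<close>)
  from filterlim_compose[OF this filterlim_inverse_at_0] have "(to_sphere f \<longlongrightarrow> L) at_infinity" by simp
  then show False using tr by (auto simp: transcendental_def)
qed

text \<open>Near infinity \<open>f\<close> takes no values in the Julia set, so by Picard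
  \<open>b\<close> is the only finite Julia point; being a prepole it cannot be fixed, so it is a
  pole. But Picard also supplies a value close to \<open>b\<close>, whose inverse branch extends to
  \<open>b\<close> and yields a finite preimage of \<open>b\<close>. By invariance this is
  \<open>b\<close> itself, a pole.\<close>

lemma transcendental_no_isolated:
  assumes tr: "transcendental f"
    and eps: "\<epsilon> > 0" "\<And>y a. Fin y \<in> post_singular f \<Longrightarrow> a \<in> Julia f \<Longrightarrow> dist y a \<ge> \<epsilon>"
    and b: "b \<in> Julia f" "Fin b \<in> Julia_infty f"
    and R: "R > 0" "\<And>z. norm z > R \<Longrightarrow> z \<notin> Julia f"
  shows False
proof -
  have far: "Fin z \<in> Fatou f" if "norm z > R" for z using R(2)[OF that] by (simp add: Julia_def)
  have img: "to_sphere f z \<in> Fatou f" if "norm z > R" for z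
    by (rule Fatou_forward[OF sphere_map_Fin far[OF that]])
  have np: "\<not> is_pole f z" if "norm z > R" for z
    using img[OF that] transcendental_Infty_notin_Fatou[OF tr] by (auto simp: to_sphere_def split: if_splits)
  have fJ: "f z \<notin> Julia f" if "norm z > R" for z
    using img[OF that] np[OF that] by (simp add: to_sphere_def Julia_def)
  have only: "a = b" if "a \<in> Julia f" for a
  proof (rule ccontr)
    assume "a \<noteq> b"
    then have "\<exists>z. norm z > R \<and> (f z = a \<or> f z = b)" by (intro Picard_at_infinity[OF tr R(1)] np)
    then show False using fJ that b(1) by blast
  qed
  have pole: "is_pole f b"
  proof (rule ccontr)
    assume np: "\<not> is_pole f b"
    then have s: "iter f 1 (Fin b) = Some (Fin (f b))" by (simp add: to_sphere_def)
    then have "f b = b" using only Julia_iter_iff[OF s] b(1) by blast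
    then have fix': "sphere_map f (Fin b) = Some (Fin b)" using np by (simp add: to_sphere_def)
    have "iter f n (Fin b) = Some (Fin b)" for n
      by (induction n) (simp_all add: map_comp_def fix' del: sphere_map_Fin)
    then show False using b(2) by (auto simp: Julia_infty_def preimage_iff)
  qed
  \<comment> \<open>Picard hits one of two candidates at distance \<open>\<epsilon> / 4\<close> from
    \<open>b\<close>. The disk of radius \<open>\<epsilon> / 2\<close> about either contains
    \<open>b\<close> and is off the post-singular set.\<close>
  have "\<exists>z0. norm z0 > R \<and> (f z0 = b + complex_of_real (\<epsilon> / 4) \<or> f z0 = b - complex_of_real (\<epsilon> / 4))"
  proof (intro Picard_at_infinity[OF tr R(1)] np)
    show "b + complex_of_real (\<epsilon> / 4) \<noteq> b - complex_of_real (\<epsilon> / 4)"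
      using eps(1) by (simp add: eq_neg_iff_add_eq_0 flip: of_real_add)
  qed
  then obtain z0 where z0: "norm z0 > R"
      "f z0 = b + complex_of_real (\<epsilon> / 4) \<or> f z0 = b - complex_of_real (\<epsilon> / 4)"
    by blast
  have d: "dist b (f z0) < \<epsilon> / 2" using z0(2) eps(1) by (auto simp: dist_norm)
  have "\<exists>g. g holomorphic_on ball (f z0) (\<epsilon> / 2) \<and> g (f z0) = z0 \<and>
    (\<forall>w\<in>ball (f z0) (\<epsilon> / 2). iter f 1 (Fin (g w)) = Some (Fin w))"
  proof (rule no_return_inverse_branch)
    show no_return using tr by (simp add: no_return_def)
    show "Fin w \<notin> post_singular f" if "w \<in> ball (f z0) (\<epsilon> / 2)" for w
      using eps(2)[of w b] b(1) that d dist_triangle[of w b "f z0"] by (auto simp: dist_commute)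
    show "iter f 1 (Fin z0) = Some (Fin (f z0))" using np[OF z0(1)] by (simp add: to_sphere_def)
  qed (use eps in auto)
  then obtain g where "\<forall>w\<in>ball (f z0) (\<epsilon> / 2). iter f 1 (Fin (g w)) = Some (Fin w)" by blast
  then have g: "iter f 1 (Fin (g b)) = Some (Fin b)"
    using d by (simp add: dist_commute del: sphere_map_Fin iter_1)
  then have "g b = b" using only Julia_iter_iff[OF g] b(1) by blast
  then show False using g pole by (simp add: to_sphere_def)
qed

end

section \<open>Isolated points for rational functions\<close>

lemma continuous_on_fin: "continuous_on (range Fin) fin"
  unfolding continuous_on_def
proof
  fix x assume "x \<in> range Fin"
  then obtain z where z: "x = Fin z" by blast
  have "((\<lambda>u. u) \<longlongrightarrow> Fin z) (at x within range Fin)" using tendsto_ident_at z by metis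
  moreover have "\<forall>\<^sub>F u in at x within range Fin. u = Fin (fin u)"
    unfolding eventually_at_filter by (rule always_eventually) auto
  ultimately have "((\<lambda>u. Fin (fin u)) \<longlongrightarrow> Fin z) (at x within range Fin)"
    by (rule Lim_transform_eventually)
  then show "(fin \<longlongrightarrow> fin x) (at x within range Fin)" by (simp add: z tendsto_Fin_iff)
qed

text \<open>Montel's theorem in the coordinate at infinity. The map \<open>T\<close> is the chart in
  which the members of the family are bounded; it is uniformly continuous on the closed disk of
  radius \<open>B\<close>, so convergence passes through it.\<close>

lemma normal_family_at_Infty:
  assumes T: "continuous_on UNIV (T :: complex \<Rightarrow> rsphere)" and "s > 0"
    and G: "\<And>g. g \<in> \<G> \<Longrightarrow> \<exists>\<Phi>. \<Phi> holomorphic_on ball 0 s \<and> (\<forall>w\<in>ball 0 s. norm (\<Phi> w) \<le> B) \<and>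
        (\<forall>w\<in>ball 0 s. g (chart Infty w) = T (\<Phi> w))"
  shows "normal_family (chart Infty ` ball 0 s) \<G>"
proof (rule normal_familyI)
  fix g :: "nat \<Rightarrow> rsphere \<Rightarrow> rsphere" assume g: "range g \<subseteq> \<G>"
  have "\<forall>k. \<exists>\<Phi>. \<Phi> holomorphic_on ball 0 s \<and> (\<forall>w\<in>ball 0 s. norm (\<Phi> w) \<le> B) \<and>
        (\<forall>w\<in>ball 0 s. g k (chart Infty w) = T (\<Phi> w))"
    using g G by blast
  then obtain \<Phi> where \<Phi>: "\<forall>k. \<Phi> k holomorphic_on ball 0 s \<and> (\<forall>w\<in>ball 0 s. norm (\<Phi> k w) \<le> B) \<and>
        (\<forall>w\<in>ball 0 s. g k (chart Infty w) = T (\<Phi> k w))"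
    by metis
  define H where "H = {h. h holomorphic_on ball 0 s \<and> (\<forall>w\<in>ball 0 s. norm (h w) \<le> B)}"
  have hH: "h holomorphic_on ball 0 s" if "h \<in> H" for h using that by (simp add: H_def)
  have bH: "\<exists>B. \<forall>h\<in>H. \<forall>z\<in>K. norm (h z) \<le> B" if "compact K" "K \<subseteq> ball 0 s" for K
    using that(2) by (intro exI[of _ B]) (auto simp: H_def)
  have rH: "range \<Phi> \<subseteq> H" using \<Phi> by (auto simp: H_def)
  obtain G r where r: "strict_mono (r :: nat \<Rightarrow> nat)"
      "\<And>x. x \<in> ball 0 s \<Longrightarrow> (\<lambda>n. \<Phi> (r n) x) \<longlonglongrightarrow> G x"
      "\<And>K. compact K \<Longrightarrow> K \<subseteq> ball 0 s \<Longrightarrow> uniform_limit K (\<Phi> \<circ> r) G sequentially"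
    using Montel[OF open_ball hH bH rH] by metis
  define \<sigma> where "\<sigma> = (\<lambda>x. fin (sinv x))"
  have \<sigma>: "\<sigma> (chart Infty w) = w" for w by (simp add: \<sigma>_def)
  have T_unif: "uniformly_continuous_on (cball 0 B) T"
    by (rule compact_uniformly_continuous[OF continuous_on_subset[OF T]]) auto
  have GB: "G x \<in> cball 0 B" if "x \<in> ball 0 s" for x
  proof -
    have "\<Phi> (r n) x \<in> cball 0 B" for n using \<Phi> that by simp
    then show ?thesis by (rule closed_sequentially[OF closed_cball _ r(2)[OF that]])
  qed
  have "uniform_limit K (g \<circ> r) (\<lambda>x. T (G (\<sigma> x))) sequentially"
    if K: "compact K" "K \<subseteq> chart Infty ` ball 0 s" for K
    unfolding uniform_limit_iff
  proof (intro allI impI)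
    have "continuous_on K \<sigma>" unfolding \<sigma>_def
      by (rule continuous_on_compose2[OF continuous_on_fin continuous_on_sinv[OF continuous_on_id]])
         (use K(2) in auto)
    then have "compact (\<sigma> ` K)" using K(1) by (rule compact_continuous_image)
    moreover have sub: "\<sigma> ` K \<subseteq> ball 0 s" using K(2) \<sigma> by fastforce
    ultimately have lim: "uniform_limit (\<sigma> ` K) (\<Phi> \<circ> r) G sequentially" by (rule r(3))
    fix e :: real assume "e > 0"
    then obtain d where d: "d > 0" "\<And>x x'. x \<in> cball 0 B \<Longrightarrow> x' \<in> cball 0 B \<Longrightarrow> dist x' x < d \<Longrightarrow> dist (T x') (T x) < e"
      using T_unif unfolding uniformly_continuous_on_def by metis
    have "\<forall>\<^sub>F n in sequentially. \<forall>x\<in>\<sigma> ` K. dist ((\<Phi> \<circ> r) n x) (G x) < d"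
      using lim d(1) unfolding uniform_limit_iff by blast
    then show "\<forall>\<^sub>F n in sequentially. \<forall>x\<in>K. dist ((g \<circ> r) n x) (T (G (\<sigma> x))) < e"
    proof eventually_elim
      case (elim n)
      show ?case
      proof
        fix x assume x: "x \<in> K"
        then obtain w where w: "w \<in> ball 0 s" "x = chart Infty w" using K(2) by blast
        have "dist (\<Phi> (r n) w) (G w) < d" using elim x \<sigma>[of w] w(2) by force
        then have "dist (T (\<Phi> (r n) w)) (T (G w)) < e"
          using \<Phi> w(1) GB[OF w(1)] by (intro d(2)) auto
        then show "dist ((g \<circ> r) n x) (T (G (\<sigma> x))) < e" using \<Phi> w \<sigma> by simp
      qed
    qed
  qed
  then show "\<exists>h r. strict_mono (r :: nat \<Rightarrow> nat) \<and>
      (\<forall>K. compact K \<longrightarrow> K \<subseteq> chart Infty ` ball 0 s \<longrightarrow> uniform_limit K (g \<circ> r) h sequentially)"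
    using r(1) by blast
qed

text \<open>The inverse of the coordinate \<open>1 / (u - e)\<close>, extended to infinity. In that
  coordinate a map omitting \<open>e\<close> is finite everywhere, even where its value is
  infinity.\<close>

definition recip_chart :: "complex \<Rightarrow> complex \<Rightarrow> rsphere" where
  "recip_chart e s = (if s = 0 then Infty else Fin (e + inverse s))"

lemma continuous_on_recip_chart: "continuous_on UNIV (recip_chart e)"
  unfolding continuous_on_def
proof
  fix x :: complex
  show "(recip_chart e \<longlongrightarrow> recip_chart e x) (at x)"
  proof (cases "x = 0")
    case True
    have "filterlim (\<lambda>s. e + inverse s) at_infinity (at (0::complex))"
      by (rule tendsto_add_filterlim_at_infinity[OF tendsto_const filterlim_inverse_at_infinity])
    then have "((\<lambda>s. Fin (e + inverse s)) \<longlongrightarrow> Infty) (at 0)" by (simp add: tendsto_Fin_Infty_iff)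
    then have "(recip_chart e \<longlongrightarrow> Infty) (at 0)"
      by (rule Lim_transform_eventually) (auto simp: recip_chart_def eventually_at_filter)
    then show ?thesis using True by (simp add: recip_chart_def)
  next
    case False
    then have "((\<lambda>s. Fin (e + inverse s)) \<longlongrightarrow> Fin (e + inverse x)) (at x)"
      unfolding tendsto_Fin_iff by (intro tendsto_intros)
    moreover have "\<forall>\<^sub>F s in at x. Fin (e + inverse s) = recip_chart e s"
      unfolding eventually_at_filter using t1_space_nhds[OF False]
      by eventually_elim (simp add: recip_chart_def)
    ultimately have "(recip_chart e \<longlongrightarrow> Fin (e + inverse x)) (at x)"
      by (rule Lim_transform_eventually)
    then show ?thesis using False by (simp add: recip_chart_def)
  qed
qed

context meromorphic_dynamics
begin

lemma iter_near_Infty: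
  assumes k: "\<And>w. w \<in> ball 0 s - {0} \<Longrightarrow> iter f n (Fin (inverse w)) = Some (Fin (k w))"
  shows "w \<in> ball 0 s - {0} \<Longrightarrow> k analytic_on {w}"
    and "s > 0 \<Longrightarrow> iter f n Infty = Some y \<Longrightarrow> ((\<lambda>w. Fin (k w)) \<longlongrightarrow> y) (at 0)"
proof -
  show "k analytic_on {w}" if w: "w \<in> ball 0 s - {0}"
  proof -
    have "(\<lambda>w. plane_iter f n (inverse w)) analytic_on {w}"
      using plane_iter_analytic[OF k[OF w]] w by (intro analytic_at_compose_inverse) auto
    moreover have "open (ball (0::complex) s - {0})" by auto
    then have "\<forall>\<^sub>F v in nhds w. v \<in> ball 0 s - {0}" using w by (rule eventually_nhds_in_open)
    then have "\<forall>\<^sub>F v in nhds w. plane_iter f n (inverse v) = k v"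
      by eventually_elim (simp add: plane_iter_eq[OF k])
    from analytic_at_cong[OF this refl] have "(\<lambda>w. plane_iter f n (inverse w)) analytic_on {w} \<longleftrightarrow> k analytic_on {w}" .
    ultimately show ?thesis by blast
  qed
  assume s: "s > 0" and y: "iter f n Infty = Some y"
  have "((\<lambda>w. Fin (inverse w)) \<longlongrightarrow> Infty) (at (0::complex))"
    unfolding tendsto_Fin_Infty_iff by (rule filterlim_inverse_at_infinity)
  from tendsto_iter[OF y this]
  have "((\<lambda>w. the (iter f n (Fin (inverse w)))) \<longlongrightarrow> y) (at 0)" .
  moreover have "\<forall>\<^sub>F w in at 0. w \<in> ball 0 s - {0}" using s by (intro eventually_at_in_open) auto
  then have "\<forall>\<^sub>F w in at 0. the (iter f n (Fin (inverse w))) = Fin (k w)"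
    by eventually_elim (simp add: k)
  ultimately show "((\<lambda>w. Fin (k w)) \<longlongrightarrow> y) (at 0)" by (rule Lim_transform_eventually)
qed

text \<open>For an iterate that fixes infinity and omits \<open>e\<close> elsewhere near it,
  \<open>1 / (k - e)\<close> has no poles and extends by 0 to the centre.\<close>

lemma recip_near_Infty:
  assumes k: "\<And>w. w \<in> ball 0 s - {0} \<Longrightarrow> iter f n (Fin (inverse w)) = Some (Fin (k w)) \<and> k w \<noteq> e"
    and "s > 0" "iter f n Infty = Some Infty"
  defines "\<Phi> \<equiv> (\<lambda>w. if w = 0 then 0 else inverse (k w - e))"
  shows "\<Phi> holomorphic_on ball 0 s"
    and "w \<in> ball 0 s \<Longrightarrow> the (iter f n (chart Infty w)) = recip_chart e (\<Phi> w)"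
proof -
  have k1: "iter f n (Fin (inverse w)) = Some (Fin (k w))" if "w \<in> ball 0 s - {0}" for w using k that by blast
  have "filterlim k at_infinity (at 0)"
    using iter_near_Infty(2)[OF k1 assms(2,3)] by (simp add: tendsto_Fin_Infty_iff)
  then have "filterlim (\<lambda>w. - e + k w) at_infinity (at 0)"
    by (rule tendsto_add_filterlim_at_infinity[OF tendsto_const])
  then have "filterlim (\<lambda>w. inverse (k w - e)) (at 0) (at 0)" by (simp add: filterlim_inverse_at_iff)
  then have "((\<lambda>w. inverse (k w - e)) \<longlongrightarrow> 0) (at 0)" by (simp add: filterlim_at)
  moreover have "(\<lambda>w. inverse (k w - e)) analytic_on {w}" if "w \<in> ball 0 s - {0}" for w
    using iter_near_Infty(1)[OF k1 that] k[OF that] by (intro analytic_intros) auto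
  ultimately show "\<Phi> holomorphic_on ball 0 s" unfolding \<Phi>_def by (intro holomorphic_extend_limit)
  show "the (iter f n (chart Infty w)) = recip_chart e (\<Phi> w)" if "w \<in> ball 0 s"
    using that k[of w] assms(3) by (auto simp: \<Phi>_def recip_chart_def sinv_def inverse_eq_divide[symmetric])
qed

lemma Fatou_InftyI:
  assumes "\<not> transcendental f" "s > 0"
    and "normal_family (chart Infty ` ball 0 s) (range (\<lambda>n x. the (iter f n x)))"
  shows "Infty \<in> Fatou f"
proof -
  have "open (chart Infty ` ball 0 s)" by (intro open_chart_image) auto
  moreover have "Infty \<in> chart Infty ` ball 0 s" using assms(2) by (auto simp: image_iff intro!: bexI[of _ 0])
  moreover have "chart Infty ` ball 0 s \<subseteq> dom (iter f n)" for n
    using nontranscendental_dom[OF assms(1)] by blast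
  ultimately show ?thesis using assms(3) unfolding Fatou_def by blast
qed

text \<open>
  If infinity were an isolated point of the Julia set, the iterates near infinity would omit all but
  at most one point of the Julia set, so Schottky's theorem would make infinity a normal point.
\<close>

lemma rational_no_isolated:
  assumes nt: "\<not> transcendental f" and inf: "infinite (Julia f)"
    and R: "R > 0" "\<And>z. norm z > R \<Longrightarrow> z \<notin> Julia f"
  shows "Infty \<in> Fatou f"
proof (rule ccontr)
  assume nF: "Infty \<notin> Fatou f"
  \<comment> \<open>Three points, because an iterate may take one Julia value at infinity itself;
    two omitted values remain for Schottky's theorem.\<close>
  obtain E where E: "E \<subseteq> Julia f" "card E = 3" using infinite_arbitrarily_large[OF inf] by metis
  then obtain e1 e2 e3 where e: "e1 \<noteq> e2" "e1 \<noteq> e3" "e2 \<noteq> e3" "e1 \<in> Julia f" "e2 \<in> Julia f" "e3 \<in> Julia f"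
    by (auto simp: card_3_iff)
  define s where "s = 1 / R"
  have s: "s > 0" using R(1) by (simp add: s_def)
  define k where "k = (\<lambda>n w. plane_iter f n (inverse w))"
  have k: "iter f n (Fin (inverse w)) = Some (Fin (k n w)) \<and> k n w \<notin> Julia f"
    if w: "w \<in> ball 0 s - {0}" for n w
  proof -
    have "norm (inverse w) > R" using norm_inverse_greater[OF R(1)] w by (simp add: s_def)
    then have F: "Fin (inverse w) \<in> Fatou f" using R(2) by (simp add: Julia_def)
    obtain y where y: "iter f n (Fin (inverse w)) = Some y" using nontranscendental_dom[OF nt] by blast
    then have "y \<in> Fatou f" using Fatou_iter_iff F by blast
    then show ?thesis using y nF by (cases y) (auto simp: k_def plane_iter_def Julia_def)
  qed
  have k1: "\<And>w. w \<in> ball 0 s - {0} \<Longrightarrow> iter f n (Fin (inverse w)) = Some (Fin (k n w))" for n using k by blast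
  \<comment> \<open>Iterates fixing infinity are bounded in the reciprocal coordinate, where they
    vanish at the centre. The others send infinity to a finite Julia point, of norm at most
    \<open>R\<close>, and are bounded in the plane.\<close>
  define A where "A = {n. iter f n Infty = Some Infty}"
  define B0 where "B0 = omit_bound (inverse (e2 - e1)) (inverse (e3 - e1)) 0"
  have "normal_family (chart Infty ` ball 0 (s / 2)) ((\<lambda>n x. the (iter f n x)) ` A)"
  proof (rule normal_family_at_Infty[OF continuous_on_recip_chart[of e1], of "s / 2" _ B0])
    fix g assume "g \<in> (\<lambda>n x. the (iter f n x)) ` A"
    then obtain n where n: "iter f n Infty = Some Infty" "g = (\<lambda>x. the (iter f n x))" by (auto simp: A_def)
    define \<Phi> where "\<Phi> = (\<lambda>w. if w = 0 then 0 else inverse (k n w - e1))"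
    have kn: "iter f n (Fin (inverse w)) = Some (Fin (k n w)) \<and> k n w \<noteq> e1" if "w \<in> ball 0 s - {0}" for w
      using k[OF that] e(4) by blast
    have hol: "\<Phi> holomorphic_on ball 0 s"
      unfolding \<Phi>_def by (rule recip_near_Infty(1)[OF kn s n(1)])
    have rep: "the (iter f n (chart Infty w)) = recip_chart e1 (\<Phi> w)" if "w \<in> ball 0 s" for w
      unfolding \<Phi>_def by (rule recip_near_Infty(2)[OF kn s n(1) that])
    have omit: "\<Phi> w \<noteq> inverse (e2 - e1) \<and> \<Phi> w \<noteq> inverse (e3 - e1)" if "w \<in> ball 0 s" for w
    proof (cases "w = 0")
      case False
      then have "k n w \<notin> Julia f" using k that by blast
      then have "k n w \<noteq> e2" "k n w \<noteq> e3" using e by auto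
      then show ?thesis using False by (simp add: \<Phi>_def)
    qed (use e in \<open>simp add: \<Phi>_def\<close>)
    have "norm (\<Phi> w) \<le> B0" if "w \<in> ball 0 (s / 2)" for w
      unfolding B0_def
      by (rule omit_two_values_bound[OF hol s _ omit]) (use e that in \<open>auto simp: \<Phi>_def\<close>)
    then show "\<exists>\<Phi>. \<Phi> holomorphic_on ball 0 (s / 2) \<and> (\<forall>w\<in>ball 0 (s / 2). norm (\<Phi> w) \<le> B0) \<and>
        (\<forall>w\<in>ball 0 (s / 2). g (chart Infty w) = recip_chart e1 (\<Phi> w))"
      using rep n(2) s by (intro exI[of _ \<Phi>] conjI holomorphic_on_subset[OF hol]) auto
  qed (use s in auto)
  moreover
  \<comment> \<open>Covers whichever pair of the three points avoids the value \<open>v\<close> at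
    infinity.\<close>
  define B1 where "B1 = max (omit_bound e1 e2 R) (max (omit_bound e1 e3 R) (omit_bound e2 e3 R))"
  have "normal_family (chart Infty ` ball 0 (s / 2)) ((\<lambda>n x. the (iter f n x)) ` (- A))"
  proof (rule normal_family_at_Infty[of Fin, of "s / 2" _ B1])
    show "continuous_on UNIV Fin" using continuous_on_Fin[OF continuous_on_id] by simp
    fix g assume "g \<in> (\<lambda>n x. the (iter f n x)) ` (- A)"
    then obtain n where n: "iter f n Infty \<noteq> Some Infty" "g = (\<lambda>x. the (iter f n x))" by (auto simp: A_def)
    obtain y where y: "iter f n Infty = Some y" using nontranscendental_dom[OF nt] by blast
    then obtain v where v: "iter f n Infty = Some (Fin v)" using n(1) by (cases y) auto
    have "v \<in> Julia f" using Fatou_iter_iff[OF v] nF by (simp add: Julia_def)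
    then have vR: "norm v \<le> R" using R(2) by (meson not_less)
    define \<Phi> where "\<Phi> = (\<lambda>w. if w = 0 then v else k n w)"
    have "(k n \<longlongrightarrow> v) (at 0)" using iter_near_Infty(2)[OF k1 s v] by (simp add: tendsto_Fin_iff)
    then have hol: "\<Phi> holomorphic_on ball 0 s"
      unfolding \<Phi>_def by (intro holomorphic_extend_limit iter_near_Infty(1)[OF k1])
    have omit: "\<Phi> w \<noteq> e" if "w \<in> ball 0 s" "e \<in> Julia f" "e \<noteq> v" for w e
      using k[of w n] that by (auto simp: \<Phi>_def)
    have bd: "norm (\<Phi> w) \<le> omit_bound a b R"
      if "w \<in> ball 0 (s / 2)" "a \<in> Julia f" "b \<in> Julia f" "a \<noteq> v" "b \<noteq> v" "a \<noteq> b" for w a b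
    proof (rule omit_two_values_bound[OF hol s that(6)])
      show "\<Phi> z \<noteq> a \<and> \<Phi> z \<noteq> b" if "z \<in> ball 0 s" for z using omit \<open>a \<in> Julia f\<close> \<open>b \<in> Julia f\<close> \<open>a \<noteq> v\<close> \<open>b \<noteq> v\<close> that by blast
    qed (use that(1) vR in \<open>auto simp: \<Phi>_def\<close>)
    have "norm (\<Phi> w) \<le> B1" if w: "w \<in> ball 0 (s / 2)" for w
    proof -
      consider "e1 \<noteq> v" "e2 \<noteq> v" | "e1 \<noteq> v" "e3 \<noteq> v" | "e2 \<noteq> v" "e3 \<noteq> v" using e by blast
      then show ?thesis
      proof cases
        case 1 then show ?thesis using bd[OF w e(4,5) 1 e(1)] by (simp add: B1_def)
      next
        case 2 then show ?thesis using bd[OF w e(4,6) 2 e(2)] by (simp add: B1_def)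
      next
        case 3 then show ?thesis using bd[OF w e(5,6) 3 e(3)] by (simp add: B1_def)
      qed
    qed
    moreover have "g (chart Infty w) = Fin (\<Phi> w)" if "w \<in> ball 0 (s / 2)" for w
      using that s k1[of w n] v by (auto simp: n(2) \<Phi>_def sinv_def inverse_eq_divide[symmetric])
    ultimately show "\<exists>\<Phi>. \<Phi> holomorphic_on ball 0 (s / 2) \<and> (\<forall>w\<in>ball 0 (s / 2). norm (\<Phi> w) \<le> B1) \<and>
        (\<forall>w\<in>ball 0 (s / 2). g (chart Infty w) = Fin (\<Phi> w))"
      using s by (intro exI[of _ \<Phi>] conjI holomorphic_on_subset[OF hol]) auto
  qed (use s in auto)
  ultimately have "normal_family (chart Infty ` ball 0 (s / 2))
      ((\<lambda>n x. the (iter f n x)) ` A \<union> (\<lambda>n x. the (iter f n x)) ` (- A))"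
    by (rule normal_family_Un)
  then have "normal_family (chart Infty ` ball 0 (s / 2)) (range (\<lambda>n x. the (iter f n x)))"
    by (simp add: image_Un[symmetric])
  then show False using Fatou_InftyI[OF nt, of "s / 2"] s nF by simp
qed

end

section \<open>The equivalence\<close>

lemma poly_analytic_on: "poly (p :: complex poly) analytic_on A"
proof -
  have "poly p holomorphic_on UNIV"
    unfolding holomorphic_on_def field_differentiable_def using poly_DERIV by fastforce
  then show ?thesis by (simp add: analytic_on_open[symmetric] analytic_on_subset[of _ UNIV])
qed

context meromorphic_dynamics
begin

section \<open>Rational functions of degree at least two\<close>

context
  fixes p q :: "complex poly" and d :: nat
  assumes q: "q \<noteq> 0" and cop: "coprime p q" and deg: "max (degree p) (degree q) = d" "d \<ge> 2"
    and f: "f = (\<lambda>z. poly p z / poly q z)"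
begin

lemma rational_not_pole: "poly q z \<noteq> 0 \<Longrightarrow> \<not> is_pole f z"
proof -
  assume "poly q z \<noteq> 0"
  then have "f analytic_on {z}" unfolding f by (intro analytic_on_divide poly_analytic_on) auto
  then show ?thesis by (rule analytic_at_imp_no_pole)
qed

lemma eventually_denominator_nonzero: "\<forall>\<^sub>F z in at_infinity. poly q z \<noteq> 0"
proof (cases "degree q = 0")
  case True
  then obtain c where "q = [:c:]" by (rule degree_eq_zeroE)
  then show ?thesis using q by simp
next
  case False
  then have "filterlim (poly q) at_infinity at_infinity" by (intro filterlim_poly_at_infinity) simp
  then show ?thesis by (rule filterlim_at_infinity_imp_eventually_ne)
qed

text \<open>Without poles \<open>f\<close> is a polynomial of degree at least two, so
  \<open>norm (f z) \<ge> norm z\<close> near infinity. Orbits starting there stay outside a fixed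
  disk, and the reciprocals of the iterates are bounded.\<close>

lemma rational_no_poles_imp_Infty_Fatou:
  assumes "\<And>z. \<not> is_pole f z"
  shows "Infty \<in> Fatou f"
proof -
  have "poly q z \<noteq> 0" for z
  proof
    assume qz: "poly q z = 0"
    then have pz: "poly p z \<noteq> 0" using coprime_poly_0[OF cop, of z] by blast
    have "\<forall>\<^sub>F w in at z. poly q w \<noteq> 0"
      using islimpt_finite[OF poly_roots_finite[OF q], of z] by (simp add: islimpt_iff_eventually)
    moreover have "isCont (poly q) z" "isCont (poly p) z" by simp_all
    then have "(poly q \<longlongrightarrow> 0) (at z)" "(poly p \<longlongrightarrow> poly p z) (at z)"
      using qz by (simp_all add: isCont_def)
    ultimately have "filterlim (\<lambda>w. poly p w / poly q w) at_infinity (at z)"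
      using pz by (intro filterlim_divide_at_infinity[of _ "poly p z"]) (auto simp: filterlim_at)
    then have "is_pole f z" by (simp add: f is_pole_def)
    then show False using assms by blast
  qed
  then have "degree q = 0"
    using fundamental_theorem_of_algebra[of q] constant_degree[of q] by blast
  then obtain c where c: "q = [:c:]" by (rule degree_eq_zeroE)
  then have c0: "c \<noteq> 0" using q by simp
  have dp: "degree p \<ge> 2" using deg c by simp
  have fz: "f z = poly p z / c" for z by (simp add: f c)
  have "filterlim (poly p) at_infinity at_infinity" using dp by (intro filterlim_poly_at_infinity) simp
  then have "filterlim (\<lambda>z. inverse c * poly p z) at_infinity at_infinity"
    using c0 by (intro tendsto_mult_filterlim_at_infinity[OF tendsto_const]) auto
  then have inf: "filterlim f at_infinity at_infinity" by (simp add: f c field_simps)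
  \<comment> \<open>This quotient is \<open>z / f z\<close>; it tends to 0 as the degree of
    \<open>p\<close> is at least two.\<close>
  have "((\<lambda>z. poly [:0, c:] z / poly p z) \<longlongrightarrow> 0) at_infinity"
    using dp c0 by (intro poly_divide_tendsto_0_at_infinity) simp
  then have "\<forall>\<^sub>F z in at_infinity. norm (poly [:0, c:] z / poly p z) < 1"
    using order_tendstoD(2)[OF tendsto_norm_zero] by fastforce
  moreover have "\<forall>\<^sub>F z in at_infinity. f z \<noteq> 0"
    using inf by (rule filterlim_at_infinity_imp_eventually_ne)
  ultimately have "\<forall>\<^sub>F z in at_infinity. norm (f z) \<ge> norm z"
  proof eventually_elim
    case (elim z)
    then have "poly p z \<noteq> 0" by (simp add: fz)
    then have "norm z * norm c < norm (poly p z)"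
      using elim(1) by (simp add: norm_divide norm_mult field_simps)
    then show ?case using c0 by (simp add: fz norm_divide pos_le_divide_eq)
  qed
  then obtain R0 where R0: "\<And>z. norm z \<ge> R0 \<Longrightarrow> norm (f z) \<ge> norm z"
    by (auto simp: eventually_at_infinity)
  define R where "R = max 1 R0"
  have R: "R > 0" "\<And>z. norm z \<ge> R \<Longrightarrow> norm (f z) \<ge> norm z" using R0 by (auto simp: R_def)
  have map: "sphere_map f (Fin z) = Some (Fin (f z))" for z using assms by (simp add: to_sphere_def)
  have "((\<lambda>z. Fin (f z)) \<longlongrightarrow> Infty) at_infinity" using inf by (simp only: tendsto_Fin_Infty_iff)
  then have lim: "(to_sphere f \<longlongrightarrow> Infty) at_infinity"
    using assms by (simp add: to_sphere_def[abs_def])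
  then have nt: "\<not> transcendental f" by (auto simp: transcendental_def)
  have mapI: "sphere_map f Infty = Some Infty"
    using tendsto_Lim[OF trivial_limit_at_infinity lim] nt by (simp add: sphere_map_def)
  have iterI: "iter f n Infty = Some Infty" for n
    by (induction n) (simp_all add: map_comp_def mapI)
  have it: "\<exists>u. iter f n (Fin z) = Some (Fin u) \<and> norm u \<ge> R" if "norm z \<ge> R" for n z
  proof (induction n)
    case (Suc n)
    then obtain u where "iter f n (Fin z) = Some (Fin u)" "norm u \<ge> R" by blast
    then show ?case using R(2)[of u] map by (auto simp: map_comp_def)
  qed (use that in auto)
  define s where "s = 1 / R"
  have s: "s > 0" using R(1) by (simp add: s_def)
  define k where "k = (\<lambda>n w. plane_iter f n (inverse w))"
  have k: "iter f n (Fin (inverse w)) = Some (Fin (k n w)) \<and> norm (k n w) \<ge> R"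
    if w: "w \<in> ball 0 s - {0}" for n w
  proof -
    have "norm (inverse w) \<ge> R" using norm_inverse_greater[OF R(1)] w by (simp add: s_def less_imp_le)
    then show ?thesis using it[of "inverse w" n] by (auto simp: k_def plane_iter_def)
  qed
  have "normal_family (chart Infty ` ball 0 s) (range (\<lambda>n x. the (iter f n x)))"
  proof (rule normal_family_at_Infty[OF continuous_on_recip_chart[of 0] s, of _ s])
    fix g assume "g \<in> range (\<lambda>n x. the (iter f n x))"
    then obtain n where n: "g = (\<lambda>x. the (iter f n x))" by blast
    define \<Phi> where "\<Phi> = (\<lambda>w. if w = 0 then 0 else inverse (k n w - 0))"
    have kn: "iter f n (Fin (inverse w)) = Some (Fin (k n w)) \<and> k n w \<noteq> 0" if "w \<in> ball 0 s - {0}" for w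
      using k[OF that, of n] R(1) by auto
    have hol: "\<Phi> holomorphic_on ball 0 s"
      unfolding \<Phi>_def by (rule recip_near_Infty(1)[OF kn s iterI])
    have rep: "the (iter f n (chart Infty w)) = recip_chart 0 (\<Phi> w)" if "w \<in> ball 0 s" for w
      unfolding \<Phi>_def by (rule recip_near_Infty(2)[OF kn s iterI that])
    have "norm (\<Phi> w) \<le> s" if w: "w \<in> ball 0 s" for w
    proof (cases "w = 0")
      case False
      then have "norm (k n w) \<ge> R" using k w by blast
      then show ?thesis using False R(1) by (simp add: \<Phi>_def s_def norm_inverse inverse_eq_divide frac_le norm_divide)
    qed (use s in \<open>simp add: \<Phi>_def\<close>)
    then show "\<exists>\<Phi>. \<Phi> holomorphic_on ball 0 s \<and> (\<forall>w\<in>ball 0 s. norm (\<Phi> w) \<le> s) \<and>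
        (\<forall>w\<in>ball 0 s. g (chart Infty w) = recip_chart 0 (\<Phi> w))"
      using hol rep n by blast
  qed
  then show ?thesis by (rule Fatou_InftyI[OF nt s])
qed

text \<open>Finite preimages of \<open>a\<close> are the roots of \<open>P = p - a q\<close>, and
  these are simple since \<open>a\<close> is not critical. With fewer than two roots
  \<open>P\<close> has degree at most 1 and \<open>q\<close> at least 2, so infinity is a preimage;
  if there were no root at all, infinity would be a critical point over \<open>a\<close>.\<close>

lemma rational_two_preimages:
  assumes a: "a \<notin> finite_critical_values f"
  obtains x1 x2 where "x1 \<noteq> x2" "sphere_map f x1 = Some (Fin a)" "sphere_map f x2 = Some (Fin a)"
proof -
  define P where "P = p - smult a q"
  have root: "poly q z \<noteq> 0 \<and> sphere_map f (Fin z) = Some (Fin a)" if "poly P z = 0" for z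
  proof -
    have pz: "poly p z = a * poly q z" using that by (simp add: P_def)
    then have "poly q z \<noteq> 0" using coprime_poly_0[OF cop, of z] by auto
    moreover from this have "\<not> is_pole f z" by (rule rational_not_pole)
    ultimately show ?thesis using pz by (simp add: to_sphere_def f)
  qed
  have f_eq: "f z = a + poly P z / poly q z" if "poly q z \<noteq> 0" for z
    using that by (simp add: f P_def field_simps)
  show thesis
  proof (cases "\<exists>z1 z2. z1 \<noteq> z2 \<and> poly P z1 = 0 \<and> poly P z2 = 0")
    case True
    then show thesis using that root by (metis rsphere.inject)
  next
    case one: False
    have P0: "P \<noteq> 0"
    proof
      assume "P = 0"
      then have "poly P 0 = 0" "poly P 1 = 0" by simp_all
      then show False using one zero_neq_one by metis
    qed
    have dP: "degree P \<le> 1"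
    proof (cases "\<exists>z. poly P z = 0")
      case False
      then have "degree P = 0"
        using fundamental_theorem_of_algebra[of P] constant_degree[of P] by blast
      then show ?thesis by simp
    next
      case True
      then obtain z where z: "poly P z = 0" by blast
      then obtain Q where Q: "P = [:-z, 1:] * Q" by (auto simp: poly_eq_0_iff_dvd dvd_def)
      have Q0: "Q \<noteq> 0" using P0 Q by auto
      \<comment> \<open>A double root would make \<open>f - a\<close> vanish to second order, and
        \<open>z\<close> a critical point over \<open>a\<close>.\<close>
      have "poly Q z \<noteq> 0"
      proof
        assume "poly Q z = 0"
        then obtain S where S: "Q = [:-z, 1:] * S" by (auto simp: poly_eq_0_iff_dvd dvd_def)
        have qz: "poly q z \<noteq> 0" and sm: "sphere_map f (Fin z) = Some (Fin a)" using root[OF z] by auto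
        define h where "h = (\<lambda>w. poly S w / poly q w)"
        obtain D where hD: "(h has_field_derivative D) (at z)"
          unfolding h_def using DERIV_divide[OF poly_DERIV poly_DERIV qz] by blast
        have "isCont (poly q) z" by simp
        then have "\<forall>\<^sub>F w in nhds z. poly q w \<noteq> 0"
          using qz by (simp add: isCont_def tendsto_at_iff_tendsto_nhds tendsto_imp_eventually_ne)
        then have ev: "\<forall>\<^sub>F w in nhds z. f w = a + (w - z)\<^sup>2 * h w"
        proof eventually_elim
          case (elim w)
          have "poly P w = (w - z)\<^sup>2 * poly S w" by (simp add: Q S power2_eq_square algebra_simps)
          then show ?case using elim by (simp add: f_eq h_def)
        qed
        have "deriv f z = deriv (\<lambda>w. a + (w - z)\<^sup>2 * h w) z" using ev by (rule deriv_cong_ev) simp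
        also have "((\<lambda>w. a + (w - z)\<^sup>2 * h w) has_field_derivative 0) (at z)"
          by (auto intro!: derivative_eq_intros hD)
        then have "deriv (\<lambda>w. a + (w - z)\<^sup>2 * h w) z = 0" by (rule DERIV_imp_deriv)
        finally have "deriv f z = 0" .
        moreover have "\<not> is_pole f z" "f z = a" using sm by (auto simp: to_sphere_def split: if_splits)
        ultimately have "a \<in> finite_critical_values f" by (auto simp: finite_critical_values_def)
        then show False using a by blast
      qed
      moreover have "poly Q w \<noteq> 0" if "w \<noteq> z" for w
        using one z that Q by (metis mult_eq_0_iff poly_mult)
      ultimately have "\<not> (\<exists>w. poly Q w = 0)" by metis
      then have "degree Q = 0"
        using fundamental_theorem_of_algebra[of Q] constant_degree[of Q] by blast
      then show ?thesis using Q0 unfolding Q by (subst degree_mult_eq) auto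
    qed
    have pP: "p = P + smult a q" by (simp add: P_def)
    have dq: "degree q \<ge> 2"
    proof (rule ccontr)
      assume "\<not> degree q \<ge> 2"
      then have "degree q \<le> 1" by simp
      then have "degree (smult a q) \<le> 1" using degree_smult_le[of a q] by linarith
      then have "degree p \<le> 1" unfolding pP using dP by (rule degree_add_le[rotated])
      then show False using deg \<open>degree q \<le> 1\<close> by simp
    qed
    have "((\<lambda>z. poly P z / poly q z) \<longlongrightarrow> 0) at_infinity"
      using dP dq by (intro poly_divide_tendsto_0_at_infinity) simp
    then have "((\<lambda>z. a + poly P z / poly q z) \<longlongrightarrow> a + 0) at_infinity" by (intro tendsto_intros)
    then have "((\<lambda>z. Fin (a + poly P z / poly q z)) \<longlongrightarrow> Fin a) at_infinity" by (simp add: tendsto_Fin_iff)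
    then have lim: "(to_sphere f \<longlongrightarrow> Fin a) at_infinity" by (rule Lim_transform_eventually)
         (use eventually_denominator_nonzero in eventually_elim, simp add: to_sphere_def rational_not_pole f_eq)
    then have nt: "\<not> transcendental f" by (auto simp: transcendental_def)
    have mapI: "sphere_map f Infty = Some (Fin a)"
      using tendsto_Lim[OF trivial_limit_at_infinity lim] nt by (simp add: sphere_map_def)
    show thesis
    proof (cases "\<exists>z. poly P z = 0")
      case True
      then show thesis using that root mapI by blast
    next
      case False
      then have "degree P = 0"
        using fundamental_theorem_of_algebra[of P] constant_degree[of P] by blast
      then obtain c where c: "P = [:c:]" by (rule degree_eq_zeroE)
      define g where "g = (\<lambda>w. if w = 0 then a else f (1 / w))"
      \<comment> \<open>At \<open>z = 1 / w\<close> this is the difference quotient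
        \<open>(g w - a) / w\<close>, so its limit is the derivative of \<open>f\<close> at
        infinity.\<close>
      have "((\<lambda>z. poly [:0, c:] z / poly q z) \<longlongrightarrow> 0) at_infinity"
        using dq by (intro poly_divide_tendsto_0_at_infinity) (auto simp: le_less_trans)
      from filterlim_compose[OF this filterlim_inverse_at_infinity]
      have "((\<lambda>w. poly [:0, c:] (inverse w) / poly q (inverse w)) \<longlongrightarrow> 0) (at 0)" .
      moreover have "\<forall>\<^sub>F w in at 0. poly q (inverse w) \<noteq> 0"
        using eventually_denominator_nonzero filterlim_inverse_at_infinity
        by (rule eventually_compose_filterlim)
      then have "\<forall>\<^sub>F w in at 0. poly [:0, c:] (inverse w) / poly q (inverse w) = (g w - g 0) / (w - 0)"
        using eventually_neq_at_within[of 0 0 UNIV]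
        by eventually_elim (simp add: g_def f_eq c field_simps)
      ultimately have "((\<lambda>w. (g w - g 0) / (w - 0)) \<longlongrightarrow> 0) (at 0)"
        by (rule Lim_transform_eventually)
      then have "(g has_field_derivative 0) (at 0)" by (simp add: has_field_derivative_iff)
      then have "deriv g 0 = 0" by (rule DERIV_imp_deriv)
      then have "a \<in> finite_critical_values f"
        using mapI by (auto simp: finite_critical_values_def g_def)
      then show thesis using a by blast
    qed
  qed
qed

text \<open>A count. Each finite Julia point has at least two preimages, all in the Julia set with
  infinity added. A pole lies in that set but maps to infinity, so only as many places remain as
  there are finite Julia points.\<close>

lemma rational_Julia_infinite:
  assumes nF: "Infty \<notin> Fatou f" and crit: "\<And>a. a \<in> Julia f \<Longrightarrow> a \<notin> finite_critical_values f"
  shows "infinite (Julia f)"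
proof
  assume fin: "finite (Julia f)"
  obtain z0 where z0: "is_pole f z0" using rational_no_poles_imp_Infty_Fatou nF by blast
  then have s0: "sphere_map f (Fin z0) = Some Infty" by (simp add: to_sphere_def)
  then have z0J: "z0 \<in> Julia f" using Fatou_forward nF by (auto simp: Julia_def simp del: sphere_map_Fin)
  define S where "S = insert Infty (Fin ` Julia f)"
  define X where "X = (\<lambda>a. {x. sphere_map f x = Some (Fin a)})"
  have XS: "X a \<subseteq> S - {Fin z0}" if a: "a \<in> Julia f" for a
  proof
    fix x assume x: "x \<in> X a"
    then have sx: "sphere_map f x = Some (Fin a)" by (simp add: X_def)
    then have "x \<notin> Fatou f" using Fatou_forward[OF sx] a by (auto simp: Julia_def)
    then have "x \<in> S" by (cases x) (auto simp: S_def Julia_def)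
    moreover have "x \<noteq> Fin z0" using s0 sx by auto
    ultimately show "x \<in> S - {Fin z0}" by blast
  qed
  have finS: "finite S" using fin by (simp add: S_def)
  have cS: "card (S - {Fin z0}) = card (Julia f)"
  proof -
    have "card (Fin ` Julia f) = card (Julia f)" by (rule card_image) (simp add: inj_on_def)
    moreover have "Infty \<notin> Fin ` Julia f" by auto
    ultimately have "card S = Suc (card (Julia f))" using fin by (simp add: S_def)
    moreover have "Fin z0 \<in> S" using z0J by (simp add: S_def)
    ultimately show ?thesis by simp
  qed
  have X2: "card (X a) \<ge> 2" if a: "a \<in> Julia f" for a
  proof -
    obtain x1 x2 where x: "x1 \<noteq> x2" "sphere_map f x1 = Some (Fin a)" "sphere_map f x2 = Some (Fin a)"
      by (rule rational_two_preimages[OF crit[OF a]])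
    have "finite (X a)" using XS[OF a] finS by (meson finite_Diff finite_subset)
    then have "card {x1, x2} \<le> card (X a)" using x by (intro card_mono) (auto simp: X_def)
    then show ?thesis using x(1) by simp
  qed
  have "2 * card (Julia f) = (\<Sum>a\<in>Julia f. 2)" by simp
  also have "\<dots> \<le> (\<Sum>a\<in>Julia f. card (X a))" using X2 by (rule sum_mono)
  also have "\<dots> = card (\<Union>a\<in>Julia f. X a)"
    using fin XS finS by (intro card_UN_disjoint[symmetric]) (auto simp: X_def intro: finite_subset)
  also have "\<dots> \<le> card (S - {Fin z0})" using XS finS by (intro card_mono) auto
  also have "\<dots> = card (Julia f)" by (rule cS)
  finally have "card (Julia f) = 0" by simp
  then show False using fin z0J by simp
qed

end

lemma rational_no_return:
  assumes nt: "\<not> transcendental f" and c: "c > 0"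
    and expand: "\<And>z. z \<in> Julia f \<Longrightarrow> Fin z \<notin> Julia_infty f \<Longrightarrow> cmod (deriv (plane_iter f 1) z) \<ge> c"
    and dense: nonprepoles_dense and unbounded: "\<And>R. R > 0 \<Longrightarrow> \<exists>z\<in>Julia f. norm z > R"
  shows no_return
proof (rule ccontr)
  assume "\<not> no_return"
  obtain y where y: "sphere_map f Infty = Some y" using nontranscendental_dom[OF nt, of 1] by auto
  then obtain v where v: "sphere_map f Infty = Some (Fin v)"
    using \<open>\<not> no_return\<close> by (cases y) (auto simp: no_return_def)
  obtain \<phi> r where rep: "chart_rep (sphere_map f) Infty (Fin v) \<phi> r" by (rule chart_rep_sphere_map[OF v])
  then have r: "r > 0" "\<phi> holomorphic_on ball 0 r"
      "\<And>w. w \<in> ball 0 r \<Longrightarrow> sphere_map f (chart Infty w) = Some (Fin (v + \<phi> w))"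
    by (auto simp: chart_rep_def)
  have d\<phi>: "deriv \<phi> holomorphic_on ball 0 r" using r(2) by (rule holomorphic_deriv) simp
  have dfz: "deriv (plane_iter f 1) z = - deriv \<phi> (inverse z) * (inverse z)\<^sup>2" if z: "norm z > 1 / r" for z
  proof -
    have z0: "z \<noteq> 0" using z r(1) by auto
    have inb: "inverse w \<in> ball 0 r" if "norm w > 1 / r" for w :: complex
    proof -
      have "norm w > 0" using that r(1) by (meson divide_pos_pos less_trans zero_less_one)
      then have "1 / norm w < r" using that r(1) by (simp add: pos_divide_less_eq mult.commute)
      then show ?thesis by (simp add: norm_divide inverse_eq_divide)
    qed
    have "open {w::complex. norm w > 1 / r}" by (intro open_Collect_less continuous_intros)
    then have "\<forall>\<^sub>F w in nhds z. w \<in> {w. norm w > 1 / r}" using z by (intro eventually_nhds_in_open) auto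
    moreover have "\<forall>\<^sub>F w in nhds z. w \<noteq> 0" using z0 by (rule t1_space_nhds)
    ultimately have "\<forall>\<^sub>F w in nhds z. plane_iter f 1 w = v + \<phi> (inverse w)"
    proof eventually_elim
      case (elim w)
      then have "sphere_map f (Fin w) = Some (Fin (v + \<phi> (inverse w)))"
        using r(3)[OF inb, of w] by (simp add: sinv_def inverse_eq_divide)
      then show ?case by (simp add: plane_iter_def del: sphere_map_Fin)
    qed
    then have "deriv (plane_iter f 1) z = deriv (\<lambda>w. v + \<phi> (inverse w)) z"
      by (rule deriv_cong_ev) simp
    also have "(\<phi> has_field_derivative deriv \<phi> (inverse z)) (at (inverse z))"
      using r(2) inb[OF z] by (intro holomorphic_derivI) auto
    then have "((\<lambda>w. \<phi> (inverse w)) has_field_derivative deriv \<phi> (inverse z) * - (inverse z ^ Suc (Suc 0))) (at z)"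
      by (rule DERIV_chain2) (rule DERIV_inverse[OF z0])
    then have "((\<lambda>w. v + \<phi> (inverse w)) has_field_derivative 0 + deriv \<phi> (inverse z) * - (inverse z ^ Suc (Suc 0))) (at z)"
      by (intro DERIV_add DERIV_const)
    then have "deriv (\<lambda>w. v + \<phi> (inverse w)) z = - deriv \<phi> (inverse z) * (inverse z)\<^sup>2"
      by (simp add: DERIV_imp_deriv power2_eq_square)
    finally show ?thesis .
  qed
  have "isCont (deriv \<phi>) 0"
    using holomorphic_on_imp_continuous_on[OF d\<phi>] r(1) by (simp add: continuous_on_eq_continuous_at)
  moreover have inv0: "(inverse \<longlongrightarrow> (0::complex)) at_infinity" by (rule tendsto_inverse_0)
  ultimately have "((\<lambda>z. deriv \<phi> (inverse z)) \<longlongrightarrow> deriv \<phi> 0) at_infinity"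
    by (rule isCont_tendsto_compose)
  then have "((\<lambda>z. - deriv \<phi> (inverse z) * (inverse z)\<^sup>2) \<longlongrightarrow> - deriv \<phi> 0 * 0\<^sup>2) at_infinity"
    by (intro tendsto_intros inv0)
  then have "((\<lambda>z. norm (- deriv \<phi> (inverse z) * (inverse z)\<^sup>2)) \<longlongrightarrow> 0) at_infinity"
    by (intro tendsto_norm_zero) simp
  then have "\<forall>\<^sub>F z in at_infinity. norm (- deriv \<phi> (inverse z) * (inverse z)\<^sup>2) < c"
    using c by (rule order_tendstoD)
  then obtain R where R: "\<And>z. norm z \<ge> R \<Longrightarrow> norm (- deriv \<phi> (inverse z) * (inverse z)\<^sup>2) < c"
    by (auto simp: eventually_at_infinity)
  define R' where "R' = max (max R 1) (1 / r)"
  have "R' > 0" by (simp add: R'_def)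
  then obtain a where a: "a \<in> Julia f" "norm a > R'" using unbounded by blast
  \<comment> \<open>The disk about \<open>a\<close> of this radius lies outside the disk of radius
    \<open>R'\<close> about 0.\<close>
  then obtain z where z: "z \<in> Julia f" "z \<in> ball a (norm a - R')" "Fin z \<notin> Julia_infty f"
    using dense unfolding nonprepoles_dense_def by (meson diff_gt_0_iff_gt)
  have "norm z > R'" using z(2) norm_triangle_ineq2[of a z] by (simp add: dist_norm)
  then have "norm z \<ge> R" "norm z > 1 / r" by (auto simp: R'_def)
  then show False using expand[OF z(1,3)] R[of z] dfz[of z] by simp
qed

section \<open>Assembly of the equivalence\<close>

lemma hyperbolicE:
  assumes "euclidean_hyperbolic f"
  obtains \<epsilon> c \<mu> where "\<epsilon> > 0" "\<And>y a. Fin y \<in> post_singular f \<Longrightarrow> a \<in> Julia f \<Longrightarrow> dist y a \<ge> \<epsilon>"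
    "c > 0" "\<mu> > 1"
    "\<And>n z. z \<in> Julia f \<Longrightarrow> Fin z \<notin> Julia_infty f \<Longrightarrow> cmod (deriv (plane_iter f n) z) \<ge> c * \<mu> ^ n"
proof -
  let ?D = "set_distance {z. Fin z \<in> post_singular f} (Julia f)"
  have "0 < ?D" using assms by (simp add: euclidean_hyperbolic_def)
  \<comment> \<open>The distance may be infinite, so a real number below it is taken.\<close>
  then obtain \<epsilon> where \<epsilon>: "0 < ereal \<epsilon>" "ereal \<epsilon> < ?D" using ereal_dense2 by blast
  have dist: "dist y a \<ge> \<epsilon>" if "Fin y \<in> post_singular f" "a \<in> Julia f" for y a
  proof -
    have "?D \<le> (case (y, a) of (x, y) \<Rightarrow> ereal (dist x y))"
      unfolding set_distance_def by (rule INF_lower) (use that in auto)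
    then have "?D \<le> ereal (dist y a)" by simp
    from less_le_trans[OF \<epsilon>(2) this] show ?thesis by simp
  qed
  obtain c \<mu> where c: "c > 0" "\<mu> > 1"
    "\<forall>n\<ge>1. \<forall>z\<in>Julia f. Fin z \<notin> Julia_infty f \<longrightarrow> cmod (deriv (plane_iter f n) z) \<ge> c * \<mu> ^ n"
    using assms unfolding euclidean_hyperbolic_def by blast
  \<comment> \<open>The minimum with 1 extends (ii) to \<open>n = 0\<close>, where the iterate is
    the identity.\<close>
  have "cmod (deriv (plane_iter f n) z) \<ge> min c 1 * \<mu> ^ n"
    if "z \<in> Julia f" "Fin z \<notin> Julia_infty f" for n z
  proof (cases "n = 0")
    case True
    have "plane_iter f 0 = (\<lambda>z. z)" by (rule ext) (simp add: plane_iter_def)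
    then show ?thesis using True by simp
  next
    case False
    have "min c 1 * \<mu> ^ n \<le> c * \<mu> ^ n" using c by (intro mult_right_mono) auto
    also have "\<dots> \<le> cmod (deriv (plane_iter f n) z)" using c(3) that False by simp
    finally show ?thesis .
  qed
  moreover have "min c 1 > 0" using c(1) by simp
  ultimately show thesis using that[of \<epsilon> "min c 1" \<mu>] \<epsilon>(1) dist c(2) by simp
qed

lemma critical_value_notin_Julia:
  assumes "\<epsilon> > 0" "\<And>y a. Fin y \<in> post_singular f \<Longrightarrow> a \<in> Julia f \<Longrightarrow> dist y a \<ge> \<epsilon>"
    and "a \<in> Julia f"
  shows "a \<notin> finite_critical_values f"
proof
  assume "a \<in> finite_critical_values f"
  then have "a \<in> sing_inv f" unfolding sing_inv_def by (intro subsetD[OF closure_subset]) simp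
  then have "Fin a \<in> (\<lambda>x. the (iter f 0 x)) ` (Fin ` sing_inv f - (\<Union>j<0. preimage f j {Infty}))"
    by simp
  then have "Fin a \<in> (\<Union>n. (\<lambda>x. the (iter f n x)) ` (Fin ` sing_inv f - (\<Union>j<n. preimage f j {Infty})))"
    by (rule UN_I[OF UNIV_I])
  then have "Fin a \<in> post_singular f" unfolding post_singular_def by (rule subsetD[OF closure_subset])
  then show False using assms(2)[of a a] assms(1,3) by simp
qed

lemma hyperbolic_imp_uniformly_expanding:
  assumes hyp: "euclidean_hyperbolic f"
    and rat: "transcendental f \<or> (\<exists>d\<ge>2. rational_of_degree d f)"
  shows "uniformly_expanding f"
proof -
  obtain \<epsilon> c \<mu> where eps: "\<epsilon> > 0" "\<And>y a. Fin y \<in> post_singular f \<Longrightarrow> a \<in> Julia f \<Longrightarrow> dist y a \<ge> \<epsilon>"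
    and c: "c > 0" "\<mu> > 1"
    and ex: "\<And>n z. z \<in> Julia f \<Longrightarrow> Fin z \<notin> Julia_infty f \<Longrightarrow> cmod (deriv (plane_iter f n) z) \<ge> c * \<mu> ^ n"
    by (rule hyperbolicE[OF hyp]) blast
  show ?thesis
  proof (cases "Infty \<in> Fatou f")
    case True
    \<comment> \<open>Julia orbits cannot reach infinity, a Fatou point, so (ii) holds on the whole
      Julia set.\<close>
    have "Fin z \<notin> Julia_infty f" if z: "z \<in> Julia f" for z
    proof
      assume "Fin z \<in> Julia_infty f"
      then obtain n where n: "iter f n (Fin z) = Some Infty" by (auto simp: Julia_infty_def preimage_iff)
      obtain u where "iter f n (Fin z) = Some (Fin u)" by (rule Julia_orbit_finite[OF True z])
      then show False using n by simp
    qed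
    then show ?thesis using compact_Julia_expanding[OF True c] ex by blast
  next
    case nF: False
    \<comment> \<open>For rational \<open>f\<close> the Julia set is unbounded here. This excludes
      isolated prepoles and also supplies the points near infinity for
      \<open>rational_no_return\<close>.\<close>
    have iso: False if nt: "\<not> transcendental f" and R: "R > 0" "\<And>z. norm z > R \<Longrightarrow> z \<notin> Julia f" for R
    proof -
      obtain d where "d \<ge> 2" "rational_of_degree d f" using rat nt by blast
      then obtain p q where pq: "q \<noteq> 0" "coprime p q" "max (degree p) (degree q) = d" "d \<ge> 2"
          "f = (\<lambda>z. poly p z / poly q z)"
        by (auto simp: rational_of_degree_def)
      have "infinite (Julia f)"
        by (rule rational_Julia_infinite[OF pq nF]) (rule critical_value_notin_Julia[OF eps])
      then show False using rational_no_isolated[OF nt _ R] nF by blast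
    qed
    have dense: nonprepoles_dense
    proof (rule ccontr)
      assume "\<not> nonprepoles_dense"
      then obtain b r where b: "b \<in> Julia f" "Fin b \<in> Julia_infty f"
        and r: "r > 0" "\<And>z. z \<in> ball b r \<Longrightarrow> z \<noteq> b \<Longrightarrow> z \<notin> Julia f"
        by (rule nonprepoles_dense_or_isolated) blast
      obtain R where R: "R > 0" "\<And>z. norm z > R \<Longrightarrow> z \<notin> Julia f"
        using isolated_prepole(1)[OF b r] by blast
      show False
      proof (cases "transcendental f")
        case True
        show False by (rule transcendental_no_isolated[OF True eps b R])
      qed (use iso R in blast)
    qed
    have nr: no_return
    proof (cases "transcendental f")
      case False
      show ?thesis
      proof (rule rational_no_return[OF False _ _ dense])
        show "c * \<mu> > 0" using c by simp
        show "cmod (deriv (plane_iter f 1) z) \<ge> c * \<mu>" if "z \<in> Julia f" "Fin z \<notin> Julia_infty f" for z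
          using ex[OF that, of 1] by simp
        show "\<exists>z\<in>Julia f. norm z > R" if "R > 0" for R using iso[OF False that] by blast
      qed
    qed (simp add: no_return_def)
    show ?thesis
    proof (rule branches_imp_expanding)
      show "branches_at n (\<epsilon> / 12) (Koebe_const / c / \<mu> ^ n)" for n
        by (rule no_return_branches[OF nr dense eps c ex])
    qed (use eps c Koebe_const_pos in auto)
  qed
qed

end

text \<open>Off the finitely many zeros of \<open>q\<close> a constant quotient gives
  \<open>p = c q\<close>, hence an identity of polynomials. Then coprimality makes \<open>q\<close>
  a unit and both degrees 0.\<close>

lemma rational_not_constant:
  assumes "rational_of_degree d f" "d \<ge> 2"
  shows "\<not> f constant_on UNIV"
proof
  assume "f constant_on UNIV"
  then obtain c where c: "\<And>z. f z = c" by (auto simp: constant_on_def)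
  obtain p q where pq: "q \<noteq> 0" "coprime p q" "max (degree p) (degree q) = d"
      "f = (\<lambda>z. poly p z / poly q z)"
    using assms(1) by (auto simp: rational_of_degree_def)
  have "poly (p - smult c q) z = 0" if "poly q z \<noteq> 0" for z
    using c[of z] that by (simp add: pq(4) field_simps)
  then have "{z. poly (p - smult c q) z \<noteq> 0} \<subseteq> {z. poly q z = 0}" by auto
  then have fin: "finite {z. poly (p - smult c q) z \<noteq> 0}"
    using poly_roots_finite[OF pq(1)] finite_subset by blast
  have "p - smult c q = 0"
  proof (rule ccontr)
    assume "p - smult c q \<noteq> 0"
    then have "finite {z. poly (p - smult c q) z = 0}" by (rule poly_roots_finite)
    with fin have "finite ({z. poly (p - smult c q) z \<noteq> 0} \<union> {z. poly (p - smult c q) z = 0})" by blast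
    moreover have "{z. poly (p - smult c q) z \<noteq> 0} \<union> {z. poly (p - smult c q) z = 0} = UNIV" by blast
    ultimately have "finite (UNIV :: complex set)" by (simp only:)
    then show False using infinite_UNIV_char_0 by blast
  qed
  then have p: "p = smult c q" by simp
  then have "q dvd p" by (simp add: dvd_smult)
  then have "is_unit q" using pq(2) by (meson coprime_common_divisor dvd_refl)
  then have "degree q = 0" using pq(1) by (simp add: is_unit_iff_degree)
  moreover have "degree p \<le> degree q" using p degree_smult_le by blast
  ultimately show False using pq(3) assms(2) by simp
qed

lemma transcendental_not_constant:
  assumes "f nicely_meromorphic_on UNIV" "transcendental f"
  shows "\<not> f constant_on UNIV"
proof
  assume "f constant_on UNIV"
  then obtain c where c: "f = (\<lambda>z. c)" by (auto simp: constant_on_def)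
  have "\<not> is_pole f z" for z
    unfolding c by (rule analytic_at_imp_no_pole) auto
  then have "to_sphere f = (\<lambda>z. Fin c)" by (rule_tac ext) (simp add: to_sphere_def c)
  then have "(to_sphere f \<longlongrightarrow> Fin c) at_infinity" by simp
  then show False using assms(2) by (auto simp: transcendental_def)
qed

theorem theorem2p4:
  fixes f :: "complex \<Rightarrow> complex"
  assumes "f nicely_meromorphic_on UNIV"
    and "transcendental f \<or> (\<exists>d\<ge>2. rational_of_degree d f)"
  shows "euclidean_hyperbolic f \<longleftrightarrow>
    (\<exists>c>0. \<exists>\<mu>>1. \<exists>\<delta>>0. \<forall>n::nat. \<forall>a\<in>Julia f.
       \<forall>U\<in>components (preimage f n (Fin ` ball a \<delta>)). \<forall>z w :: complex.
         Fin z \<in> U \<and> Fin w \<in> U \<longrightarrow>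
           dist (plane_iter f n z) (plane_iter f n w) \<ge> c * \<mu> ^ n * dist z w)"
proof -
  interpret meromorphic_dynamics f
  proof
    show "\<not> f constant_on UNIV"
      using assms rational_not_constant transcendental_not_constant by blast
  qed (rule assms(1))
  show ?thesis
    unfolding uniformly_expanding_def[symmetric]
    using hyperbolic_imp_uniformly_expanding[OF _ assms(2)] uniformly_expanding_imp_hyperbolic by blast
qed

end
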